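(* Let $\mathcal A$ be a small category, and let $\kappa$ be an (infinite) regular cardinal greater than $\omega\times|\mathcal A|$, where $\omega$ is the smallest infinite cardinal and $|\mathcal A|$ is the cardinality of the set of morphisms of $\mathcal A$. Then the category $\mathbf{CrsGrp}_{\mathcal A}$ of crossed $\mathcal A$-groups is locally $\kappa$-presentable; i.e. it is cocomplete, and every object can be written as a $\kappa$-filtered colimit of $\kappa$-small objects.
   Context: Let $\mathcal A$ be a small category. An $\mathcal A$-set is a presheaf of sets on $\mathcal A$. A crossed $\mathcal A$-group is an $\mathcal A$-set $G$ together with a group structure on $G(a)$ for each $a\in\mathcal A$ and a left action $G(b)\times\mathcal A(a,b)\to\mathcal A(a,b)$, $(x,\varphi)\mapsto\varphi^x$, of the group $G(b)$ on the set $\mathcal A(a,b)$ for all $a,b\in\mathcal A$, such that: (i) for $\varphi:a\to b$, $\psi:b\to c$ in $\mathcal A$ and $x\in G(c)$, $(\psi\varphi)^x=\psi^x\varphi^{\psi^\ast(x)}$; (ii) for $\varphi:a\to b$ in $\mathcal A$ and $x,y\in G(b)$, $\varphi^\ast(xy)=(\varphi^y)^\ast(x)\,\varphi^\ast(y)$. Here $\varphi^\ast:G(b)\to G(a)$ is the presheaf structure map. A map of crossed $\mathcal A$-groups is a map of $\mathcal A$-sets which is degreewise a group homomorphism and respects the actions on the sets $\mathcal A(a,b)$. These form the category $\mathbf{CrsGrp}_{\mathcal A}$. An object $X$ of a category is $\kappa$-small (i.e. $\kappa$-presentable) if the functor $\mathrm{Hom}(X,-)$ preserves $\kappa$-filtered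 colimits. *)

theory Defs
  imports "HOL-Algebra.Group_Action"
begin

unbundle cardinal_syntax

section \<open>Categories, functors, colimits\<close>

record ('o, 'm) category =
  Ob :: "'o set"
  Mor :: "'m set"
  Dom :: "'m \<Rightarrow> 'o"
  Cod :: "'m \<Rightarrow> 'o"
  Ident :: "'o \<Rightarrow> 'm"
  Comp :: "'m \<Rightarrow> 'm \<Rightarrow> 'm"  \<comment> \<open>\<open>Comp C g f\<close> is "\<open>g\<close> after \<open>f\<close>"\<close>

definition Hom :: "('o, 'm) category \<Rightarrow> 'o \<Rightarrow> 'o \<Rightarrow> 'm set" where
  "Hom C a b = {f \<in> Mor C. Dom C f = a \<and> Cod C f = b}"

locale category =
  fixes C :: "('o, 'm) category"
  assumes Dom_in_Ob: "f \<in> Mor C \<Longrightarrow> Dom C f \<in> Ob C"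
    and Cod_in_Ob: "f \<in> Mor C \<Longrightarrow> Cod C f \<in> Ob C"
    and Ident_in_Hom: "a \<in> Ob C \<Longrightarrow> Ident C a \<in> Hom C a a"
    and Comp_in_Hom: "\<lbrakk>f \<in> Hom C a b; g \<in> Hom C b c\<rbrakk> \<Longrightarrow> Comp C g f \<in> Hom C a c"
    and Comp_Ident_right: "f \<in> Hom C a b \<Longrightarrow> Comp C f (Ident C a) = f"
    and Comp_Ident_left: "f \<in> Hom C a b \<Longrightarrow> Comp C (Ident C b) f = f"
    and Comp_assoc: "\<lbrakk>f \<in> Hom C a b; g \<in> Hom C b c; h \<in> Hom C c d\<rbrakk>
          \<Longrightarrow> Comp C h (Comp C g f) = Comp C (Comp C h g) f"

record ('o1, 'm1, 'o2, 'm2) functor_data =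
  FOb :: "'o1 \<Rightarrow> 'o2"
  FMor :: "'m1 \<Rightarrow> 'm2"

definition is_functor ::
  "('o1, 'm1) category \<Rightarrow> ('o2, 'm2) category \<Rightarrow> ('o1, 'm1, 'o2, 'm2) functor_data \<Rightarrow> bool" where
  "is_functor C D F \<longleftrightarrow>
     (\<forall>a\<in>Ob C. FOb F a \<in> Ob D) \<and>
     (\<forall>a b. \<forall>f\<in>Hom C a b. FMor F f \<in> Hom D (FOb F a) (FOb F b)) \<and>
     (\<forall>a\<in>Ob C. FMor F (Ident C a) = Ident D (FOb F a)) \<and>
     (\<forall>a b c. \<forall>f\<in>Hom C a b. \<forall>g\<in>Hom C b c.
        FMor F (Comp C g f) = Comp D (FMor F g) (FMor F f))"

definition comp_functor ::
  "('o2, 'm2, 'o3, 'm3) functor_data \<Rightarrow> ('o1, 'm1, 'o2, 'm2) functor_data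
     \<Rightarrow> ('o1, 'm1, 'o3, 'm3) functor_data" where
  "comp_functor G F = \<lparr>FOb = (\<lambda>a. FOb G (FOb F a)), FMor = (\<lambda>f. FMor G (FMor F f))\<rparr>"

definition is_cocone ::
  "('oj, 'mj) category \<Rightarrow> ('o, 'm) category \<Rightarrow> ('oj, 'mj, 'o, 'm) functor_data
     \<Rightarrow> 'o \<Rightarrow> ('oj \<Rightarrow> 'm) \<Rightarrow> bool" where
  "is_cocone J C F c \<iota> \<longleftrightarrow>
     c \<in> Ob C \<and>
     (\<forall>j\<in>Ob J. \<iota> j \<in> Hom C (FOb F j) c) \<and>
     (\<forall>i j. \<forall>u\<in>Hom J i j. Comp C (\<iota> j) (FMor F u) = \<iota> i)"

definition is_colimit ::
  "('oj, 'mj) category \<Rightarrow> ('o, 'm) category \<Rightarrow> ('oj, 'mj, 'o, 'm) functor_data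
     \<Rightarrow> 'o \<Rightarrow> ('oj \<Rightarrow> 'm) \<Rightarrow> bool" where
  "is_colimit J C F c \<iota> \<longleftrightarrow>
     is_cocone J C F c \<iota> \<and>
     (\<forall>d \<theta>. is_cocone J C F d \<theta> \<longrightarrow>
        (\<exists>!h. h \<in> Hom C c d \<and> (\<forall>j\<in>Ob J. Comp C h (\<iota> j) = \<theta> j)))"

text \<open>
  The category of all sets of elements of the type \<open>'x\<close>; a map from \<open>S\<close> to \<open>T\<close> is a triple
  \<open>(S, f, T)\<close> with \<open>f\<close> extensional.
\<close>

definition set_cat :: "('x set, 'x set \<times> ('x \<Rightarrow> 'x) \<times> 'x set) category" where
  "set_cat =
     \<lparr>Ob = UNIV,
      Mor = {(S, f, T). f \<in> S \<rightarrow>\<^sub>E T},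
      Dom = (\<lambda>(S, f, T). S),
      Cod = (\<lambda>(S, f, T). T),
      Ident = (\<lambda>S. (S, \<lambda>x\<in>S. x, S)),
      Comp = (\<lambda>(S', g, T) (S, f, S''). (S, compose S g f, T))\<rparr>"

definition hom_functor ::
  "('o, 'm) category \<Rightarrow> 'o \<Rightarrow> ('o, 'm, 'm set, 'm set \<times> ('m \<Rightarrow> 'm) \<times> 'm set) functor_data" where
  "hom_functor C X =
     \<lparr>FOb = (\<lambda>Y. Hom C X Y),
      FMor = (\<lambda>f. (Hom C X (Dom C f), \<lambda>g\<in>Hom C X (Dom C f). Comp C f g, Hom C X (Cod C f)))\<rparr>"

section \<open>Size\<close>

text \<open>
  The ambient notion of smallness is given by a cardinal \<open>\<mu>\<close> on a type \<open>'u\<close>: a set is small if it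
  has fewer than \<open>\<mu>\<close> elements, and up to bijection every small set is a subset of \<open>'u\<close>.
  Instead of strong inaccessibility of \<open>\<mu>\<close> (a Grothendieck universe) we only require that \<open>\<mu>\<close> is
  a regular cardinal above \<open>\<kappa>\<close> and that a small set has only a small set of subsets of cardinality
  less than \<open>\<kappa>\<close>.  Every strongly inaccessible \<open>\<mu>\<close> above \<open>\<kappa>\<close> has these properties
  (\<open>inaccessible_size_bound\<close>), but so do cardinals whose existence is provable in HOL
  (\<open>size_bound_cardSuc\<close>).
\<close>

definition small :: "'u rel \<Rightarrow> 'x set \<Rightarrow> bool" where
  "small \<mu> S \<longleftrightarrow> |S| <o \<mu>"

definition size_bound :: "'k rel \<Rightarrow> 'u rel \<Rightarrow> bool" where
  "size_bound \<kappa> \<mu> \<longleftrightarrow>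
     Cinfinite \<mu> \<and> regularCard \<mu> \<and> \<kappa> <o \<mu> \<and>
     (\<forall>S :: 'u set. small \<mu> S \<longrightarrow> small \<mu> {T. T \<subseteq> S \<and> |T| <o \<kappa>})"

lemma inaccessible_size_bound:
  fixes \<kappa> :: "'k rel" and \<mu> :: "'u rel"
  assumes "Cinfinite \<mu>" "regularCard \<mu>" "\<kappa> <o \<mu>"
    and strong_limit: "\<And>S :: 'u set. |S| <o \<mu> \<Longrightarrow> |Pow S| <o \<mu>"
  shows "size_bound \<kappa> \<mu>"
  unfolding size_bound_def small_def
proof (intro conjI allI impI)
  fix S :: "'u set"
  assume "|S| <o \<mu>"
  then have "|Pow S| <o \<mu>" by (rule strong_limit)
  moreover have "|{T. T \<subseteq> S \<and> |T| <o \<kappa>}| \<le>o |Pow S|"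
    by (rule card_of_mono1) auto
  ultimately show "|{T. T \<subseteq> S \<and> |T| <o \<kappa>}| <o \<mu>"
    by (rule ordLeq_ordLess_trans[rotated])
qed (use assms in auto)

lemma size_bound_cardSuc:
  fixes \<kappa> :: "'k rel"
  assumes "Cinfinite \<kappa>"
  shows "size_bound \<kappa> (cardSuc |UNIV :: 'k set set| )"
proof -
  have kle: "\<kappa> \<le>o |UNIV :: 'k set|"
    using assms by (metis card_of_Field_ordIso card_of_mono1 ordIso_ordLeq_trans ordIso_symmetric subset_UNIV)
  have infk: "infinite (UNIV :: 'k set)"
    using assms by (meson cinfinite_def infinite_super subset_UNIV)
  then have Cinf: "Cinfinite |UNIV :: 'k set set|"
    using card_of_Card_order by (simp add: cinfinite_def Finite_Set.finite_set Field_card_of)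
  have "\<kappa> \<le>o |UNIV :: 'k set set|"
    using ordLeq_transitive[OF kle] card_of_Pow[of "UNIV :: 'k set"] ordLess_imp_ordLeq by auto
  then have kless: "\<kappa> <o cardSuc |UNIV :: 'k set set|"
    using cardSuc_greater card_of_Card_order ordLeq_ordLess_trans by metis
  have "|(UNIV :: 'k set) <+> (UNIV :: ('k \<times> 'k) set)| \<le>o |UNIV :: 'k set|"
    using card_of_Plus_infinite1[OF infk, of "UNIV :: ('k \<times> 'k) set"]
      card_of_Times_same_infinite[OF infk] by (simp add: ordIso_imp_ordLeq)
  then obtain e :: "'k + 'k \<times> 'k \<Rightarrow> 'k" where e: "inj e"
    unfolding card_of_ordLeq[symmetric] by auto
  have few: "|{T. T \<subseteq> S \<and> |T| <o \<kappa>}| \<le>o |UNIV :: 'k set set|"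
    if S: "|S| \<le>o |UNIV :: 'k set set|" for S :: "'k set set set"
  proof (cases "S = {}")
    case True
    then have "{T. T \<subseteq> S \<and> |T| <o \<kappa>} \<subseteq> {{}}" by auto
    then show ?thesis
      by (rule ordLeq_transitive[OF card_of_mono1 card_of_singl_ordLeq]) simp
  next
    case False
    then obtain g :: "'k set \<Rightarrow> 'k set set" where g: "g ` UNIV = S"
      using S card_of_ordLeq2[of S "UNIV :: 'k set set"] by auto
    define dec where "dec Q = (\<lambda>k. g {y. e (Inr (k, y)) \<in> Q}) ` {k. e (Inl k) \<in> Q}" for Q
    have "{T. T \<subseteq> S \<and> |T| <o \<kappa>} \<subseteq> range dec"
    proof
      fix T assume "T \<in> {T. T \<subseteq> S \<and> |T| <o \<kappa>}"
      then have T: "T \<subseteq> S" "|T| \<le>o |UNIV :: 'k set|"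
        using ordLeq_transitive[OF ordLess_imp_ordLeq kle] by blast+
      then obtain i :: "'k set set \<Rightarrow> 'k" where i: "inj_on i T"
        unfolding card_of_ordLeq[symmetric] by auto
      have "\<exists>p. \<forall>t\<in>T. g (p t) = t"
        using T(1) g by (intro bchoice) (auto simp: image_iff subset_iff)
      then obtain p where p: "\<And>t. t \<in> T \<Longrightarrow> g (p t) = t" by blast
      define Q where "Q = e ` (Inl ` i ` T \<union> {Inr (i t, y) | t y. t \<in> T \<and> y \<in> p t})"
      have 1: "{k. e (Inl k) \<in> Q} = i ` T"
        using e by (auto simp: Q_def inj_image_mem_iff)
      have "g {y. e (Inr (i t, y)) \<in> Q} = t" if "t \<in> T" for t
      proof -
        have "{y. e (Inr (i t, y)) \<in> Q} = p t"
          using e that i by (auto simp: Q_def inj_image_mem_iff dest: inj_onD)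
        then show ?thesis using p that by simp
      qed
      then have "dec Q = T"
        unfolding dec_def 1 by (simp add: image_image)
      then show "T \<in> range dec" by blast
    qed
    then have "|{T. T \<subseteq> S \<and> |T| <o \<kappa>}| \<le>o |range dec|"
      by (rule card_of_mono1)
    then show ?thesis by (rule ordLeq_transitive[OF _ card_of_image])
  qed
  show ?thesis
    unfolding size_bound_def small_def
  proof (intro conjI allI impI)
    show "cinfinite (cardSuc |UNIV :: 'k set set| )" "Card_order (cardSuc |UNIV :: 'k set set| )"
      using Cinfinite_cardSuc[OF Cinf] by auto
    show "regularCard (cardSuc |UNIV :: 'k set set| )"
      by (rule regularCard_cardSuc[OF Cinf])
    show "\<kappa> <o cardSuc |UNIV :: 'k set set|"
      by (rule kless)
    show "|{T. T \<subseteq> S \<and> |T| <o \<kappa>}| <o cardSuc |UNIV :: 'k set set|"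
      if "|S| <o cardSuc |UNIV :: 'k set set|" for S :: "'k set set set"
      using few[of S] that
        cardSuc_ordLeq_ordLess[OF card_of_Card_order[of "UNIV :: 'k set set"] card_of_Card_order[of S]]
        cardSuc_ordLeq_ordLess[OF card_of_Card_order[of "UNIV :: 'k set set"]
          card_of_Card_order[of "{T. T \<subseteq> S \<and> |T| <o \<kappa>}"]]
      by simp
  qed
qed

text \<open>
  The categories in the next two definitions are taken on the types \<open>'u\<close> and \<open>'k\<close>
  because every category with fewer than \<open>\<mu>\<close> (respectively \<open>\<kappa>\<close>) morphisms is isomorphic to one
  on \<open>'u\<close> (respectively \<open>'k\<close>).
\<close>

definition small_category :: "'u rel \<Rightarrow> ('u, 'u) category \<Rightarrow> bool" where
  "small_category \<mu> J \<longleftrightarrow> category J \<and> small \<mu> (Ob J) \<and> small \<mu> (Mor J)"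

definition filtered :: "'k rel \<Rightarrow> ('o, 'm) category \<Rightarrow> bool" where
  "filtered \<kappa> J \<longleftrightarrow>
     category J \<and>
     (\<forall>(I :: ('k, 'k) category) F.
        category I \<and> |Mor I| <o \<kappa> \<and> is_functor I J F \<longrightarrow> (\<exists>c \<iota>. is_cocone I J F c \<iota>))"

definition cocomplete :: "'u rel \<Rightarrow> ('o, 'm) category \<Rightarrow> bool" where
  "cocomplete \<mu> C \<longleftrightarrow>
     (\<forall>(J :: ('u, 'u) category) F.
        small_category \<mu> J \<and> is_functor J C F \<longrightarrow> (\<exists>c \<iota>. is_colimit J C F c \<iota>))"

definition preserves_colimits ::
  "('oj, 'mj) category \<Rightarrow> ('o1, 'm1) category \<Rightarrow> ('o2, 'm2) category
     \<Rightarrow> ('o1, 'm1, 'o2, 'm2) functor_data \<Rightarrow> bool" where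
  "preserves_colimits J C D G \<longleftrightarrow>
     (\<forall>F c \<iota>. is_functor J C F \<and> is_colimit J C F c \<iota> \<longrightarrow>
        is_colimit J D (comp_functor G F) (FOb G c) (\<lambda>j. FMor G (\<iota> j)))"

text \<open>
  \<open>Hom(X, -)\<close> takes values in the sets of morphisms of \<open>C\<close>. Colimits in \<^const>\<open>set_cat\<close> on this type
  are colimits of sets in the usual sense, since a cocone of sets is a colimit as soon as it has the
  universal property with respect to some set with at least two elements.
\<close>

definition small_object :: "'u rel \<Rightarrow> 'k rel \<Rightarrow> ('o, 'm) category \<Rightarrow> 'o \<Rightarrow> bool" where
  "small_object \<mu> \<kappa> C X \<longleftrightarrow>
     X \<in> Ob C \<and>
     (\<forall>J :: ('u, 'u) category. small_category \<mu> J \<and> filtered \<kappa> J \<longrightarrow>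
        preserves_colimits J C set_cat (hom_functor C X))"

definition locally_presentable :: "'u rel \<Rightarrow> 'k rel \<Rightarrow> ('o, 'm) category \<Rightarrow> bool" where
  "locally_presentable \<mu> \<kappa> C \<longleftrightarrow>
     category C \<and> cocomplete \<mu> C \<and>
     (\<forall>X\<in>Ob C. \<exists>(J :: ('u, 'u) category) F \<iota>.
        small_category \<mu> J \<and> filtered \<kappa> J \<and> is_functor J C F \<and>
        (\<forall>j\<in>Ob J. small_object \<mu> \<kappa> C (FOb F j)) \<and>
        is_colimit J C F X \<iota>)"

section \<open>Crossed groups\<close>

locale presheaf = category A
  for A :: "('o, 'm) category" +
  fixes X :: "'o \<Rightarrow> 'x set" and r :: "'m \<Rightarrow> 'x \<Rightarrow> 'x"
  assumes restr_closed: "\<lbrakk>\<phi> \<in> Hom A a b; x \<in> X b\<rbrakk> \<Longrightarrow> r \<phi> x \<in> X a"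
    and restr_Ident: "\<lbrakk>a \<in> Ob A; x \<in> X a\<rbrakk> \<Longrightarrow> r (Ident A a) x = x"
    and restr_Comp: "\<lbrakk>\<phi> \<in> Hom A a b; \<psi> \<in> Hom A b c; x \<in> X c\<rbrakk>
          \<Longrightarrow> r (Comp A \<psi> \<phi>) x = r \<phi> (r \<psi> x)"

text \<open>
  For \<open>\<phi> : a \<rightarrow> b\<close>, \<open>pull G \<phi>\<close> is the structure map \<open>\<phi>\<^sup>* : G(b) \<rightarrow> G(a)\<close>, and \<open>act G x \<phi>\<close> is
  \<open>\<phi>\<^sup>x\<close> for \<open>x \<in> G(b)\<close>; the group \<open>G(b)\<close> in which \<open>x\<close> is taken is determined by \<open>\<phi>\<close>.
\<close>

record ('o, 'm, 'u) crossed_group =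
  grp :: "'o \<Rightarrow> 'u monoid"
  pull :: "'m \<Rightarrow> 'u \<Rightarrow> 'u"
  act :: "'u \<Rightarrow> 'm \<Rightarrow> 'm"

locale crossed_group = presheaf A "\<lambda>a. carrier (grp G a)" "pull G"
  for A :: "('o, 'm) category" and G :: "('o, 'm, 'u) crossed_group" +
  assumes group_grp: "a \<in> Ob A \<Longrightarrow> group (grp G a)"
    and group_action_act: "\<lbrakk>a \<in> Ob A; b \<in> Ob A\<rbrakk>
          \<Longrightarrow> group_action (grp G b) (Hom A a b) (\<lambda>x. restrict (act G x) (Hom A a b))"
    and act_Comp: "\<lbrakk>\<phi> \<in> Hom A a b; \<psi> \<in> Hom A b c; x \<in> carrier (grp G c)\<rbrakk>
          \<Longrightarrow> act G x (Comp A \<psi> \<phi>) = Comp A (act G x \<psi>) (act G (pull G \<psi> x) \<phi>)"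
    and pull_mult: "\<lbrakk>\<phi> \<in> Hom A a b; x \<in> carrier (grp G b); y \<in> carrier (grp G b)\<rbrakk>
          \<Longrightarrow> pull G \<phi> (x \<otimes>\<^bsub>grp G b\<^esub> y) = pull G (act G y \<phi>) x \<otimes>\<^bsub>grp G a\<^esub> pull G \<phi> y"

definition crossed_group_map ::
  "('o, 'm) category \<Rightarrow> ('o, 'm, 'u) crossed_group \<Rightarrow> ('o, 'm, 'u) crossed_group
     \<Rightarrow> ('o \<Rightarrow> 'u \<Rightarrow> 'u) \<Rightarrow> bool" where
  "crossed_group_map A G H f \<longleftrightarrow>
     (\<forall>a\<in>Ob A. f a \<in> hom (grp G a) (grp H a)) \<and>
     (\<forall>a b. \<forall>\<phi>\<in>Hom A a b. \<forall>x\<in>carrier (grp G b).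
        f a (pull G \<phi> x) = pull H \<phi> (f b x) \<and> act H (f b x) \<phi> = act G x \<phi>)"

text \<open>
  The category of crossed groups with small underlying sets, taken as subsets of \<open>'u\<close>. As in
  \<^const>\<open>set_cat\<close>, a morphism is a triple whose middle component is extensional in both arguments.
\<close>

definition CrsGrp ::
  "'u rel \<Rightarrow> ('o, 'm) category
     \<Rightarrow> (('o, 'm, 'u) crossed_group,
         ('o, 'm, 'u) crossed_group \<times> ('o \<Rightarrow> 'u \<Rightarrow> 'u) \<times> ('o, 'm, 'u) crossed_group) category" where
  "CrsGrp \<mu> A =
     (let Obs = {G. crossed_group A G \<and> (\<forall>a\<in>Ob A. small \<mu> (carrier (grp G a)))} in
      \<lparr>Ob = Obs,
       Mor = {(G, f, H). G \<in> Obs \<and> H \<in> Obs \<and> crossed_group_map A G H f \<and>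
                f \<in> extensional (Ob A) \<and> (\<forall>a\<in>Ob A. f a \<in> extensional (carrier (grp G a)))},
       Dom = (\<lambda>(G, f, H). G),
       Cod = (\<lambda>(G, f, H). H),
       Ident = (\<lambda>G. (G, \<lambda>a\<in>Ob A. \<lambda>x\<in>carrier (grp G a). x, G)),
       Comp = (\<lambda>(G', g, H) (G, f, G'').
                 (G, \<lambda>a\<in>Ob A. compose (carrier (grp G a)) (g a) (f a), H))\<rparr>)"

end

theory Submission
  imports Defs
begin

text \<open>
  Every element of a crossed group built from a diagram \<open>G j\<close> is a product of elements of the \<open>G j\<close>,
  because axiom (ii) pulls a product back to a product. So a colimit is the set of words in the
  elements of the \<open>G j\<close> modulo the congruence generated by the relations of the \<open>G j\<close> and of the
  diagram; axioms (i) and (ii) extend the action and the structure maps to words.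

  If the diagram is filtered, congruent words become equal when they are evaluated at a late enough
  stage. So every element of a filtered colimit comes from some stage, and elements that are
  identified in the colimit are identified at some stage. A homomorphism from \<open>X\<close>, where \<open>X\<close> has
  fewer than \<open>\<kappa>\<close> elements in total, is determined by fewer than \<open>\<kappa>\<close> elements subject to fewer
  than \<open>\<kappa>\<close> equations, so it factors through a stage of any \<open>\<kappa>\<close>-filtered colimit, essentially
  uniquely.

  Finally, fewer than \<open>\<kappa>\<close> elements of a crossed group generate a crossed subgroup with fewer than
  \<open>\<kappa>\<close> elements, as \<open>\<kappa>\<close> exceeds \<open>\<omega>\<close> and the number of morphisms of \<open>A\<close>. So every crossed group is
  the \<open>\<kappa>\<close>-directed union of such subgroups. If \<open>A\<close> is empty then \<open>\<kappa> = \<omega>\<close> is possible, but then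
  crossed groups have no elements at all.
\<close>

text \<open>Types shape much of the work. Carriers must lie in \<open>'u\<close>, and
  \<open>filtered\<close> only speaks about test categories on \<open>'k\<close>. So classes of
  words, shapes of diagrams and the poset of crossed subgroups are all coded through injections
  supplied by \<open>small_embed\<close>. Two features of the axioms keep the algebra light. The
  action takes values in the fixed category \<open>A\<close> and maps preserve it exactly, so it
  never has to be matched by passing to a later stage. It also moves morphisms and not group
  elements, so generating a subgroup involves only the group operations and the structure maps.
  Filtered colimits are not built a second time. The word construction serves every small diagram,
  and a given colimit is compared with it by the universal property; directedness of the index
  category enters only when congruences of words are analysed. The two cardinals have separate
  tasks: \<open>\<mu>\<close> bounds the sets of words and of subgroups, \<open>\<kappa>\<close>
  bounds the elements and equations of a single small object. Uncountability of
  \<open>\<kappa>\<close> pays for the countable iteration in \<open>generated\<close>.\<close>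

lemma HomD:
  assumes "f \<in> Hom C a b"
  shows "f \<in> Mor C" "Dom C f = a" "Cod C f = b"
  using assms by (auto simp: Hom_def)

lemma (in category) Hom_Ob:
  assumes "f \<in> Hom C a b"
  shows "a \<in> Ob C" "b \<in> Ob C"
  using assms Dom_in_Ob Cod_in_Ob by (auto simp: Hom_def)

text \<open>\<open>group_action\<close> means a homomorphism into \<open>BijGroup\<close>, whose
  elements are extensional bijections. Bijectivity is not assumed: by \<open>mult\<close> and
  \<open>one\<close>, the inverse of \<open>x\<close> acts as a two-sided inverse of
  \<open>t x\<close>.\<close>

lemma group_actionI:
  assumes "group G"
    and closed: "\<And>x e. \<lbrakk>x \<in> carrier G; e \<in> E\<rbrakk> \<Longrightarrow> t x e \<in> E"
    and one: "\<And>e. e \<in> E \<Longrightarrow> t \<one>\<^bsub>G\<^esub> e = e"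
    and mult: "\<And>x y e. \<lbrakk>x \<in> carrier G; y \<in> carrier G; e \<in> E\<rbrakk> \<Longrightarrow> t (x \<otimes>\<^bsub>G\<^esub> y) e = t x (t y e)"
  shows "group_action G E (\<lambda>x. restrict (t x) E)"
proof -
  interpret G: group G by fact
  have bij: "restrict (t x) E \<in> Bij E" if x: "x \<in> carrier G" for x
  proof -
    have "t (inv\<^bsub>G\<^esub> x) (t x e) = e" "t x (t (inv\<^bsub>G\<^esub> x) e) = e" if "e \<in> E" for e
      using that x by (simp_all add: mult[symmetric] one)
    then have "bij_betw (t x) E E"
      using x by (intro bij_betw_byWitness[where f' = "t (inv\<^bsub>G\<^esub> x)"]) (auto intro: closed)
    then show ?thesis
      by (simp add: Bij_def)
  qed
  have "restrict (t (x \<otimes>\<^bsub>G\<^esub> y)) E = compose E (restrict (t x) E) (restrict (t y) E)"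
    if "x \<in> carrier G" "y \<in> carrier G" for x y
    using that by (auto simp: compose_def restrict_def closed mult)
  then show ?thesis
    using bij group_BijGroup[of E]
    by (auto simp: group_action_def group_hom_def group_hom_axioms_def hom_def BijGroup_def
        G.is_group)
qed

section \<open>Crossed groups\<close>

context crossed_group
begin

lemma act_closed:
  assumes "\<phi> \<in> Hom A a b" "x \<in> carrier (grp G b)"
  shows "act G x \<phi> \<in> Hom A a b"
  using group_action.element_image[OF group_action_act[OF Hom_Ob[OF assms(1)]] assms(2,1)] assms(1)
  by simp

lemma act_one:
  assumes "\<phi> \<in> Hom A a b"
  shows "act G \<one>\<^bsub>grp G b\<^esub> \<phi> = \<phi>"
  using fun_cong[OF group_action.id_eq_one[OF group_action_act[OF Hom_Ob[OF assms]]], of \<phi>] assms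
  by simp

lemma act_mult:
  assumes "\<phi> \<in> Hom A a b" "x \<in> carrier (grp G b)" "y \<in> carrier (grp G b)"
  shows "act G (x \<otimes>\<^bsub>grp G b\<^esub> y) \<phi> = act G x (act G y \<phi>)"
  using group_action.composition_rule[OF group_action_act[OF Hom_Ob[OF assms(1)]] assms(1,2,3)]
    assms act_closed
  by simp

text \<open>Axiom (i) applied to the composite of the identity with the image \<open>?\<phi>\<close>
  of the identity under the inverse of \<open>x\<close>: since \<open>x\<close> sends
  \<open>?\<phi>\<close> back to the identity, the equation collapses to the claim.\<close>

lemma act_Ident:
  assumes "a \<in> Ob A" and x: "x \<in> carrier (grp G a)"
  shows "act G x (Ident A a) = Ident A a"
proof -
  interpret group "grp G a" using assms(1) by (rule group_grp)
  let ?i = "Ident A a" and ?\<phi> = "act G (inv\<^bsub>grp G a\<^esub> x) (Ident A a)"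
  have i: "?i \<in> Hom A a a" using assms(1) by (rule Ident_in_Hom)
  then have \<phi>: "?\<phi> \<in> Hom A a a" using x by (intro act_closed) auto
  have id: "act G x ?\<phi> = ?i"
    using act_mult[OF i x inv_closed[OF x]] act_one[OF i] x by simp
  have "act G x ?\<phi> = Comp A (act G x ?i) (act G x ?\<phi>)"
    using act_Comp[OF \<phi> i x] Comp_Ident_left[OF \<phi>] restr_Ident[OF assms] by simp
  then show ?thesis
    using Comp_Ident_right[OF act_closed[OF i x]] id by simp
qed

text \<open>Structure maps are not homomorphisms, but the unit acts trivially, so axiom (ii) makes
  the image of the unit idempotent.\<close>

lemma pull_one:
  assumes "\<phi> \<in> Hom A a b"
  shows "pull G \<phi> \<one>\<^bsub>grp G b\<^esub> = \<one>\<^bsub>grp G a\<^esub>"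
proof -
  note ab = Hom_Ob[OF assms]
  interpret a: group "grp G a" using ab(1) by (rule group_grp)
  interpret b: group "grp G b" using ab(2) by (rule group_grp)
  have "pull G \<phi> \<one>\<^bsub>grp G b\<^esub> \<otimes>\<^bsub>grp G a\<^esub> pull G \<phi> \<one>\<^bsub>grp G b\<^esub> = pull G \<phi> \<one>\<^bsub>grp G b\<^esub>"
    using pull_mult[OF assms b.one_closed b.one_closed] act_one[OF assms] by simp
  then show ?thesis
    using restr_closed[OF assms b.one_closed] by (simp add: a.l_cancel_one)
qed

end

lemma crossed_groupI:
  assumes "category A"
    and grp: "\<And>a. a \<in> Ob A \<Longrightarrow> group (grp G a)"
    and pull: "\<And>a b \<phi> x. \<lbrakk>\<phi> \<in> Hom A a b; x \<in> carrier (grp G b)\<rbrakk> \<Longrightarrow> pull G \<phi> x \<in> carrier (grp G a)"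
    and pull_Ident: "\<And>a x. \<lbrakk>a \<in> Ob A; x \<in> carrier (grp G a)\<rbrakk> \<Longrightarrow> pull G (Ident A a) x = x"
    and pull_Comp: "\<And>a b c \<phi> \<psi> x. \<lbrakk>\<phi> \<in> Hom A a b; \<psi> \<in> Hom A b c; x \<in> carrier (grp G c)\<rbrakk>
          \<Longrightarrow> pull G (Comp A \<psi> \<phi>) x = pull G \<phi> (pull G \<psi> x)"
    and act: "\<And>a b \<phi> x. \<lbrakk>\<phi> \<in> Hom A a b; x \<in> carrier (grp G b)\<rbrakk> \<Longrightarrow> act G x \<phi> \<in> Hom A a b"
    and act_one: "\<And>a b \<phi>. \<phi> \<in> Hom A a b \<Longrightarrow> act G \<one>\<^bsub>grp G b\<^esub> \<phi> = \<phi>"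
    and act_mult: "\<And>a b \<phi> x y. \<lbrakk>\<phi> \<in> Hom A a b; x \<in> carrier (grp G b); y \<in> carrier (grp G b)\<rbrakk>
          \<Longrightarrow> act G (x \<otimes>\<^bsub>grp G b\<^esub> y) \<phi> = act G x (act G y \<phi>)"
    and act_Comp: "\<And>a b c \<phi> \<psi> x. \<lbrakk>\<phi> \<in> Hom A a b; \<psi> \<in> Hom A b c; x \<in> carrier (grp G c)\<rbrakk>
          \<Longrightarrow> act G x (Comp A \<psi> \<phi>) = Comp A (act G x \<psi>) (act G (pull G \<psi> x) \<phi>)"
    and pull_mult: "\<And>a b \<phi> x y. \<lbrakk>\<phi> \<in> Hom A a b; x \<in> carrier (grp G b); y \<in> carrier (grp G b)\<rbrakk>
          \<Longrightarrow> pull G \<phi> (x \<otimes>\<^bsub>grp G b\<^esub> y) = pull G (act G y \<phi>) x \<otimes>\<^bsub>grp G a\<^esub> pull G \<phi> y"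
  shows "crossed_group A G"
proof -
  interpret category A by fact
  have "group_action (grp G b) (Hom A a b) (\<lambda>x. restrict (act G x) (Hom A a b))"
    if "a \<in> Ob A" "b \<in> Ob A" for a b
    using that by (intro group_actionI grp act act_one act_mult)
  then show ?thesis
    using assms
    by (intro crossed_group.intro presheaf.intro presheaf_axioms.intro crossed_group_axioms.intro)
      blast+
qed

lemma crossed_group_mapD:
  assumes "crossed_group_map A G H f"
  shows "\<lbrakk>a \<in> Ob A; x \<in> carrier (grp G a)\<rbrakk> \<Longrightarrow> f a x \<in> carrier (grp H a)"
    and "\<lbrakk>a \<in> Ob A; x \<in> carrier (grp G a); y \<in> carrier (grp G a)\<rbrakk>
          \<Longrightarrow> f a (x \<otimes>\<^bsub>grp G a\<^esub> y) = f a x \<otimes>\<^bsub>grp H a\<^esub> f a y"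
    and "\<lbrakk>\<phi> \<in> Hom A a b; x \<in> carrier (grp G b)\<rbrakk> \<Longrightarrow> f a (pull G \<phi> x) = pull H \<phi> (f b x)"
    and "\<lbrakk>\<phi> \<in> Hom A a b; x \<in> carrier (grp G b)\<rbrakk> \<Longrightarrow> act H (f b x) \<phi> = act G x \<phi>"
  using assms unfolding crossed_group_map_def hom_def by blast+

lemma crossed_group_mapI:
  assumes "\<And>a x. \<lbrakk>a \<in> Ob A; x \<in> carrier (grp G a)\<rbrakk> \<Longrightarrow> f a x \<in> carrier (grp H a)"
    and "\<And>a x y. \<lbrakk>a \<in> Ob A; x \<in> carrier (grp G a); y \<in> carrier (grp G a)\<rbrakk>
          \<Longrightarrow> f a (x \<otimes>\<^bsub>grp G a\<^esub> y) = f a x \<otimes>\<^bsub>grp H a\<^esub> f a y"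
    and "\<And>a b \<phi> x. \<lbrakk>\<phi> \<in> Hom A a b; x \<in> carrier (grp G b)\<rbrakk> \<Longrightarrow> f a (pull G \<phi> x) = pull H \<phi> (f b x)"
    and "\<And>a b \<phi> x. \<lbrakk>\<phi> \<in> Hom A a b; x \<in> carrier (grp G b)\<rbrakk> \<Longrightarrow> act H (f b x) \<phi> = act G x \<phi>"
  shows "crossed_group_map A G H f"
  using assms unfolding crossed_group_map_def hom_def by blast

lemma crossed_group_map_one:
  assumes "crossed_group_map A G H f" "crossed_group A G" "crossed_group A H" "a \<in> Ob A"
  shows "f a \<one>\<^bsub>grp G a\<^esub> = \<one>\<^bsub>grp H a\<^esub>"
proof -
  have "group_hom (grp G a) (grp H a) (f a)"
    using assms crossed_group.group_grp
    by (auto simp: group_hom_def group_hom_axioms_def crossed_group_map_def)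
  then show ?thesis by (rule group_hom.hom_one)
qed

section \<open>The category of crossed groups\<close>

abbreviation fam :: "'g \<times> ('o \<Rightarrow> 'u \<Rightarrow> 'u) \<times> 'g \<Rightarrow> 'o \<Rightarrow> 'u \<Rightarrow> 'u" where
  "fam M \<equiv> fst (snd M)"

text \<open>Truncation outside the carriers turns any family satisfying
  \<open>crossed_group_map\<close> into a morphism, so that maps can be given by plain
  formulas.\<close>

definition crs_mor ::
  "('o, 'm) category \<Rightarrow> ('o, 'm, 'u) crossed_group \<Rightarrow> ('o, 'm, 'u) crossed_group
     \<Rightarrow> ('o \<Rightarrow> 'u \<Rightarrow> 'u)
     \<Rightarrow> ('o, 'm, 'u) crossed_group \<times> ('o \<Rightarrow> 'u \<Rightarrow> 'u) \<times> ('o, 'm, 'u) crossed_group" where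
  "crs_mor A G H f = (G, \<lambda>a\<in>Ob A. \<lambda>x\<in>carrier (grp G a). f a x, H)"

lemma Ob_CrsGrp:
  "G \<in> Ob (CrsGrp \<mu> A) \<longleftrightarrow> crossed_group A G \<and> (\<forall>a\<in>Ob A. small \<mu> (carrier (grp G a)))"
  by (simp add: CrsGrp_def)

lemma Hom_CrsGrp:
  "M \<in> Hom (CrsGrp \<mu> A) G H \<longleftrightarrow>
     G \<in> Ob (CrsGrp \<mu> A) \<and> H \<in> Ob (CrsGrp \<mu> A) \<and> fst M = G \<and> snd (snd M) = H \<and>
     crossed_group_map A G H (fam M) \<and> fam M \<in> extensional (Ob A) \<and>
     (\<forall>a\<in>Ob A. fam M a \<in> extensional (carrier (grp G a)))"
  by (cases M) (auto simp: Hom_def CrsGrp_def)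

lemma Comp_CrsGrp:
  "Comp (CrsGrp \<mu> A) N M =
     (fst M, \<lambda>a\<in>Ob A. compose (carrier (grp (fst M) a)) (fam N a) (fam M a), snd (snd N))"
  by (cases M, cases N) (simp add: CrsGrp_def)

lemma Ident_CrsGrp: "Ident (CrsGrp \<mu> A) G = crs_mor A G G (\<lambda>a x. x)"
  by (simp add: CrsGrp_def crs_mor_def)

lemma Hom_CrsGrpD:
  assumes "M \<in> Hom (CrsGrp \<mu> A) G H"
  shows "G \<in> Ob (CrsGrp \<mu> A)" "H \<in> Ob (CrsGrp \<mu> A)" "crossed_group A G" "crossed_group A H"
    "crossed_group_map A G H (fam M)"
  using assms by (auto simp: Hom_CrsGrp Ob_CrsGrp)

lemma Hom_CrsGrp_eqI:
  assumes M: "M \<in> Hom (CrsGrp \<mu> A) G H" and N: "N \<in> Hom (CrsGrp \<mu> A) G H"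
    and eq: "\<And>a x. \<lbrakk>a \<in> Ob A; x \<in> carrier (grp G a)\<rbrakk> \<Longrightarrow> fam M a x = fam N a x"
  shows "M = N"
proof -
  have "fam M = fam N"
  proof (rule extensionalityI)
    show "fam M a = fam N a" if "a \<in> Ob A" for a
      using M N that by (intro extensionalityI[of _ "carrier (grp G a)"]) (auto simp: Hom_CrsGrp eq)
  qed (use M N in \<open>auto simp: Hom_CrsGrp\<close>)
  then show ?thesis
    using M N by (auto simp: Hom_CrsGrp prod_eq_iff)
qed

lemma crs_mor_apply:
  "\<lbrakk>a \<in> Ob A; x \<in> carrier (grp G a)\<rbrakk> \<Longrightarrow> fam (crs_mor A G H f) a x = f a x"
  by (simp add: crs_mor_def)

lemma crs_mor_in_Hom:
  assumes G: "G \<in> Ob (CrsGrp \<mu> A)" and H: "H \<in> Ob (CrsGrp \<mu> A)" and f: "crossed_group_map A G H f"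
  shows "crs_mor A G H f \<in> Hom (CrsGrp \<mu> A) G H"
proof -
  interpret crossed_group A G using G by (simp add: Ob_CrsGrp)
  have "crossed_group_map A G H (fam (crs_mor A G H f))"
  proof (rule crossed_group_mapI, goal_cases)
    case (2 a x y)
    then show ?case
      using crossed_group_mapD[OF f] group.is_monoid[OF group_grp] monoid.m_closed
      by (fastforce simp: crs_mor_apply)
  qed (use crossed_group_mapD[OF f] Hom_Ob restr_closed in \<open>auto simp: crs_mor_apply\<close>)
  then show ?thesis
    using assms by (auto simp: Hom_CrsGrp crs_mor_def)
qed

lemma Comp_CrsGrp_apply:
  assumes "M \<in> Hom (CrsGrp \<mu> A) G H" "a \<in> Ob A" "x \<in> carrier (grp G a)"
  shows "fam (Comp (CrsGrp \<mu> A) N M) a x = fam N a (fam M a x)"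
  using assms by (auto simp: Comp_CrsGrp Hom_CrsGrp compose_def)

lemma Ident_CrsGrp_apply:
  assumes "a \<in> Ob A" "x \<in> carrier (grp G a)"
  shows "fam (Ident (CrsGrp \<mu> A) G) a x = x"
  using assms by (simp add: Ident_CrsGrp crs_mor_apply)

lemma Comp_CrsGrp_in_Hom:
  assumes M: "M \<in> Hom (CrsGrp \<mu> A) G H" and N: "N \<in> Hom (CrsGrp \<mu> A) H K"
  shows "Comp (CrsGrp \<mu> A) N M \<in> Hom (CrsGrp \<mu> A) G K"
proof -
  note m = crossed_group_mapD[OF Hom_CrsGrpD(5)[OF M]]
  note n = crossed_group_mapD[OF Hom_CrsGrpD(5)[OF N]]
  interpret crossed_group A G using Hom_CrsGrpD[OF M] by simp
  have "crossed_group_map A G K (\<lambda>a x. fam N a (fam M a x))"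
    using m n Hom_Ob by (intro crossed_group_mapI) simp_all
  from crs_mor_in_Hom[OF Hom_CrsGrpD(1)[OF M] Hom_CrsGrpD(2)[OF N] this]
  show ?thesis
    using M N by (simp add: Hom_CrsGrp crs_mor_def Comp_CrsGrp compose_def)
qed

lemma category_CrsGrp:
  assumes "category A"
  shows "category (CrsGrp \<mu> A)"
proof
  show Id: "Ident (CrsGrp \<mu> A) G \<in> Hom (CrsGrp \<mu> A) G G" if "G \<in> Ob (CrsGrp \<mu> A)" for G
  proof -
    have "crossed_group_map A G G (\<lambda>a x. x)"
      by (intro crossed_group_mapI) auto
    from crs_mor_in_Hom[OF that that this] show ?thesis
      by (simp add: Ident_CrsGrp)
  qed
  show "Comp (CrsGrp \<mu> A) M (Ident (CrsGrp \<mu> A) G) = M" if M: "M \<in> Hom (CrsGrp \<mu> A) G H" for M G H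
    using Id[OF Hom_CrsGrpD(1)[OF M]] M
    by (intro Hom_CrsGrp_eqI[OF Comp_CrsGrp_in_Hom])
      (auto simp: Comp_CrsGrp_apply Ident_CrsGrp_apply)
  show "Comp (CrsGrp \<mu> A) (Ident (CrsGrp \<mu> A) H) M = M" if M: "M \<in> Hom (CrsGrp \<mu> A) G H" for M G H
    using Id[OF Hom_CrsGrpD(2)[OF M]] M crossed_group_mapD(1)[OF Hom_CrsGrpD(5)[OF M]]
    by (intro Hom_CrsGrp_eqI[OF Comp_CrsGrp_in_Hom])
      (auto simp: Comp_CrsGrp_apply Ident_CrsGrp_apply)
  show "Comp (CrsGrp \<mu> A) P (Comp (CrsGrp \<mu> A) N M) = Comp (CrsGrp \<mu> A) (Comp (CrsGrp \<mu> A) P N) M"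
    if M: "M \<in> Hom (CrsGrp \<mu> A) G H" and N: "N \<in> Hom (CrsGrp \<mu> A) H K"
      and P: "P \<in> Hom (CrsGrp \<mu> A) K L" for M N P G H K L
    using Comp_CrsGrp_in_Hom[OF M N] Comp_CrsGrp_in_Hom[OF N P]
      crossed_group_mapD(1)[OF Hom_CrsGrpD(5)[OF M]]
    by (intro Hom_CrsGrp_eqI[OF Comp_CrsGrp_in_Hom[OF _ P] Comp_CrsGrp_in_Hom[OF M]])
      (auto simp: Comp_CrsGrp_apply[OF M] Comp_CrsGrp_apply[OF N] Comp_CrsGrp_apply)
  show "Dom (CrsGrp \<mu> A) M \<in> Ob (CrsGrp \<mu> A)" "Cod (CrsGrp \<mu> A) M \<in> Ob (CrsGrp \<mu> A)"
    if "M \<in> Mor (CrsGrp \<mu> A)" for M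
    using that by (auto simp: CrsGrp_def)
qed (rule Comp_CrsGrp_in_Hom)

section \<open>Cardinals\<close>

text \<open>One locale for two uses: \<open>\<kappa>\<close> measures the presenting objects,
  \<open>\<mu>\<close> the ambient sets.\<close>

locale regular_cardinal =
  fixes r :: "'r rel"
  assumes Cinfinite: "Cinfinite r" and regular: "regularCard r"
begin

lemma small_subset: "small r T \<Longrightarrow> S \<subseteq> T \<Longrightarrow> small r S"
  unfolding small_def by (rule ordLeq_ordLess_trans[OF card_of_mono1])

lemma small_image: "small r S \<Longrightarrow> small r (f ` S)"
  unfolding small_def by (rule ordLeq_ordLess_trans[OF card_of_image])

lemma small_inj_on: "inj_on f S \<Longrightarrow> small r (f ` S) \<Longrightarrow> small r S"
  unfolding small_def
  using card_of_ordLeqI[of f S "f ` S"] ordLeq_ordLess_trans by blast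

lemma small_UN:
  assumes "small r I" "\<And>i. i \<in> I \<Longrightarrow> small r (S i)"
  shows "small r (\<Union>i\<in>I. S i)"
  using assms Cinfinite regular unfolding small_def cinfinite_def
  by (intro stable_UNION regularCard_stable) auto

lemma small_finite: "finite S \<Longrightarrow> small r S"
  unfolding small_def using Cinfinite
  by (metis Cfinite_ordLess_Cinfinite card_of_Card_order cfinite_def Field_card_of)

lemma small_Un: "small r S \<Longrightarrow> small r T \<Longrightarrow> small r (S \<union> T)"
  using small_UN[of UNIV "\<lambda>b. if b then S else T"] small_finite[of "UNIV :: bool set"]
  by (simp add: UNIV_bool Un_commute)

lemma small_Sigma:
  assumes "small r S" "\<And>x. x \<in> S \<Longrightarrow> small r (T x)"
  shows "small r (Sigma S T)"
proof -
  have "Sigma S T = (\<Union>x\<in>S. Pair x ` T x)" by auto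
  then show ?thesis using assms by (simp add: small_UN small_image)
qed

text \<open>Every object is the domain of its identity, so \<open>Dom\<close> maps the morphisms
  onto the objects.\<close>

lemma small_Ob:
  assumes "category C" "small r (Mor C)"
  shows "small r (Ob C)"
proof (rule small_subset[OF small_image[OF assms(2), of "Dom C"]], rule subsetI)
  fix a assume "a \<in> Ob C"
  then show "a \<in> Dom C ` Mor C"
    using category.Ident_in_Hom[OF assms(1), of a]
    by (intro image_eqI[of a "Dom C" "Ident C a"]) (auto simp: Hom_def)
qed

lemma small_less:
  assumes "r <o s" "small r S"
  shows "small s S"
  using assms ordLess_transitive unfolding small_def by blast

text \<open>Strictness of \<open>natLeq <o r\<close> pays for the union over all lengths; already
  the lists over a single letter are countably infinite.\<close>

lemma small_lists:
  assumes "natLeq <o r" "small r S"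
  shows "small r (lists S)"
proof -
  have "small r {l \<in> lists S. length l = n}" for n
  proof (induction n)
    case 0
    have "{l \<in> lists S. length l = 0} \<subseteq> {[]}" by auto
    then show ?case by (rule small_subset[OF small_finite, rotated]) simp
  next
    case (Suc n)
    have "{l \<in> lists S. length l = Suc n} = (\<lambda>(x, l). x # l) ` (S \<times> {l \<in> lists S. length l = n})"
      by (auto simp: image_iff length_Suc_conv)
    then show ?case using assms(2) Suc by (simp add: small_image small_Sigma)
  qed
  moreover have "small r (UNIV :: nat set)"
    unfolding small_def using card_of_nat assms(1) ordIso_ordLess_trans by blast
  moreover have "lists S = (\<Union>n. {l \<in> lists S. length l = n})" by auto
  ultimately show ?thesis by (metis (no_types, lifting) small_UN)
qed

lemma small_embed:
  fixes S :: "'x set"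
  assumes "small r S"
  obtains e :: "'x \<Rightarrow> 'r" where "inj_on e S"
proof -
  have "|S| \<le>o |Field r|"
    using assms Cinfinite unfolding small_def
    by (meson card_of_Field_ordIso ordIso_symmetric ordLess_imp_ordLeq ordLess_ordIso_trans)
  then show ?thesis using that unfolding card_of_ordLeq[symmetric] by blast
qed

end

section \<open>Colimits of crossed groups\<close>

text \<open>Elementwise form of a functor to crossed groups, free of size conditions and of the
  triples of \<open>CrsGrp\<close>. The algebra of words needs no more than this.\<close>

locale crs_diagram = A: category A + J: category J
  for A :: "('o, 'm) category" and J :: "('j, 'n) category" +
  fixes G :: "'j \<Rightarrow> ('o, 'm, 'u) crossed_group" and D :: "'n \<Rightarrow> 'o \<Rightarrow> 'u \<Rightarrow> 'u"
  assumes crossed: "j \<in> Ob J \<Longrightarrow> crossed_group A (G j)"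
    and D_map: "u \<in> Hom J i j \<Longrightarrow> crossed_group_map A (G i) (G j) (D u)"
    and D_Ident: "\<lbrakk>j \<in> Ob J; a \<in> Ob A; x \<in> carrier (grp (G j) a)\<rbrakk> \<Longrightarrow> D (Ident J j) a x = x"
    and D_Comp: "\<lbrakk>u \<in> Hom J i j; v \<in> Hom J j k; a \<in> Ob A; x \<in> carrier (grp (G i) a)\<rbrakk>
          \<Longrightarrow> D (Comp J v u) a x = D v a (D u a x)"
begin

lemmas D_closed = crossed_group_mapD(1)[OF D_map]
  and D_mult = crossed_group_mapD(2)[OF D_map]
  and D_pull = crossed_group_mapD(3)[OF D_map]
  and D_act = crossed_group_mapD(4)[OF D_map]

lemma D_one:
  assumes "u \<in> Hom J i j" "a \<in> Ob A"
  shows "D u a \<one>\<^bsub>grp (G i) a\<^esub> = \<one>\<^bsub>grp (G j) a\<^esub>"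
  using assms by (intro crossed_group_map_one[OF D_map] crossed) (auto dest: J.Hom_Ob)

lemma group_G: "\<lbrakk>j \<in> Ob J; a \<in> Ob A\<rbrakk> \<Longrightarrow> group (grp (G j) a)"
  by (rule crossed_group.group_grp[OF crossed])

lemma monoid_G: "\<lbrakk>j \<in> Ob J; a \<in> Ob A\<rbrakk> \<Longrightarrow> monoid (grp (G j) a)"
  using group_G group.is_monoid by blast

section \<open>Words in the elements of a diagram, their action and their pullbacks\<close>

definition letters :: "'o \<Rightarrow> ('j \<times> 'u) set" where
  "letters a = (SIGMA j:Ob J. carrier (grp (G j) a))"

definition words :: "'o \<Rightarrow> ('j \<times> 'u) list set" where
  "words a = lists (letters a)"

lemma words_simps [simp]:
  "[] \<in> words a"
  "l # w \<in> words a \<longleftrightarrow> l \<in> letters a \<and> w \<in> words a"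
  "v @ w \<in> words a \<longleftrightarrow> v \<in> words a \<and> w \<in> words a"
  by (auto simp: words_def)

lemma mem_letters [simp]: "(j, x) \<in> letters a \<longleftrightarrow> j \<in> Ob J \<and> x \<in> carrier (grp (G j) a)"
  by (simp add: letters_def)

text \<open>
  By \<open>\<phi>\<^sup>*(xy) = (\<phi>\<^sup>y)\<^sup>*(x) \<phi>\<^sup>*(y)\<close>, a word is pulled back letter by letter from the right. Words need no
  letters for inverses, and structure maps need not be adjoined freely: both exist in each \<open>G j\<close>.
\<close>

fun wact :: "('j \<times> 'u) list \<Rightarrow> 'm \<Rightarrow> 'm" where
  "wact [] \<phi> = \<phi>"
| "wact ((j, x) # w) \<phi> = act (G j) x (wact w \<phi>)"

fun wpull :: "'m \<Rightarrow> ('j \<times> 'u) list \<Rightarrow> ('j \<times> 'u) list" where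
  "wpull \<phi> [] = []"
| "wpull \<phi> ((j, x) # w) = (j, pull (G j) (wact w \<phi>) x) # wpull \<phi> w"

lemma wact_closed: "\<lbrakk>\<phi> \<in> Hom A a b; w \<in> words b\<rbrakk> \<Longrightarrow> wact w \<phi> \<in> Hom A a b"
  by (induction w) (auto intro: crossed_group.act_closed[OF crossed])

lemma wpull_closed: "\<lbrakk>\<phi> \<in> Hom A a b; w \<in> words b\<rbrakk> \<Longrightarrow> wpull \<phi> w \<in> words a"
proof (induction w)
  case (Cons l w)
  obtain j x where l: "l = (j, x)" by (cases l)
  then interpret crossed_group A "G j" using Cons.prems by (auto intro: crossed)
  show ?case using Cons l wact_closed[OF Cons.prems(1)] by (auto intro: restr_closed)
qed simp

lemma wact_append: "wact (v @ w) \<phi> = wact v (wact w \<phi>)"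
  by (induction v) auto

lemma wpull_append: "wpull \<phi> (v @ w) = wpull (wact w \<phi>) v @ wpull \<phi> w"
  by (induction v) (auto simp: wact_append)

lemma wact_Ident: "\<lbrakk>a \<in> Ob A; w \<in> words a\<rbrakk> \<Longrightarrow> wact w (Ident A a) = Ident A a"
  by (induction w) (auto simp: crossed_group.act_Ident[OF crossed])

lemma wpull_Ident: "\<lbrakk>a \<in> Ob A; w \<in> words a\<rbrakk> \<Longrightarrow> wpull (Ident A a) w = w"
proof (induction w)
  case (Cons l w)
  obtain j x where l: "l = (j, x)" by (cases l)
  then interpret crossed_group A "G j" using Cons.prems by (auto intro: crossed)
  show ?case using Cons l by (auto simp: wact_Ident restr_Ident)
qed simp

text \<open>Axiom (i) letter by letter. It asks for the letter \<open>x\<close> to be pulled back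
  along \<open>wact w \<psi>\<close>, which is the letter that \<open>wpull\<close> puts in its
  place.\<close>

lemma wact_Comp:
  assumes "\<phi> \<in> Hom A a b" "\<psi> \<in> Hom A b c" "w \<in> words c"
  shows "wact w (Comp A \<psi> \<phi>) = Comp A (wact w \<psi>) (wact (wpull \<psi> w) \<phi>)"
  using assms(3)
proof (induction w)
  case (Cons l w)
  obtain j x where l: "l = (j, x)" by (cases l)
  then interpret crossed_group A "G j" using Cons.prems by (auto intro: crossed)
  have "wact w \<psi> \<in> Hom A b c" "wact (wpull \<psi> w) \<phi> \<in> Hom A a b"
    using Cons.prems assms by (auto intro: wact_closed wpull_closed)
  then show ?case
    using Cons l by (auto simp: act_Comp)
qed simp

text \<open>The head letter is pulled back along \<open>wact w (Comp A \<psi> \<phi>)\<close>;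
  \<open>wact_Comp\<close> splits this morphism, and functoriality of \<open>pull\<close> in
  \<open>G j\<close> does the rest.\<close>

lemma wpull_Comp:
  assumes "\<phi> \<in> Hom A a b" "\<psi> \<in> Hom A b c" "w \<in> words c"
  shows "wpull (Comp A \<psi> \<phi>) w = wpull \<phi> (wpull \<psi> w)"
  using assms(3)
proof (induction w)
  case (Cons l w)
  obtain j x where l: "l = (j, x)" by (cases l)
  then interpret crossed_group A "G j" using Cons.prems by (auto intro: crossed)
  have "wact w \<psi> \<in> Hom A b c" "wact (wpull \<psi> w) \<phi> \<in> Hom A a b"
    using Cons.prems assms by (auto intro: wact_closed wpull_closed)
  then show ?case
    using Cons l assms by (auto simp: wact_Comp restr_Comp)
qed simp

section \<open>The congruence on words\<close>

inductive rel :: "'o \<Rightarrow> ('j \<times> 'u) list \<Rightarrow> ('j \<times> 'u) list \<Rightarrow> bool" for a where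
  rel_map: "\<lbrakk>u \<in> Hom J i j; x \<in> carrier (grp (G i) a)\<rbrakk> \<Longrightarrow> rel a [(i, x)] [(j, D u a x)]"
| rel_mult: "\<lbrakk>j \<in> Ob J; x \<in> carrier (grp (G j) a); y \<in> carrier (grp (G j) a)\<rbrakk>
    \<Longrightarrow> rel a [(j, x), (j, y)] [(j, x \<otimes>\<^bsub>grp (G j) a\<^esub> y)]"
| rel_one: "j \<in> Ob J \<Longrightarrow> rel a [(j, \<one>\<^bsub>grp (G j) a\<^esub>)] []"

lemma rel_words:
  assumes "rel a l r" "a \<in> Ob A"
  shows "l \<in> words a" "r \<in> words a"
  using assms monoid.m_closed[OF monoid_G] monoid.one_closed[OF monoid_G] D_closed J.Hom_Ob
  by (auto elim!: rel.cases)

lemma rel_wact: "\<lbrakk>rel b l r; \<phi> \<in> Hom A a b\<rbrakk> \<Longrightarrow> wact l \<phi> = wact r \<phi>"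
  by (auto elim!: rel.cases
      simp: D_act crossed_group.act_mult[OF crossed] crossed_group.act_one[OF crossed])

text \<open>A generating relation pulls back to a generating relation of the same kind. For products
  this is axiom (ii), with the left factor pulled back along the morphism moved by the right
  one.\<close>

lemma rel_wpull:
  assumes "rel b l r" and \<phi>: "\<phi> \<in> Hom A a b"
  shows "rel a (wpull \<phi> l) (wpull \<phi> r)"
  using assms(1)
proof cases
  case (rel_map u i j x)
  interpret crossed_group A "G i" using J.Hom_Ob[OF rel_map(3)] by (auto intro: crossed)
  show ?thesis
    using rel.rel_map[OF rel_map(3) restr_closed[OF \<phi> rel_map(4)]] rel_map D_pull[OF rel_map(3) \<phi>]
    by simp
next
  case (rel_mult j x y)
  interpret crossed_group A "G j" using rel_mult by (auto intro: crossed)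
  show ?thesis
    using rel.rel_mult[OF rel_mult(3) restr_closed[OF act_closed[OF \<phi> rel_mult(5)] rel_mult(4)]
        restr_closed[OF \<phi> rel_mult(5)]] rel_mult
    by (simp add: pull_mult[OF \<phi>])
next
  case (rel_one j)
  then show ?thesis using rel.rel_one[of j a] by (simp add: crossed_group.pull_one[OF crossed \<phi>])
qed

text \<open>Closure under structure maps is not imposed but proved in \<open>cong_wpull\<close>.
  Every induction over the congruence therefore stays within a single object
  \<open>a\<close>.\<close>

inductive cong :: "'o \<Rightarrow> ('j \<times> 'u) list \<Rightarrow> ('j \<times> 'u) list \<Rightarrow> bool" for a where
  cong_refl: "w \<in> words a \<Longrightarrow> cong a w w"
| cong_sym: "cong a v w \<Longrightarrow> cong a w v"
| cong_trans: "\<lbrakk>cong a v w; cong a w z\<rbrakk> \<Longrightarrow> cong a v z"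
| cong_rel: "\<lbrakk>rel a l r; p \<in> words a; q \<in> words a\<rbrakk> \<Longrightarrow> cong a (p @ l @ q) (p @ r @ q)"

lemma rel_cong: "rel a l r \<Longrightarrow> cong a l r"
  using cong_rel[of a l r "[]" "[]"] by simp

lemma cong_words:
  assumes "cong a v w" "a \<in> Ob A"
  shows "v \<in> words a \<and> w \<in> words a"
  using assms by induction (auto dest: rel_words)

lemma cong_context: "\<lbrakk>cong a v w; p \<in> words a; q \<in> words a\<rbrakk> \<Longrightarrow> cong a (p @ v @ q) (p @ w @ q)"
proof (induction rule: cong.induct)
  case (cong_rel l r p' q')
  then show ?case using cong.cong_rel[of a l r "p @ p'" "q' @ q"] by simp
qed (auto intro: cong.intros)

lemma cong_append:
  assumes "cong a v v'" "cong a w w'" "a \<in> Ob A"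
  shows "cong a (v @ w) (v' @ w')"
  using cong_context[OF assms(1), of "[]" w] cong_context[OF assms(2), of v' "[]"]
    cong_words[OF assms(1,3)] cong_words[OF assms(2,3)]
  by (auto intro: cong_trans)

lemma cong_wact: "\<lbrakk>cong b v w; \<phi> \<in> Hom A a b\<rbrakk> \<Longrightarrow> wact v \<phi> = wact w \<phi>"
  by (induction rule: cong.induct) (auto simp: wact_append dest: rel_wact wact_closed)

lemma cong_wpull:
  assumes "cong b v w" and \<phi>: "\<phi> \<in> Hom A a b"
  shows "cong a (wpull \<phi> v) (wpull \<phi> w)"
  using assms(1)
proof induction
  case (cong_rel l r p q)
  \<comment> \<open>The right context acts first, so the relation itself is pulled back along
    \<open>wact q \<phi>\<close>. The left context \<open>p\<close> is pulled back along the same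
    morphism on both sides, by \<open>rel_wact\<close>.\<close>
  have *: "wact q \<phi> \<in> Hom A a b" using \<phi> cong_rel by (auto intro: wact_closed)
  then have "wact r (wact q \<phi>) \<in> Hom A a b"
    using rel_words[OF cong_rel(1)] A.Hom_Ob[OF \<phi>] by (auto intro: wact_closed)
  with * show ?case
    using cong.cong_rel[OF rel_wpull[OF cong_rel(1) *]] cong_rel \<phi>
    by (auto simp: wpull_append wact_append wpull_closed rel_wact[OF cong_rel(1) *])
qed (use \<phi> wpull_closed in \<open>auto intro: cong.intros\<close>)

text \<open>The inverse of a word consists of the inverses of its letters in reverse order;
  \<open>rel_mult\<close> followed by \<open>rel_one\<close> cancels each adjacent pair. Left
  inverses are all that \<open>groupI\<close> asks for.\<close>

lemma cong_left_inverse: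
  assumes "w \<in> words a" "a \<in> Ob A"
  shows "\<exists>v\<in>words a. cong a (v @ w) []"
  using assms(1)
proof (induction w)
  case Nil
  then show ?case by (intro bexI[of _ "[]"]) (auto intro: cong_refl)
next
  case (Cons l w)
  obtain j x where l: "l = (j, x)" by (cases l)
  then have j: "j \<in> Ob J" and x: "x \<in> carrier (grp (G j) a)" using Cons.prems by auto
  interpret group "grp (G j) a" using j assms(2) by (rule group_G)
  obtain v where v: "v \<in> words a" "cong a (v @ w) []"
    using Cons by auto
  let ?y = "inv\<^bsub>grp (G j) a\<^esub> x"
  have "cong a [(j, ?y), (j, x)] []"
    using cong_trans[OF rel_cong[OF rel_mult[OF j inv_closed[OF x] x]]] rel_cong[OF rel_one[OF j]] x
    by simp
  from cong_context[OF this v(1)] have "cong a ((v @ [(j, ?y)]) @ (l # w)) (v @ w)"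
    using Cons.prems l by auto
  then have "cong a ((v @ [(j, ?y)]) @ (l # w)) []"
    using v(2) by (rule cong_trans)
  then show ?case
    using v(1) j x by (intro bexI[of _ "v @ [(j, ?y)]"]) auto
qed

section \<open>Evaluation of words in a cocone\<close>

definition cocone :: "('o, 'm, 'u) crossed_group \<Rightarrow> ('j \<Rightarrow> 'o \<Rightarrow> 'u \<Rightarrow> 'u) \<Rightarrow> bool" where
  "cocone H \<theta> \<longleftrightarrow> crossed_group A H \<and> (\<forall>j\<in>Ob J. crossed_group_map A (G j) H (\<theta> j)) \<and>
     (\<forall>i j. \<forall>u\<in>Hom J i j. \<forall>a\<in>Ob A. \<forall>x\<in>carrier (grp (G i) a). \<theta> j a (D u a x) = \<theta> i a x)"

fun weval :: "('o, 'm, 'u) crossed_group \<Rightarrow> ('j \<Rightarrow> 'o \<Rightarrow> 'u \<Rightarrow> 'u) \<Rightarrow> 'o \<Rightarrow> ('j \<times> 'u) list \<Rightarrow> 'u" where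
  "weval H \<theta> a [] = \<one>\<^bsub>grp H a\<^esub>"
| "weval H \<theta> a ((j, x) # w) = \<theta> j a x \<otimes>\<^bsub>grp H a\<^esub> weval H \<theta> a w"

context
  fixes H \<theta>
  assumes cocone: "cocone H \<theta>"
begin

interpretation H: crossed_group A H
  using cocone by (simp add: cocone_def)

lemma monoid_H: "a \<in> Ob A \<Longrightarrow> monoid (grp H a)"
  using H.group_grp group.is_monoid by blast

lemma cocone_map: "j \<in> Ob J \<Longrightarrow> crossed_group_map A (G j) H (\<theta> j)"
  using cocone by (simp add: cocone_def)

lemma weval_closed: "\<lbrakk>w \<in> words a; a \<in> Ob A\<rbrakk> \<Longrightarrow> weval H \<theta> a w \<in> carrier (grp H a)"
  by (induction w)
    (auto simp: monoid.one_closed[OF monoid_H] monoid.m_closed[OF monoid_H]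
      crossed_group_mapD(1)[OF cocone_map])

lemma weval_append:
  assumes "v \<in> words a" "w \<in> words a" "a \<in> Ob A"
  shows "weval H \<theta> a (v @ w) = weval H \<theta> a v \<otimes>\<^bsub>grp H a\<^esub> weval H \<theta> a w"
  using assms(1)
proof (induction v)
  case Nil
  then show ?case using assms by (simp add: monoid.l_one[OF monoid_H] weval_closed)
next
  case (Cons l v)
  then show ?case
    using assms
    by (cases l) (auto simp: monoid.m_assoc[OF monoid_H] weval_closed crossed_group_mapD(1)[OF cocone_map])
qed

text \<open>The legs preserve actions exactly, so the action of a product of legs can be read off
  from the word.\<close>

lemma weval_act: "\<lbrakk>\<phi> \<in> Hom A a b; w \<in> words b\<rbrakk> \<Longrightarrow> act H (weval H \<theta> b w) \<phi> = wact w \<phi>"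
proof (induction w)
  case (Cons l w)
  then show ?case
    using A.Hom_Ob[OF Cons.prems(1)]
    by (cases l) (auto simp: H.act_mult weval_closed crossed_group_mapD(1)[OF cocone_map]
        crossed_group_mapD(4)[OF cocone_map wact_closed])
qed (simp add: H.act_one)

text \<open>Axiom (ii) in \<open>H\<close> pulls the head back along the morphism moved by the value
  of the tail; \<open>weval_act\<close> identifies that morphism with the one used in
  \<open>wpull\<close>.\<close>

lemma weval_pull:
  "\<lbrakk>\<phi> \<in> Hom A a b; w \<in> words b\<rbrakk> \<Longrightarrow> weval H \<theta> a (wpull \<phi> w) = pull H \<phi> (weval H \<theta> b w)"
proof (induction w)
  case (Cons l w)
  then show ?case
    using A.Hom_Ob[OF Cons.prems(1)]
    by (cases l) (auto simp: H.pull_mult weval_closed weval_act crossed_group_mapD(1)[OF cocone_map]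
        crossed_group_mapD(3)[OF cocone_map wact_closed])
qed (simp add: H.pull_one)

lemma weval_rel:
  assumes "rel a l r" "a \<in> Ob A"
  shows "weval H \<theta> a l = weval H \<theta> a r"
  using assms(1)
proof cases
  case (rel_map u i j x)
  then show ?thesis using cocone assms(2) by (simp add: cocone_def)
next
  case (rel_mult j x y)
  then show ?thesis
    using assms(2) crossed_group_mapD(1,2)[OF cocone_map[OF rel_mult(3)]]
    by (simp add: monoid.r_one[OF monoid_H] monoid.m_closed[OF monoid_H])
next
  case (rel_one j)
  then show ?thesis
    using assms(2) crossed_group_map_one[OF cocone_map crossed H.crossed_group_axioms]
    by (simp add: monoid.r_one[OF monoid_H] monoid.one_closed[OF monoid_H])
qed

lemma weval_cong: "\<lbrakk>cong a v w; a \<in> Ob A\<rbrakk> \<Longrightarrow> weval H \<theta> a v = weval H \<theta> a w"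
proof (induction rule: cong.induct)
  case (cong_rel l r p q)
  then show ?case by (simp add: weval_append weval_rel[OF cong_rel(1)] rel_words[OF cong_rel(1)])
qed auto

end

end

section \<open>The quotient of the words as a crossed group\<close>

locale crs_diagram_code = crs_diagram A J G D
  for A :: "('o, 'm) category" and J :: "('j, 'n) category"
    and G :: "'j \<Rightarrow> ('o, 'm, 'u) crossed_group" and D :: "'n \<Rightarrow> 'o \<Rightarrow> 'u \<Rightarrow> 'u" +
  fixes e :: "'o \<Rightarrow> ('j \<times> 'u) list \<Rightarrow> 'u"
  assumes inj_e: "a \<in> Ob A \<Longrightarrow> inj_on (e a) (words a)"
begin

text \<open>A congruence class cannot itself be an element of a carrier, since carriers lie in
  \<open>'u\<close>. It is replaced by the code of a chosen representative, which depends only on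
  the predicate \<open>cong a w\<close> and hence only on the class.\<close>

definition cls :: "'o \<Rightarrow> ('j \<times> 'u) list \<Rightarrow> 'u" where
  "cls a w = e a (SOME v. cong a w v)"

definition rep :: "'o \<Rightarrow> 'u \<Rightarrow> ('j \<times> 'u) list" where
  "rep a = inv_into (words a) (cls a)"

text \<open>One element of \<open>'u\<close> may code classes over several objects;
  \<open>Cod A \<phi>\<close> tells which class is meant in \<open>pull\<close> and
  \<open>act\<close>.\<close>

definition colim :: "('o, 'm, 'u) crossed_group" where
  "colim = \<lparr>grp = (\<lambda>a. \<lparr>carrier = cls a ` words a, mult = (\<lambda>s t. cls a (rep a s @ rep a t)), one = cls a []\<rparr>),
     pull = (\<lambda>\<phi> s. cls (Dom A \<phi>) (wpull \<phi> (rep (Cod A \<phi>) s))),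
     act = (\<lambda>s \<phi>. wact (rep (Cod A \<phi>) s) \<phi>)\<rparr>"

definition coproj :: "'j \<Rightarrow> 'o \<Rightarrow> 'u \<Rightarrow> 'u" where
  "coproj j a x = cls a [(j, x)]"

lemma cls_eq_iff:
  assumes "v \<in> words a" "w \<in> words a" "a \<in> Ob A"
  shows "cls a v = cls a w \<longleftrightarrow> cong a v w"
proof
  have *: "cong a u (SOME v. cong a u v)" if "u \<in> words a" for u
    using someI[of "cong a u" u] cong_refl[OF that] .
  assume "cls a v = cls a w"
  then have "(SOME u. cong a v u) = (SOME u. cong a w u)"
    using inj_onD[OF inj_e[OF assms(3)]] * assms cong_words unfolding cls_def by blast
  then show "cong a v w"
    using *[OF assms(1)] *[OF assms(2)] by (metis cong_sym cong_trans)
next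
  assume "cong a v w"
  then have "cong a v = cong a w"
    by (auto intro!: ext intro: cong_sym cong_trans)
  then show "cls a v = cls a w" by (simp add: cls_def)
qed

lemma rep_cls:
  assumes "w \<in> words a" "a \<in> Ob A"
  shows "rep a (cls a w) \<in> words a" "cong a (rep a (cls a w)) w"
proof -
  have *: "cls a w \<in> cls a ` words a" using assms by simp
  show "rep a (cls a w) \<in> words a"
    unfolding rep_def by (rule inv_into_into[OF *])
  then show "cong a (rep a (cls a w)) w"
    using f_inv_into_f[OF *] assms by (simp add: cls_eq_iff[symmetric] rep_def)
qed

lemma carrier_colim: "carrier (grp colim a) = cls a ` words a"
  and one_colim: "\<one>\<^bsub>grp colim a\<^esub> = cls a []"
  by (simp_all add: colim_def)

lemma mult_colim:
  assumes "v \<in> words a" "w \<in> words a" "a \<in> Ob A"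
  shows "cls a v \<otimes>\<^bsub>grp colim a\<^esub> cls a w = cls a (v @ w)"
  using assms by (auto simp: colim_def cls_eq_iff rep_cls intro: cong_append)

lemma pull_colim:
  assumes "\<phi> \<in> Hom A a b" "w \<in> words b"
  shows "pull colim \<phi> (cls b w) = cls a (wpull \<phi> w)"
  using cong_wpull[OF rep_cls(2)[OF assms(2)] assms(1)] assms A.Hom_Ob[OF assms(1)] HomD[OF assms(1)]
  by (simp add: colim_def cls_eq_iff rep_cls(1) wpull_closed[OF assms(1)])

lemma act_colim:
  assumes "\<phi> \<in> Hom A a b" "w \<in> words b"
  shows "act colim (cls b w) \<phi> = wact w \<phi>"
  using assms A.Hom_Ob[OF assms(1)] HomD[OF assms(1)]
  by (simp add: colim_def cong_wact[OF rep_cls(2)])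

lemma group_colim:
  assumes a: "a \<in> Ob A"
  shows "group (grp colim a)"
proof (rule groupI)
  fix s assume "s \<in> carrier (grp colim a)"
  then obtain w where w: "w \<in> words a" "s = cls a w" by (auto simp: carrier_colim)
  then show "\<one>\<^bsub>grp colim a\<^esub> \<otimes>\<^bsub>grp colim a\<^esub> s = s"
    using a by (simp add: one_colim mult_colim)
  obtain v where v: "v \<in> words a" "cong a (v @ w) []"
    using cong_left_inverse[OF w(1) a] by blast
  then show "\<exists>t\<in>carrier (grp colim a). t \<otimes>\<^bsub>grp colim a\<^esub> s = \<one>\<^bsub>grp colim a\<^esub>"
    using w a by (intro bexI[of _ "cls a v"]) (auto simp: carrier_colim one_colim mult_colim cls_eq_iff)
qed (use a in \<open>auto simp: carrier_colim one_colim mult_colim\<close>)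

lemma crossed_group_colim: "crossed_group A colim"
proof (rule crossed_groupI)
  fix a assume "a \<in> Ob A"
  then show "group (grp colim a)" by (rule group_colim)
  fix s assume "s \<in> carrier (grp colim a)"
  then show "pull colim (Ident A a) s = s"
    using \<open>a \<in> Ob A\<close>
    by (auto simp: carrier_colim pull_colim[OF A.Ident_in_Hom] wpull_Ident)
next
  fix a b \<phi> assume \<phi>: "\<phi> \<in> Hom A a b"
  note ab = A.Hom_Ob[OF \<phi>]
  show "act colim \<one>\<^bsub>grp colim b\<^esub> \<phi> = \<phi>"
    by (simp add: one_colim act_colim[OF \<phi>])
  fix s assume "s \<in> carrier (grp colim b)"
  then obtain v where v: "v \<in> words b" "s = cls b v" by (auto simp: carrier_colim)
  then show "pull colim \<phi> s \<in> carrier (grp colim a)" "act colim s \<phi> \<in> Hom A a b"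
    by (simp_all add: carrier_colim pull_colim[OF \<phi>] act_colim[OF \<phi>] wpull_closed[OF \<phi>] wact_closed[OF \<phi>])
  fix t assume "t \<in> carrier (grp colim b)"
  then obtain w where w: "w \<in> words b" "t = cls b w" by (auto simp: carrier_colim)
  have \<phi>w: "wact w \<phi> \<in> Hom A a b" using w(1) by (rule wact_closed[OF \<phi>])
  show "act colim (s \<otimes>\<^bsub>grp colim b\<^esub> t) \<phi> = act colim s (act colim t \<phi>)"
    using v w ab by (simp add: mult_colim act_colim[OF \<phi>] act_colim[OF \<phi>w] wact_append)
  show "pull colim \<phi> (s \<otimes>\<^bsub>grp colim b\<^esub> t) = pull colim (act colim t \<phi>) s \<otimes>\<^bsub>grp colim a\<^esub> pull colim \<phi> t"
    using v w ab
    by (simp add: mult_colim act_colim[OF \<phi>] pull_colim[OF \<phi>] pull_colim[OF \<phi>w] wpull_append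
        wpull_closed[OF \<phi>] wpull_closed[OF \<phi>w])
next
  fix a b c \<phi> \<psi> s
  assume \<phi>: "\<phi> \<in> Hom A a b" and \<psi>: "\<psi> \<in> Hom A b c" and "s \<in> carrier (grp colim c)"
  then obtain w where w: "w \<in> words c" "s = cls c w" by (auto simp: carrier_colim)
  have \<psi>\<phi>: "Comp A \<psi> \<phi> \<in> Hom A a c" using \<phi> \<psi> by (rule A.Comp_in_Hom)
  show "pull colim (Comp A \<psi> \<phi>) s = pull colim \<phi> (pull colim \<psi> s)"
    and "act colim s (Comp A \<psi> \<phi>) = Comp A (act colim s \<psi>) (act colim (pull colim \<psi> s) \<phi>)"
    using w by (simp_all add: pull_colim[OF \<psi>\<phi>] pull_colim[OF \<psi>] pull_colim[OF \<phi>] act_colim[OF \<psi>\<phi>]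
        act_colim[OF \<psi>] act_colim[OF \<phi>] wpull_closed[OF \<psi>] wpull_Comp[OF \<phi> \<psi>] wact_Comp[OF \<phi> \<psi>])
qed (rule A.category_axioms)

lemma cocone_coproj: "cocone colim coproj"
  unfolding cocone_def
proof (intro conjI ballI allI crossed_group_colim crossed_group_mapI)
  fix j a x y
  assume "j \<in> Ob J" "a \<in> Ob A" "x \<in> carrier (grp (G j) a)"
  then show "coproj j a x \<in> carrier (grp colim a)"
    by (auto simp: coproj_def carrier_colim)
  assume "y \<in> carrier (grp (G j) a)"
  with \<open>j \<in> Ob J\<close> \<open>a \<in> Ob A\<close> \<open>x \<in> carrier (grp (G j) a)\<close>
  show "coproj j a (x \<otimes>\<^bsub>grp (G j) a\<^esub> y) = coproj j a x \<otimes>\<^bsub>grp colim a\<^esub> coproj j a y"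
    by (auto simp: coproj_def mult_colim cls_eq_iff monoid.m_closed[OF monoid_G]
        intro: rel_cong rel_mult cong_sym)
next
  fix j a b \<phi> x
  assume "j \<in> Ob J" "\<phi> \<in> Hom A a b" "x \<in> carrier (grp (G j) b)"
  then show "coproj j a (pull (G j) \<phi> x) = pull colim \<phi> (coproj j b x)"
    and "act colim (coproj j b x) \<phi> = act (G j) x \<phi>"
    by (simp_all add: coproj_def pull_colim act_colim)
next
  fix i j u a x
  assume "u \<in> Hom J i j" "a \<in> Ob A" "x \<in> carrier (grp (G i) a)"
  then show "coproj j a (D u a x) = coproj i a x"
    using J.Hom_Ob[of u i j]
    by (auto simp: coproj_def cls_eq_iff D_closed intro: cong_sym rel_cong rel_map)
qed

text \<open>The representative chosen by \<open>rep\<close> is immaterial for a cocone, by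
  \<open>weval_cong\<close>.\<close>

definition mediating :: "('o, 'm, 'u) crossed_group \<Rightarrow> ('j \<Rightarrow> 'o \<Rightarrow> 'u \<Rightarrow> 'u) \<Rightarrow> 'o \<Rightarrow> 'u \<Rightarrow> 'u" where
  "mediating H \<theta> a s = weval H \<theta> a (rep a s)"

lemma mediating_cls:
  assumes "cocone H \<theta>" "w \<in> words a" "a \<in> Ob A"
  shows "mediating H \<theta> a (cls a w) = weval H \<theta> a w"
  unfolding mediating_def using assms by (intro weval_cong rep_cls)

lemma mediating_coproj:
  assumes "cocone H \<theta>" "j \<in> Ob J" "a \<in> Ob A" "x \<in> carrier (grp (G j) a)"
  shows "mediating H \<theta> a (coproj j a x) = \<theta> j a x"
  using assms crossed_group_mapD(1)[OF cocone_map[OF assms(1,2)]]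
  by (simp add: coproj_def mediating_cls monoid.r_one[OF monoid_H])

lemma mediating_map:
  assumes "cocone H \<theta>"
  shows "crossed_group_map A colim H (mediating H \<theta>)"
proof (rule crossed_group_mapI)
  fix a b \<phi> s
  assume \<phi>: "\<phi> \<in> Hom A a b" and "s \<in> carrier (grp colim b)"
  then obtain w where w: "w \<in> words b" "s = cls b w" by (auto simp: carrier_colim)
  then show "mediating H \<theta> a (pull colim \<phi> s) = pull H \<phi> (mediating H \<theta> b s)"
    and "act H (mediating H \<theta> b s) \<phi> = act colim s \<phi>"
    using A.Hom_Ob[OF \<phi>] weval_pull[OF assms \<phi>] weval_act[OF assms \<phi>]
    by (simp_all add: pull_colim[OF \<phi>] act_colim[OF \<phi>] mediating_cls[OF assms] wpull_closed[OF \<phi>])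
qed (auto simp: carrier_colim mediating_cls[OF assms] weval_closed[OF assms] mult_colim
    weval_append[OF assms])

text \<open>Uniqueness of the mediating map: the class of a word is the product of the coprojections
  of its letters, and the empty word is the unit.\<close>

lemma map_colim_eq:
  assumes f: "crossed_group_map A colim H f" and g: "crossed_group_map A colim H g"
    and H: "crossed_group A H"
    and eq: "\<And>j a x. \<lbrakk>j \<in> Ob J; a \<in> Ob A; x \<in> carrier (grp (G j) a)\<rbrakk>
      \<Longrightarrow> f a (coproj j a x) = g a (coproj j a x)"
    and a: "a \<in> Ob A" and s: "s \<in> carrier (grp colim a)"
  shows "f a s = g a s"
proof -
  have "f a (cls a w) = g a (cls a w)" if "w \<in> words a" for w
    using that
  proof (induction w)
    case Nil
    then show ?case
      using crossed_group_map_one[OF f crossed_group_colim H a]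
        crossed_group_map_one[OF g crossed_group_colim H a]
      by (simp add: one_colim)
  next
    case (Cons l w)
    obtain j x where l: "l = (j, x)" by (cases l)
    then have *: "[(j, x)] \<in> words a" "w \<in> words a" using Cons.prems by auto
    then have "cls a (l # w) = coproj j a x \<otimes>\<^bsub>grp colim a\<^esub> cls a w"
      using a l by (simp add: mult_colim coproj_def)
    moreover have "coproj j a x \<in> carrier (grp colim a)" "cls a w \<in> carrier (grp colim a)"
      using * by (auto simp: carrier_colim coproj_def)
    ultimately show ?case
      using Cons.IH * a eq by (simp add: crossed_group_mapD(2)[OF f] crossed_group_mapD(2)[OF g])
  qed
  then show ?thesis using s by (auto simp: carrier_colim)
qed

end

text \<open>This is filteredness in the ordinary finitary sense, parallel morphisms included; the
  analysis of words uses no more of \<open>filtered \<kappa> J\<close>.\<close>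

definition directed :: "('j, 'n) category \<Rightarrow> bool" where
  "directed J \<longleftrightarrow> Ob J \<noteq> {} \<and>
     (\<forall>i\<in>Ob J. \<forall>j\<in>Ob J. \<exists>k u v. u \<in> Hom J i k \<and> v \<in> Hom J j k) \<and>
     (\<forall>i j. \<forall>u\<in>Hom J i j. \<forall>v\<in>Hom J i j. \<exists>k. \<exists>w\<in>Hom J j k. Comp J w u = Comp J w v)"

section \<open>Values of words at the stages of a directed diagram\<close>

context crs_diagram
begin

text \<open>
  \<open>stage a k w z\<close>: transporting the letters of \<open>w\<close> to \<open>G k\<close> along some morphisms of \<open>J\<close> and multiplying
  gives \<open>z\<close>. The value depends on the chosen morphisms, but for directed \<open>J\<close> not after
  passing to a later stage. Hence \<open>cong\<close> only identifies words with a common value at some stage.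
\<close>

inductive stage :: "'o \<Rightarrow> 'j \<Rightarrow> ('j \<times> 'u) list \<Rightarrow> 'u \<Rightarrow> bool" for a k where
  stage_Nil: "k \<in> Ob J \<Longrightarrow> stage a k [] \<one>\<^bsub>grp (G k) a\<^esub>"
| stage_Cons: "\<lbrakk>u \<in> Hom J j k; x \<in> carrier (grp (G j) a); stage a k w z\<rbrakk>
    \<Longrightarrow> stage a k ((j, x) # w) (D u a x \<otimes>\<^bsub>grp (G k) a\<^esub> z)"

lemma stage_closed:
  assumes "stage a k w z" "a \<in> Ob A"
  shows "k \<in> Ob J \<and> z \<in> carrier (grp (G k) a)"
  using assms
  by induction (auto simp: monoid.one_closed[OF monoid_G] monoid.m_closed[OF monoid_G] D_closed)

lemma stage_push:
  assumes "stage a k w z" "v \<in> Hom J k l" "a \<in> Ob A"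
  shows "stage a l w (D v a z)"
  using assms
proof induction
  case stage_Nil
  then show ?case using stage.stage_Nil[of l a] J.Hom_Ob by (simp add: D_one)
next
  case (stage_Cons u j x w z)
  then show ?case
    using stage.stage_Cons[OF J.Comp_in_Hom[OF stage_Cons(1) stage_Cons.prems(1)] stage_Cons(2)
        stage_Cons.IH] stage_closed[OF stage_Cons(3)]
    by (simp add: D_mult D_closed D_Comp)
qed

lemma stage_append:
  assumes "stage a k v y" "stage a k w z" "a \<in> Ob A"
  shows "stage a k (v @ w) (y \<otimes>\<^bsub>grp (G k) a\<^esub> z)"
  using assms
proof induction
  case stage_Nil
  then show ?case by (simp add: monoid.l_one[OF monoid_G] stage_closed)
next
  case (stage_Cons u j x v y)
  then show ?case
    using stage.stage_Cons[OF stage_Cons(1,2) stage_Cons.IH[OF stage_Cons.prems]]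
      stage_closed[OF stage_Cons(3)] stage_closed[OF stage_Cons.prems] J.Hom_Ob(2)[OF stage_Cons(1)]
    by (simp add: monoid.m_assoc[OF monoid_G] D_closed)
qed

lemma stage_single:
  assumes "u \<in> Hom J j k" "x \<in> carrier (grp (G j) a)" "a \<in> Ob A"
  shows "stage a k [(j, x)] (D u a x)"
  using stage_Cons[OF assms(1,2) stage_Nil] assms J.Hom_Ob(2)[OF assms(1)]
  by (simp add: monoid.r_one[OF monoid_G] D_closed)

context
  assumes directed: "directed J"
begin

lemma upper_bound:
  assumes "i \<in> Ob J" "j \<in> Ob J"
  obtains k u v where "u \<in> Hom J i k" "v \<in> Hom J j k"
  using assms directed unfolding directed_def by meson

lemma coequalise:
  assumes "u \<in> Hom J i j" "v \<in> Hom J i j"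
  obtains k w where "w \<in> Hom J j k" "Comp J w u = Comp J w v"
  using assms directed unfolding directed_def by meson

lemma stage_exists: "\<lbrakk>w \<in> words a; a \<in> Ob A\<rbrakk> \<Longrightarrow> \<exists>k z. stage a k w z"
proof (induction w)
  case Nil
  then show ?case using directed stage_Nil unfolding directed_def by blast
next
  case (Cons l w)
  then obtain j x k z where l: "l = (j, x)" "j \<in> Ob J" "x \<in> carrier (grp (G j) a)" and z: "stage a k w z"
    by (cases l) auto
  obtain m u v where "u \<in> Hom J j m" "v \<in> Hom J k m"
    using upper_bound l(2) stage_closed[OF z Cons.prems(2)] by metis
  then show ?case
    using stage_Cons[OF _ l(3) stage_push[OF z _ Cons.prems(2)]] l(1) by blast
qed

text \<open>Two values differ only through the morphisms that transport the letters. The induction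
  merges the values of the tail first; the two transports of the head are then parallel and can be
  coequalised.\<close>

lemma stage_unique:
  assumes "stage a k w y" "stage a k w z" "a \<in> Ob A"
  shows "\<exists>l. \<exists>v\<in>Hom J k l. D v a y = D v a z"
  using assms
proof (induction arbitrary: z)
  case stage_Nil
  then have "z = \<one>\<^bsub>grp (G k) a\<^esub>" by (auto elim: stage.cases)
  then show ?case using J.Ident_in_Hom[OF stage_Nil(1)] by blast
next
  case (stage_Cons u j x w y)
  note a = stage_Cons.prems(2)
  obtain u' z' where u': "u' \<in> Hom J j k" and z': "stage a k w z'"
    and z: "z = D u' a x \<otimes>\<^bsub>grp (G k) a\<^esub> z'"
    using stage_Cons.prems(1) by (auto elim: stage.cases)
  obtain l v where v: "v \<in> Hom J k l" "D v a y = D v a z'"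
    using stage_Cons.IH[OF z' a] by blast
  have "Comp J v u \<in> Hom J j l" "Comp J v u' \<in> Hom J j l"
    using stage_Cons(1) u' v by (auto intro: J.Comp_in_Hom)
  then obtain m t where t: "t \<in> Hom J l m" "Comp J t (Comp J v u) = Comp J t (Comp J v u')"
    by (rule coequalise)
  \<comment> \<open>\<open>?s\<close> identifies the two tails because it extends \<open>v\<close>,
    and the two heads by the choice of \<open>t\<close>.\<close>
  let ?s = "Comp J t v"
  have s: "?s \<in> Hom J k m" using v t by (auto intro: J.Comp_in_Hom)
  have "Comp J ?s u = Comp J ?s u'"
    using t(2) J.Comp_assoc[OF stage_Cons(1) v(1) t(1)] J.Comp_assoc[OF u' v(1) t(1)] by simp
  then have "D ?s a (D u a x) = D ?s a (D u' a x)"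
    using D_Comp[OF stage_Cons(1) s a stage_Cons(2)] D_Comp[OF u' s a stage_Cons(2)] by simp
  moreover have "D ?s a y = D ?s a z'"
    using v(2) D_Comp[OF v(1) t(1) a] stage_closed[OF stage_Cons(3) a] stage_closed[OF z' a] by simp
  ultimately have "D ?s a (D u a x \<otimes>\<^bsub>grp (G k) a\<^esub> y) = D ?s a z"
    using z stage_closed[OF stage_Cons(3) a] stage_closed[OF z' a] D_closed[OF stage_Cons(1) a stage_Cons(2)]
      D_closed[OF u' a stage_Cons(2)]
    by (simp add: D_mult[OF s a])
  with s show ?case by blast
qed

definition costage :: "'o \<Rightarrow> ('j \<times> 'u) list \<Rightarrow> ('j \<times> 'u) list \<Rightarrow> bool" where
  "costage a v w \<longleftrightarrow> (\<exists>k z. stage a k v z \<and> stage a k w z)"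

text \<open>The middle word has a value at \<open>k\<close> and another one at \<open>l\<close>.
  Pushed to a common stage \<open>m\<close>, both are values of the same word, so
  \<open>stage_unique\<close> merges them further on.\<close>

lemma costage_trans:
  assumes "costage a v w" "costage a w x" and a: "a \<in> Ob A"
  shows "costage a v x"
proof -
  obtain k y l z where y: "stage a k v y" "stage a k w y" and z: "stage a l w z" "stage a l x z"
    using assms(1,2) by (auto simp: costage_def)
  obtain m s t where s: "s \<in> Hom J k m" and t: "t \<in> Hom J l m"
    using upper_bound stage_closed[OF y(1) a] stage_closed[OF z(1) a] by metis
  obtain n r where r: "r \<in> Hom J m n" "D r a (D s a y) = D r a (D t a z)"
    using stage_unique[OF stage_push[OF y(2) s a] stage_push[OF z(1) t a] a] by blast
  have "stage a n v (D r a (D s a y))" "stage a n x (D r a (D s a y))"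
    using stage_push[OF stage_push[OF y(1) s a] r(1) a] stage_push[OF stage_push[OF z(2) t a] r(1) a] r(2)
    by simp_all
  then show ?thesis by (auto simp: costage_def)
qed

lemma costage_append:
  assumes "costage a v v'" "costage a w w'" and a: "a \<in> Ob A"
  shows "costage a (v @ w) (v' @ w')"
proof -
  obtain k y l z where y: "stage a k v y" "stage a k v' y" and z: "stage a l w z" "stage a l w' z"
    using assms(1,2) by (auto simp: costage_def)
  obtain m s t where "s \<in> Hom J k m" "t \<in> Hom J l m"
    using upper_bound stage_closed[OF y(1) a] stage_closed[OF z(1) a] by metis
  then show ?thesis
    using stage_append[OF stage_push[OF y(1) _ a] stage_push[OF z(1) _ a] a]
      stage_append[OF stage_push[OF y(2) _ a] stage_push[OF z(2) _ a] a]
    unfolding costage_def by blast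
qed

lemma costage_rel:
  assumes "rel a l r" and a: "a \<in> Ob A"
  shows "costage a l r"
  using assms(1)
proof cases
  case (rel_map u i j x)
  have "stage a j [(i, x)] (D u a x)" "stage a j [(j, D u a x)] (D u a x)"
    using stage_single[OF rel_map(3,4) a] stage_single[OF J.Ident_in_Hom D_closed[OF rel_map(3) a rel_map(4)] a]
      D_Ident[OF _ a D_closed[OF rel_map(3) a rel_map(4)]] J.Hom_Ob(2)[OF rel_map(3)]
    by simp_all
  then show ?thesis using rel_map by (auto simp: costage_def)
next
  case (rel_mult j x y)
  note j = J.Ident_in_Hom[OF rel_mult(3)]
  have "stage a j [(j, x), (j, y)] (x \<otimes>\<^bsub>grp (G j) a\<^esub> y)"
    using stage_Cons[OF j rel_mult(4) stage_single[OF j rel_mult(5) a]] rel_mult(3-5) a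
    by (simp add: D_Ident)
  moreover have "stage a j [(j, x \<otimes>\<^bsub>grp (G j) a\<^esub> y)] (x \<otimes>\<^bsub>grp (G j) a\<^esub> y)"
    using stage_single[OF j _ a, of "x \<otimes>\<^bsub>grp (G j) a\<^esub> y"] rel_mult(3-5) a
    by (simp add: D_Ident monoid.m_closed[OF monoid_G])
  ultimately show ?thesis using rel_mult by (auto simp: costage_def)
next
  case (rel_one j)
  then show ?thesis
    using stage_single[OF J.Ident_in_Hom[OF rel_one(3)] _ a, of "\<one>\<^bsub>grp (G j) a\<^esub>"] stage_Nil[of j a] a
    by (auto simp: costage_def D_Ident monoid.one_closed[OF monoid_G])
qed

text \<open>\<open>costage\<close> is symmetric and transitive, reflexive on words, compatible with
  concatenation, and contains \<open>rel\<close>; \<open>cong\<close> is generated by exactly these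
  closures.\<close>

lemma cong_costage:
  assumes "cong a v w" and a: "a \<in> Ob A"
  shows "costage a v w"
  using assms(1)
proof induction
  case (cong_refl w)
  then show ?case using stage_exists[OF _ a] by (auto simp: costage_def)
next
  case (cong_sym v w)
  then show ?case by (auto simp: costage_def)
next
  case (cong_trans v w z)
  then show ?case using a by (blast intro: costage_trans)
next
  case (cong_rel l r p q)
  then have pq: "costage a p p" "costage a q q"
    using stage_exists[OF _ a] by (auto simp: costage_def)
  show ?case
    by (rule costage_append[OF pq(1) costage_append[OF costage_rel[OF cong_rel(1) a] pq(2) a] a])
qed

lemma cong_single:
  assumes "cong a [(i, x)] [(i, y)]" and a: "a \<in> Ob A"
  shows "\<exists>k. \<exists>u\<in>Hom J i k. D u a x = D u a y"
proof -
  obtain k z where z: "stage a k [(i, x)] z" "stage a k [(i, y)] z"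
    using cong_costage[OF assms] by (auto simp: costage_def)
  have xy: "x \<in> carrier (grp (G i) a)" "y \<in> carrier (grp (G i) a)"
    using cong_words[OF assms] by auto
  have *: "\<exists>u\<in>Hom J i k. z = D u a x'" if "stage a k [(i, x')] z" "x' \<in> carrier (grp (G i) a)" for x'
    using that a
    by (auto elim!: stage.cases[of a k "[(i, x')]" z] stage.cases[of a k "[]"]
        simp: monoid.r_one[OF monoid_G] D_closed dest: J.Hom_Ob)
  obtain u v where uv: "u \<in> Hom J i k" "v \<in> Hom J i k" "z = D u a x" "z = D v a y"
    using *[OF z(1) xy(1)] *[OF z(2) xy(2)] by blast
  \<comment> \<open>The common value arises along two possibly different morphisms \<open>u\<close>
    and \<open>v\<close>, whereas the claim asks for a single one.\<close>
  obtain l w where w: "w \<in> Hom J k l" "Comp J w u = Comp J w v"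
    using uv(1,2) by (rule coequalise)
  have "D (Comp J w u) a x = D (Comp J w u) a y"
    using D_Comp[OF uv(1) w(1) a xy(1)] D_Comp[OF uv(2) w(1) a xy(2)] uv w by simp
  then show ?thesis
    using J.Comp_in_Hom[OF uv(1) w(1)] by blast
qed

end

end

section \<open>Functors into the category of crossed groups and their colimits\<close>

locale crs_functor = A: category A + J: category J + regular_cardinal \<mu>
  for A :: "('o, 'm) category" and J :: "('j, 'n) category" and \<mu> :: "'u rel" +
  fixes F :: "('j, 'n, ('o, 'm, 'u) crossed_group,
    ('o, 'm, 'u) crossed_group \<times> ('o \<Rightarrow> 'u \<Rightarrow> 'u) \<times> ('o, 'm, 'u) crossed_group) functor_data"
  assumes is_functor: "is_functor J (CrsGrp \<mu> A) F"
    and small_Ob: "small \<mu> (Ob J)"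
    and uncountable: "natLeq <o \<mu>"
begin

lemma FOb: "j \<in> Ob J \<Longrightarrow> FOb F j \<in> Ob (CrsGrp \<mu> A)"
  and FMor: "u \<in> Hom J i j \<Longrightarrow> FMor F u \<in> Hom (CrsGrp \<mu> A) (FOb F i) (FOb F j)"
  and FMor_Ident: "j \<in> Ob J \<Longrightarrow> FMor F (Ident J j) = Ident (CrsGrp \<mu> A) (FOb F j)"
  and FMor_Comp: "\<lbrakk>u \<in> Hom J i j; v \<in> Hom J j k\<rbrakk>
    \<Longrightarrow> FMor F (Comp J v u) = Comp (CrsGrp \<mu> A) (FMor F v) (FMor F u)"
  using is_functor by (auto simp: is_functor_def)

sublocale crs_diagram A J "FOb F" "\<lambda>u. fam (FMor F u)"
proof (intro crs_diagram.intro crs_diagram_axioms.intro A.category_axioms J.category_axioms)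
  show "crossed_group A (FOb F j)" if "j \<in> Ob J" for j
    using FOb[OF that] by (simp add: Ob_CrsGrp)
  show "crossed_group_map A (FOb F i) (FOb F j) (fam (FMor F u))" if "u \<in> Hom J i j" for u i j
    using FMor[OF that] by (rule Hom_CrsGrpD)
qed (simp_all add: FMor_Ident Ident_CrsGrp_apply FMor_Comp Comp_CrsGrp_apply[OF FMor])

lemma small_words: "a \<in> Ob A \<Longrightarrow> small \<mu> (words a)"
  unfolding words_def letters_def
  using small_Ob FOb by (intro small_lists uncountable small_Sigma) (auto simp: Ob_CrsGrp)

definition code :: "'o \<Rightarrow> ('j \<times> 'u) list \<Rightarrow> 'u" where
  "code = (SOME e. \<forall>a\<in>Ob A. inj_on (e a) (words a))"

sublocale crs_diagram_code A J "FOb F" "\<lambda>u. fam (FMor F u)" code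
proof
  have "\<forall>a\<in>Ob A. \<exists>e :: ('j \<times> 'u) list \<Rightarrow> 'u. inj_on e (words a)"
    using small_words by (blast elim: small_embed)
  then have "\<exists>e :: 'o \<Rightarrow> ('j \<times> 'u) list \<Rightarrow> 'u. \<forall>a\<in>Ob A. inj_on (e a) (words a)"
    by (rule bchoice)
  then show "inj_on (code a) (words a)" if "a \<in> Ob A" for a
    using that unfolding code_def by (rule bspec[OF someI_ex])
qed

lemma cocone_CrsGrpD:
  assumes "is_cocone J (CrsGrp \<mu> A) F H \<theta>"
  shows "H \<in> Ob (CrsGrp \<mu> A)" "cocone H (\<lambda>j. fam (\<theta> j))"
    and "j \<in> Ob J \<Longrightarrow> \<theta> j \<in> Hom (CrsGrp \<mu> A) (FOb F j) H"
proof -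
  have *: "H \<in> Ob (CrsGrp \<mu> A)" "\<And>j. j \<in> Ob J \<Longrightarrow> \<theta> j \<in> Hom (CrsGrp \<mu> A) (FOb F j) H"
    "\<And>i j u. u \<in> Hom J i j \<Longrightarrow> Comp (CrsGrp \<mu> A) (\<theta> j) (FMor F u) = \<theta> i"
    using assms by (auto simp: is_cocone_def)
  show "H \<in> Ob (CrsGrp \<mu> A)" "j \<in> Ob J \<Longrightarrow> \<theta> j \<in> Hom (CrsGrp \<mu> A) (FOb F j) H"
    using * by auto
  show "cocone H (\<lambda>j. fam (\<theta> j))"
    unfolding cocone_def
  proof (intro conjI ballI allI)
    show "crossed_group A H" using *(1) by (simp add: Ob_CrsGrp)
    show "crossed_group_map A (FOb F j) H (fam (\<theta> j))" if "j \<in> Ob J" for j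
      by (rule Hom_CrsGrpD(5)[OF *(2)[OF that]])
    show "fam (\<theta> j) a (fam (FMor F u) a x) = fam (\<theta> i) a x"
      if "u \<in> Hom J i j" "a \<in> Ob A" "x \<in> carrier (grp (FOb F i) a)" for i j u a x
      using Comp_CrsGrp_apply[OF FMor[OF that(1)] that(2,3)] *(3)[OF that(1)] by metis
  qed
qed

lemma cocone_CrsGrpI:
  assumes H: "H \<in> Ob (CrsGrp \<mu> A)" and \<theta>: "cocone H \<theta>"
  shows "is_cocone J (CrsGrp \<mu> A) F H (\<lambda>j. crs_mor A (FOb F j) H (\<theta> j))"
proof -
  have *: "crs_mor A (FOb F j) H (\<theta> j) \<in> Hom (CrsGrp \<mu> A) (FOb F j) H" if "j \<in> Ob J" for j
    using FOb[OF that] H cocone_map[OF \<theta> that] by (rule crs_mor_in_Hom)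
  have "Comp (CrsGrp \<mu> A) (crs_mor A (FOb F j) H (\<theta> j)) (FMor F u) = crs_mor A (FOb F i) H (\<theta> i)"
    if u: "u \<in> Hom J i j" for i j u
    using \<theta> J.Hom_Ob[OF u] u
    by (intro Hom_CrsGrp_eqI[OF Comp_CrsGrp_in_Hom[OF FMor[OF u] *] *])
      (auto simp: Comp_CrsGrp_apply[OF FMor] crs_mor_apply D_closed cocone_def)
  with H * show ?thesis by (auto simp: is_cocone_def)
qed

lemma colim_in_Ob: "colim \<in> Ob (CrsGrp \<mu> A)"
  using crossed_group_colim small_words by (simp add: Ob_CrsGrp carrier_colim small_image)

lemma colimit_exists: "is_colimit J (CrsGrp \<mu> A) F colim (\<lambda>j. crs_mor A (FOb F j) colim (coproj j))"
  unfolding is_colimit_def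
proof (intro conjI allI impI)
  show cc: "is_cocone J (CrsGrp \<mu> A) F colim (\<lambda>j. crs_mor A (FOb F j) colim (coproj j))"
    by (rule cocone_CrsGrpI[OF colim_in_Ob cocone_coproj])
  note \<iota> = cocone_CrsGrpD(3)[OF cc]
  fix H \<theta> assume \<theta>: "is_cocone J (CrsGrp \<mu> A) F H \<theta>"
  note H = cocone_CrsGrpD[OF \<theta>]
  define h where "h = crs_mor A colim H (mediating H (\<lambda>j. fam (\<theta> j)))"
  have h: "h \<in> Hom (CrsGrp \<mu> A) colim H"
    unfolding h_def by (rule crs_mor_in_Hom[OF colim_in_Ob H(1) mediating_map[OF H(2)]])
  have coproj: "coproj j a x \<in> carrier (grp colim a)"
    if "j \<in> Ob J" "a \<in> Ob A" "x \<in> carrier (grp (FOb F j) a)" for j a x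
    using that by (simp add: coproj_def carrier_colim)
  show "\<exists>!h. h \<in> Hom (CrsGrp \<mu> A) colim H \<and>
      (\<forall>j\<in>Ob J. Comp (CrsGrp \<mu> A) h (crs_mor A (FOb F j) colim (coproj j)) = \<theta> j)"
  proof (rule ex1I[of _ h])
    show "h \<in> Hom (CrsGrp \<mu> A) colim H \<and>
        (\<forall>j\<in>Ob J. Comp (CrsGrp \<mu> A) h (crs_mor A (FOb F j) colim (coproj j)) = \<theta> j)"
    proof (intro conjI ballI h)
      fix j assume j: "j \<in> Ob J"
      show "Comp (CrsGrp \<mu> A) h (crs_mor A (FOb F j) colim (coproj j)) = \<theta> j"
        by (rule Hom_CrsGrp_eqI[OF Comp_CrsGrp_in_Hom[OF \<iota>[OF j] h] H(3)[OF j]])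
          (simp add: Comp_CrsGrp_apply[OF \<iota>[OF j]] crs_mor_apply h_def coproj j mediating_coproj[OF H(2)])
    qed
  next
    fix g assume g: "g \<in> Hom (CrsGrp \<mu> A) colim H \<and>
        (\<forall>j\<in>Ob J. Comp (CrsGrp \<mu> A) g (crs_mor A (FOb F j) colim (coproj j)) = \<theta> j)"
    show "g = h"
    proof (rule Hom_CrsGrp_eqI[OF conjunct1[OF g] h])
      fix a s assume "a \<in> Ob A" "s \<in> carrier (grp colim a)"
      then show "fam g a s = fam h a s"
      proof (rule map_colim_eq[OF Hom_CrsGrpD(5)[OF conjunct1[OF g]] Hom_CrsGrpD(5)[OF h]
            Hom_CrsGrpD(4)[OF h], rotated])
        fix j a x assume jax: "j \<in> Ob J" "a \<in> Ob A" "x \<in> carrier (grp (FOb F j) a)"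
        then have "fam g a (coproj j a x) = fam (\<theta> j) a x"
          using Comp_CrsGrp_apply[OF \<iota>[OF jax(1)] jax(2,3), of g] g by (simp add: crs_mor_apply)
        also have "\<dots> = fam h a (coproj j a x)"
          using jax by (simp add: h_def crs_mor_apply coproj mediating_coproj[OF H(2)])
        finally show "fam g a (coproj j a x) = fam h a (coproj j a x)" .
      qed
    qed
  qed
qed

text \<open>\<open>c\<close> is an arbitrary colimit whose elements are not words. The mediating map
  from \<open>c\<close> to \<open>colim\<close> carries the equality over, where it becomes a
  congruence of one-letter words.\<close>

lemma colimit_separates:
  assumes c: "is_colimit J (CrsGrp \<mu> A) F c \<iota>" and "directed J"
    and i: "i \<in> Ob J" and a: "a \<in> Ob A"
    and x: "x \<in> carrier (grp (FOb F i) a)" and y: "y \<in> carrier (grp (FOb F i) a)"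
    and eq: "fam (\<iota> i) a x = fam (\<iota> i) a y"
  shows "\<exists>k. \<exists>u\<in>Hom J i k. fam (FMor F u) a x = fam (FMor F u) a y"
proof -
  obtain h where h: "h \<in> Hom (CrsGrp \<mu> A) c colim"
    "\<And>j. j \<in> Ob J \<Longrightarrow> Comp (CrsGrp \<mu> A) h (\<iota> j) = crs_mor A (FOb F j) colim (coproj j)"
    using c cocone_CrsGrpI[OF colim_in_Ob cocone_coproj] unfolding is_colimit_def by blast
  have \<iota>: "\<iota> i \<in> Hom (CrsGrp \<mu> A) (FOb F i) c"
    using c i by (simp add: is_colimit_def is_cocone_def)
  have "coproj i a x = coproj i a y"
    using Comp_CrsGrp_apply[OF \<iota> a x, of h] Comp_CrsGrp_apply[OF \<iota> a y, of h] eq h(2)[OF i] a x y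
    by (simp add: crs_mor_apply)
  then have "cong a [(i, x)] [(i, y)]"
    using i a x y by (simp add: coproj_def cls_eq_iff)
  then show ?thesis by (rule cong_single[OF \<open>directed J\<close> _ a])
qed

end

lemma cocomplete_CrsGrp:
  fixes A :: "('o, 'm) category" and \<mu> :: "'u rel"
  assumes "category A" "Cinfinite \<mu>" "regularCard \<mu>" "natLeq <o \<mu>"
  shows "cocomplete \<mu> (CrsGrp \<mu> A)"
  unfolding cocomplete_def small_category_def
proof (intro allI impI)
  fix J :: "('u, 'u) category"
  fix F :: "('u, 'u, ('o, 'm, 'u) crossed_group,
    ('o, 'm, 'u) crossed_group \<times> ('o \<Rightarrow> 'u \<Rightarrow> 'u) \<times> ('o, 'm, 'u) crossed_group) functor_data"
  assume J: "(category J \<and> small \<mu> (Ob J) \<and> small \<mu> (Mor J)) \<and> is_functor J (CrsGrp \<mu> A) F"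
  interpret crs_functor A J \<mu> F
    using assms J by (simp add: crs_functor_def regular_cardinal_def crs_functor_axioms_def)
  show "\<exists>c \<iota>. is_colimit J (CrsGrp \<mu> A) F c \<iota>"
    using colimit_exists by blast
qed

context crs_diagram
begin

text \<open>Moving the letters to stage \<open>k\<close> and multiplying them there uses only
  generating relations. With \<open>stage_exists\<close>, this shrinks every word over a directed
  diagram to a single letter.\<close>

lemma stage_cong:
  assumes "stage a k w z" "w \<in> words a" and a: "a \<in> Ob A"
  shows "cong a w [(k, z)]"
  using assms(1,2)
proof induction
  case stage_Nil
  then show ?case by (intro cong_sym[OF rel_cong] rel_one)
next
  case (stage_Cons u j x w z)
  let ?y = "D u a x"
  have k: "k \<in> Ob J" and y: "?y \<in> carrier (grp (G k) a)" and z: "z \<in> carrier (grp (G k) a)"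
    using stage_closed[OF stage_Cons(3) a] D_closed[OF stage_Cons(1) a stage_Cons(2)] by auto
  have "cong a ([(j, x)] @ w) ([(k, ?y)] @ [(k, z)])"
    using rel_cong[OF rel_map[OF stage_Cons(1,2)]] stage_Cons.IH stage_Cons.prems a
    by (intro cong_append) auto
  also have "[(k, ?y)] @ [(k, z)] = [(k, ?y), (k, z)]" by simp
  finally show ?case
    using cong_trans[OF _ rel_cong[OF rel_mult[OF k y z]]] by simp
qed

end

text \<open>The mediating maps \<open>h\<close> from \<open>c\<close> to \<open>colim\<close> and
  \<open>g\<close> back compose to the identity of \<open>c\<close>, by uniqueness. So
  \<open>s\<close> is the image under \<open>g\<close> of the class of a word, and that word is
  congruent to a single letter.\<close>

lemma (in crs_functor) colimit_covers:
  assumes c: "is_colimit J (CrsGrp \<mu> A) F c \<iota>" and "directed J"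
    and a: "a \<in> Ob A" and s: "s \<in> carrier (grp c a)"
  obtains k x where "k \<in> Ob J" "x \<in> carrier (grp (FOb F k) a)" "s = fam (\<iota> k) a x"
proof -
  let ?\<kappa> = "\<lambda>j. crs_mor A (FOb F j) colim (coproj j)"
  have cc: "is_cocone J (CrsGrp \<mu> A) F c \<iota>" "is_cocone J (CrsGrp \<mu> A) F colim ?\<kappa>"
    using c colimit_exists by (auto simp: is_colimit_def)
  interpret C: category "CrsGrp \<mu> A" by (rule category_CrsGrp[OF A.category_axioms])
  note \<iota> = cocone_CrsGrpD(3)[OF cc(1)] and \<kappa> = cocone_CrsGrpD(3)[OF cc(2)]
  obtain h where h: "h \<in> Hom (CrsGrp \<mu> A) c colim"
    "\<And>j. j \<in> Ob J \<Longrightarrow> Comp (CrsGrp \<mu> A) h (\<iota> j) = ?\<kappa> j"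
    using c cc(2) unfolding is_colimit_def by blast
  obtain g where g: "g \<in> Hom (CrsGrp \<mu> A) colim c"
    "\<And>j. j \<in> Ob J \<Longrightarrow> Comp (CrsGrp \<mu> A) g (?\<kappa> j) = \<iota> j"
    using colimit_exists cc(1) unfolding is_colimit_def by blast
  have id: "Ident (CrsGrp \<mu> A) c \<in> Hom (CrsGrp \<mu> A) c c"
    using cocone_CrsGrpD(1)[OF cc(1)] by (rule C.Ident_in_Hom)
  have "Comp (CrsGrp \<mu> A) (Comp (CrsGrp \<mu> A) g h) (\<iota> j) = \<iota> j" if "j \<in> Ob J" for j
    using C.Comp_assoc[OF \<iota>[OF that] h(1) g(1)] h(2)[OF that] g(2)[OF that] by simp
  moreover have "Comp (CrsGrp \<mu> A) (Ident (CrsGrp \<mu> A) c) (\<iota> j) = \<iota> j" if "j \<in> Ob J" for j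
    using \<iota>[OF that] by (rule C.Comp_Ident_left)
  ultimately have gh: "Comp (CrsGrp \<mu> A) g h = Ident (CrsGrp \<mu> A) c"
    using c cc(1) id C.Comp_in_Hom[OF h(1) g(1)] unfolding is_colimit_def by blast
  have "fam h a s \<in> carrier (grp colim a)"
    using crossed_group_mapD(1)[OF Hom_CrsGrpD(5)[OF h(1)] a s] .
  then obtain w where w: "w \<in> words a" "fam h a s = cls a w" by (auto simp: carrier_colim)
  obtain k z where z: "stage a k w z" using stage_exists[OF \<open>directed J\<close> w(1) a] by blast
  then have k: "k \<in> Ob J" and zc: "z \<in> carrier (grp (FOb F k) a)" using stage_closed[OF z a] by auto
  have "fam h a s = fam (?\<kappa> k) a z"
    using stage_cong[OF z w(1) a] w k zc a by (simp add: crs_mor_apply coproj_def cls_eq_iff)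
  then have "fam g a (fam h a s) = fam (\<iota> k) a z"
    using Comp_CrsGrp_apply[OF \<kappa>[OF k] a zc, of g] g(2)[OF k] by simp
  moreover have "fam g a (fam h a s) = s"
    using Comp_CrsGrp_apply[OF h(1) a s, of g] Ident_CrsGrp_apply[OF a s] gh by simp
  ultimately show ?thesis using that[OF k zc] by simp
qed

section \<open>Filtered categories\<close>

text \<open>\<open>filtered\<close> offers cocones only over functors from categories on
  \<open>'k\<close>. Graphs in which no vertex is both a target and a source become such categories
  without adding composites, and they cover all shapes that occur here. The injection
  \<open>n\<close> codes vertices and edges in \<open>'k\<close>.\<close>

locale bipartite_diagram = regular_cardinal \<kappa> + J: category J
  for \<kappa> :: "'k rel" and J :: "('j, 'n) category" +
  fixes V :: "'v set" and E :: "'e set" and src tgt :: "'e \<Rightarrow> 'v"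
    and ob :: "'v \<Rightarrow> 'j" and mor :: "'e \<Rightarrow> 'n" and n :: "'v + 'e \<Rightarrow> 'k"
  assumes small_VE: "small \<kappa> (V <+> E)"
    and src: "e \<in> E \<Longrightarrow> src e \<in> V" and tgt: "e \<in> E \<Longrightarrow> tgt e \<in> V"
    and bipartite: "\<lbrakk>e \<in> E; e' \<in> E\<rbrakk> \<Longrightarrow> tgt e \<noteq> src e'"
    and ob: "v \<in> V \<Longrightarrow> ob v \<in> Ob J"
    and mor: "e \<in> E \<Longrightarrow> mor e \<in> Hom J (ob (src e)) (ob (tgt e))"
    and inj_n: "inj_on n (V <+> E)"
begin

abbreviation "decode \<equiv> inv_into (V <+> E) n"

text \<open>The vertices serve as their own identities; two edges are never composable.\<close>

definition shape :: "('k, 'k) category" where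
  "shape = \<lparr>Ob = n ` Inl ` V, Mor = n ` (V <+> E),
     Dom = (\<lambda>f. case decode f of Inl v \<Rightarrow> f | Inr e \<Rightarrow> n (Inl (src e))),
     Cod = (\<lambda>f. case decode f of Inl v \<Rightarrow> f | Inr e \<Rightarrow> n (Inl (tgt e))),
     Ident = (\<lambda>a. a),
     Comp = (\<lambda>g f. case decode g of Inl v \<Rightarrow> f | Inr e \<Rightarrow> g)\<rparr>"

definition diagram :: "('k, 'k, 'j, 'n) functor_data" where
  "diagram = \<lparr>FOb = (\<lambda>a. case decode a of Inl v \<Rightarrow> ob v),
     FMor = (\<lambda>f. case decode f of Inl v \<Rightarrow> Ident J (ob v) | Inr e \<Rightarrow> mor e)\<rparr>"

lemma decode: "v \<in> V \<Longrightarrow> decode (n (Inl v)) = Inl v" "e \<in> E \<Longrightarrow> decode (n (Inr e)) = Inr e"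
  using inj_n by (auto intro: inv_into_f_f)

lemma n_eq_iff:
  "\<lbrakk>v \<in> V; v' \<in> V\<rbrakk> \<Longrightarrow> n (Inl v) = n (Inl v') \<longleftrightarrow> v = v'"
  using inj_on_eq_iff[OF inj_n] by auto

lemma Hom_shape:
  "f \<in> Hom shape a b \<longleftrightarrow> (\<exists>v\<in>V. f = n (Inl v) \<and> a = f \<and> b = f) \<or>
     (\<exists>e\<in>E. f = n (Inr e) \<and> a = n (Inl (src e)) \<and> b = n (Inl (tgt e)))"
  by (auto simp: Hom_def shape_def decode image_iff)

lemma shape_simps:
  "Ident shape a = a"
  "v \<in> V \<Longrightarrow> Comp shape (n (Inl v)) f = f"
  "e \<in> E \<Longrightarrow> Comp shape (n (Inr e)) f = n (Inr e)"
  by (simp_all add: shape_def decode)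

lemma diagram_simps:
  "v \<in> V \<Longrightarrow> FOb diagram (n (Inl v)) = ob v"
  "v \<in> V \<Longrightarrow> FMor diagram (n (Inl v)) = Ident J (ob v)"
  "e \<in> E \<Longrightarrow> FMor diagram (n (Inr e)) = mor e"
  by (simp_all add: diagram_def decode)

lemma category_shape: "category shape"
proof
  show "Comp shape g f \<in> Hom shape a c" if "f \<in> Hom shape a b" "g \<in> Hom shape b c" for f g a b c
    using that by (auto simp: Hom_shape src tgt shape_simps n_eq_iff bipartite)
  show "Comp shape h (Comp shape g f) = Comp shape (Comp shape h g) f"
    if "f \<in> Hom shape a b" "g \<in> Hom shape b c" "h \<in> Hom shape c d" for f g h a b c d
    using that by (auto simp: Hom_shape src tgt shape_simps n_eq_iff bipartite)
  show "Comp shape f (Ident shape a) = f" if "f \<in> Hom shape a b" for f a b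
    using that by (auto simp: Hom_shape shape_simps)
  show "Comp shape (Ident shape b) f = f" if "f \<in> Hom shape a b" for f a b
    using that by (auto simp: Hom_shape src tgt shape_simps)
  show "Dom shape f \<in> Ob shape" "Cod shape f \<in> Ob shape" if "f \<in> Mor shape" for f
    using that src tgt by (auto simp: decode shape_def)
  show "Ident shape a \<in> Hom shape a a" if "a \<in> Ob shape" for a
    using that by (auto simp: Hom_shape shape_simps) (auto simp: shape_def)
qed

lemma functor_diagram: "is_functor shape J diagram"
  unfolding is_functor_def
proof (intro conjI ballI allI)
  show "FOb diagram a \<in> Ob J" "FMor diagram (Ident shape a) = Ident J (FOb diagram a)"
    if "a \<in> Ob shape" for a
    using that ob by (auto simp: shape_def diagram_simps)
  show "FMor diagram f \<in> Hom J (FOb diagram a) (FOb diagram b)" if "f \<in> Hom shape a b" for f a b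
    using that mor by (auto simp: Hom_shape diagram_simps src tgt J.Ident_in_Hom ob)
  show "FMor diagram (Comp shape g f) = Comp J (FMor diagram g) (FMor diagram f)"
    if "f \<in> Hom shape a b" "g \<in> Hom shape b c" for f g a b c
    using that
    by (auto simp: Hom_shape shape_simps diagram_simps src tgt n_eq_iff bipartite
        J.Comp_Ident_left[OF J.Ident_in_Hom] J.Comp_Ident_left[OF mor]
        J.Comp_Ident_right[OF mor] ob)
qed

end

locale filtered_category = regular_cardinal \<kappa> + J: category J
  for \<kappa> :: "'k rel" and J :: "('j, 'n) category" +
  assumes filtered: "filtered \<kappa> J"
begin

text \<open>All consequences of \<open>filtered\<close> used for colimits are drawn through this
  lemma, which hides the coding of the shape.\<close>

lemma bipartite_cocone:
  fixes V :: "'v set" and E :: "'e set"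
  assumes "small \<kappa> V" "small \<kappa> E"
    and src: "\<And>e. e \<in> E \<Longrightarrow> src e \<in> V" and tgt: "\<And>e. e \<in> E \<Longrightarrow> tgt e \<in> V"
    and bip: "\<And>e e'. \<lbrakk>e \<in> E; e' \<in> E\<rbrakk> \<Longrightarrow> tgt e \<noteq> src e'"
    and ob: "\<And>v. v \<in> V \<Longrightarrow> ob v \<in> Ob J"
    and mor: "\<And>e. e \<in> E \<Longrightarrow> mor e \<in> Hom J (ob (src e)) (ob (tgt e))"
  shows "\<exists>c\<in>Ob J. \<exists>\<iota>. (\<forall>v\<in>V. \<iota> v \<in> Hom J (ob v) c) \<and>
    (\<forall>e\<in>E. Comp J (\<iota> (tgt e)) (mor e) = \<iota> (src e))"
proof -
  have VE: "small \<kappa> (V <+> E)"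
    using assms(1,2) by (simp add: Plus_def small_Un small_image)
  then obtain n :: "'v + 'e \<Rightarrow> 'k" where n: "inj_on n (V <+> E)" by (rule small_embed)
  interpret bipartite_diagram \<kappa> J V E src tgt ob mor n
    by unfold_locales (fact VE src tgt bip ob mor n)+
  have "|Mor shape| <o \<kappa>"
    using small_image[OF VE] by (simp add: shape_def small_def)
  then obtain c \<iota> where c: "is_cocone shape J diagram c \<iota>"
    using filtered category_shape functor_diagram unfolding filtered_def by blast
  have 1: "\<iota> (n (Inl v)) \<in> Hom J (ob v) c" if "v \<in> V" for v
    using c that by (auto simp: is_cocone_def shape_def diagram_def decode)
  have 2: "Comp J (\<iota> (n (Inl (tgt e)))) (mor e) = \<iota> (n (Inl (src e)))" if "e \<in> E" for e
  proof -
    have "n (Inr e) \<in> Hom shape (n (Inl (src e))) (n (Inl (tgt e)))"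
      using that by (auto simp: Hom_shape)
    then have "Comp J (\<iota> (n (Inl (tgt e)))) (FMor diagram (n (Inr e))) = \<iota> (n (Inl (src e)))"
      using c unfolding is_cocone_def by blast
    then show ?thesis using that by (simp add: diagram_def decode)
  qed
  show ?thesis
    using 1 2 c by (intro bexI[of _ c] exI[of _ "\<lambda>v. \<iota> (n (Inl v))"]) (auto simp: is_cocone_def)
qed

lemma upper_bound_family:
  assumes "small \<kappa> V" "\<And>v. v \<in> V \<Longrightarrow> ob v \<in> Ob J"
  shows "\<exists>c\<in>Ob J. \<exists>\<iota>. \<forall>v\<in>V. \<iota> v \<in> Hom J (ob v) c"
  using bipartite_cocone[of V "{} :: 'v set" undefined undefined ob undefined] assms small_finite
  by auto

text \<open>The shape is a fan: \<open>None\<close> stands for \<open>i\<close>,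
  \<open>Some r\<close> for \<open>k r\<close>, and the edge \<open>r\<close> is \<open>u r\<close>.
  The leg \<open>z\<close> at \<open>None\<close> then factors through every \<open>u r\<close> at
  once.\<close>

lemma coequalise_family:
  assumes "small \<kappa> R" "i \<in> Ob J" and u: "\<And>r. r \<in> R \<Longrightarrow> u r \<in> Hom J i (k r)"
  shows "\<exists>l. \<exists>z\<in>Hom J i l. \<exists>w. \<forall>r\<in>R. w r \<in> Hom J (k r) l \<and> Comp J (w r) (u r) = z"
proof -
  have R: "small \<kappa> (insert None (Some ` R))"
    using small_Un[OF small_finite[of "{None}"] small_image[OF assms(1), of Some]] by simp
  have "\<exists>l\<in>Ob J. \<exists>\<iota>. (\<forall>v\<in>insert None (Some ` R). \<iota> v \<in> Hom J (case_option i k v) l) \<and>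
      (\<forall>r\<in>R. Comp J (\<iota> (Some r)) (u r) = \<iota> None)"
    by (rule bipartite_cocone[OF R assms(1), where src = "\<lambda>_. None"])
      (use assms J.Hom_Ob(2)[OF u] in auto)
  then obtain l \<iota> where \<iota>: "\<forall>v\<in>insert None (Some ` R). \<iota> v \<in> Hom J (case_option i k v) l"
    "\<forall>r\<in>R. Comp J (\<iota> (Some r)) (u r) = \<iota> None" by blast
  then show ?thesis
    by (intro exI[of _ l] bexI[of _ "\<iota> None"] exI[of _ "\<lambda>r. \<iota> (Some r)"]) auto
qed

lemma directed: "directed J"
  unfolding directed_def
proof (intro conjI ballI allI)
  show "Ob J \<noteq> {}"
  proof -
    have "\<exists>c\<in>Ob J. \<exists>\<iota>. \<forall>v\<in>{} :: bool set. \<iota> v \<in> Hom J undefined c"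
      by (rule upper_bound_family) (simp_all add: small_finite)
    then obtain c where "c \<in> Ob J" by (elim bexE)
    then show ?thesis by (metis empty_iff)
  qed
  show "\<exists>k u v. u \<in> Hom J i k \<and> v \<in> Hom J j k" if ij: "i \<in> Ob J" "j \<in> Ob J" for i j
  proof -
    have "\<exists>k\<in>Ob J. \<exists>\<iota>. \<forall>b\<in>UNIV. \<iota> b \<in> Hom J (if b then i else j) k"
      by (rule upper_bound_family) (use ij in \<open>simp_all add: small_finite\<close>)
    then show ?thesis by (metis UNIV_I)
  qed
  show "\<exists>k. \<exists>w\<in>Hom J j k. Comp J w u = Comp J w v"
    if uv: "u \<in> Hom J i j" "v \<in> Hom J i j" for i j u v
  proof -
    \<comment> \<open>Two vertices and two parallel edges: \<open>False\<close> is the source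
      \<open>i\<close>, \<open>True\<close> the target \<open>j\<close>, and the edges, again
      indexed by \<open>bool\<close>, are \<open>u\<close> and \<open>v\<close>.\<close>
    have "\<exists>k\<in>Ob J. \<exists>\<iota>. (\<forall>b\<in>UNIV. \<iota> b \<in> Hom J (if b then j else i) k) \<and>
        (\<forall>b\<in>UNIV. Comp J (\<iota> True) (if b then u else v) = \<iota> False)"
      by (rule bipartite_cocone) (use uv J.Hom_Ob[OF uv(1)] in \<open>simp_all add: small_finite\<close>)
    then show ?thesis by (metis UNIV_I)
  qed
qed

end

section \<open>Small objects\<close>

lemma Hom_set_cat: "M \<in> Hom set_cat S T \<longleftrightarrow> (\<exists>f \<in> S \<rightarrow>\<^sub>E T. M = (S, f, T))"
  by (auto simp: Hom_def set_cat_def)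

lemma Comp_set_cat: "Comp set_cat (S', g, T) (S, f, S'') = (S, compose S g f, T)"
  by (simp add: set_cat_def)

lemma hom_functor_FMor:
  assumes "f \<in> Hom C Y Z"
  shows "FMor (hom_functor C X) f = (Hom C X Y, \<lambda>g\<in>Hom C X Y. Comp C f g, Hom C X Z)"
  using assms by (auto simp: hom_functor_def Hom_def)

text \<open>The usual criterion for a directed colimit of sets: the legs are jointly surjective
  (\<open>factor\<close>), and elements with equal images agree at a later stage
  (\<open>separate\<close>). The latter compares elements of one stage only; \<open>t_eq\<close>
  first moves two elements to a common stage.\<close>

lemma hom_functor_colimit:
  assumes "category C" and "directed J" and J: "category J" and F: "is_functor J C F"
    and cc: "is_cocone J C F c \<iota>"
    and factor: "\<And>f. f \<in> Hom C X c \<Longrightarrow> \<exists>j\<in>Ob J. \<exists>g\<in>Hom C X (FOb F j). Comp C (\<iota> j) g = f"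
    and separate: "\<And>i g g'. \<lbrakk>i \<in> Ob J; g \<in> Hom C X (FOb F i); g' \<in> Hom C X (FOb F i);
        Comp C (\<iota> i) g = Comp C (\<iota> i) g'\<rbrakk>
      \<Longrightarrow> \<exists>k. \<exists>u\<in>Hom J i k. Comp C (FMor F u) g = Comp C (FMor F u) g'"
  shows "is_colimit J set_cat (comp_functor (hom_functor C X) F)
    (FOb (hom_functor C X) c) (\<lambda>j. FMor (hom_functor C X) (\<iota> j))"
proof -
  interpret C: category C by fact
  interpret J: category J by fact
  let ?H = "comp_functor (hom_functor C X) F"
  have \<iota>: "\<iota> j \<in> Hom C (FOb F j) c" if "j \<in> Ob J" for j
    using cc that by (simp add: is_cocone_def)
  have Fu: "FMor F u \<in> Hom C (FOb F i) (FOb F j)" if "u \<in> Hom J i j" for u i j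
    using F that by (simp add: is_functor_def)
  have \<iota>F: "Comp C (\<iota> j) (FMor F u) = \<iota> i" if "u \<in> Hom J i j" for u i j
    using cc that by (simp add: is_cocone_def)
  have FOb_H: "FOb ?H j = Hom C X (FOb F j)" for j
    by (simp add: comp_functor_def hom_functor_def)
  have FMor_H: "FMor ?H u = (Hom C X (FOb F i), \<lambda>g\<in>Hom C X (FOb F i). Comp C (FMor F u) g, Hom C X (FOb F j))"
    if "u \<in> Hom J i j" for u i j
    using hom_functor_FMor[OF Fu[OF that]] by (simp add: comp_functor_def)
  have FOb_c: "FOb (hom_functor C X) c = Hom C X c"
    by (simp add: hom_functor_def)
  note FMor_\<iota> = hom_functor_FMor[OF \<iota>, where X = X]
  show ?thesis
    unfolding is_colimit_def
  proof (intro conjI allI impI)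
    show "is_cocone J set_cat ?H (FOb (hom_functor C X) c) (\<lambda>j. FMor (hom_functor C X) (\<iota> j))"
      unfolding is_cocone_def FOb_H FOb_c
    proof (intro conjI ballI allI)
      show "Hom C X c \<in> Ob set_cat" by (simp add: set_cat_def)
      show "FMor (hom_functor C X) (\<iota> j) \<in> Hom set_cat (Hom C X (FOb F j)) (Hom C X c)" if "j \<in> Ob J" for j
        using C.Comp_in_Hom[OF _ \<iota>[OF that]] by (auto simp: Hom_set_cat FMor_\<iota>[OF that])
      show "Comp set_cat (FMor (hom_functor C X) (\<iota> j)) (FMor ?H u) = FMor (hom_functor C X) (\<iota> i)"
        if u: "u \<in> Hom J i j" for i j u
        using J.Hom_Ob[OF u] C.Comp_in_Hom[OF _ Fu[OF u]] C.Comp_assoc[OF _ Fu[OF u] \<iota>] \<iota>F[OF u]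
        by (auto simp: FMor_\<iota> FMor_H[OF u] Comp_set_cat compose_def restrict_def)
    qed
    fix D \<theta> assume D: "is_cocone J set_cat ?H D \<theta>"
    define t where "t j = fst (snd (\<theta> j))" for j
    have \<theta>: "\<theta> j = (Hom C X (FOb F j), t j, D)" "t j \<in> Hom C X (FOb F j) \<rightarrow>\<^sub>E D" if "j \<in> Ob J" for j
    proof -
      have "\<theta> j \<in> Hom set_cat (Hom C X (FOb F j)) D"
        using D that by (simp add: is_cocone_def FOb_H)
      then show "\<theta> j = (Hom C X (FOb F j), t j, D)" "t j \<in> Hom C X (FOb F j) \<rightarrow>\<^sub>E D"
        by (auto simp: Hom_set_cat t_def)
    qed
    have t: "t j (Comp C (FMor F u) g) = t i g" if u: "u \<in> Hom J i j" and g: "g \<in> Hom C X (FOb F i)" for i j u g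
    proof -
      have "Comp set_cat (\<theta> j) (FMor ?H u) = \<theta> i"
        using D u by (simp add: is_cocone_def)
      then have "compose (Hom C X (FOb F i)) (t j) (\<lambda>g\<in>Hom C X (FOb F i). Comp C (FMor F u) g) = t i"
        using J.Hom_Ob[OF u] \<theta> by (simp add: FMor_H[OF u] Comp_set_cat)
      from fun_cong[OF this, of g] show ?thesis using g by (simp add: compose_def)
    qed
    have t_eq: "t i g = t j g'"
      if i: "i \<in> Ob J" and j: "j \<in> Ob J" and g: "g \<in> Hom C X (FOb F i)" and g': "g' \<in> Hom C X (FOb F j)"
        and eq: "Comp C (\<iota> i) g = Comp C (\<iota> j) g'" for i j g g'
    proof -
      obtain k u v where u: "u \<in> Hom J i k" and v: "v \<in> Hom J j k"
        using \<open>directed J\<close> i j unfolding directed_def by meson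
      have k: "k \<in> Ob J" using J.Hom_Ob[OF u] by simp
      note ug = C.Comp_in_Hom[OF g Fu[OF u]] and vg = C.Comp_in_Hom[OF g' Fu[OF v]]
      have "Comp C (\<iota> k) (Comp C (FMor F u) g) = Comp C (\<iota> k) (Comp C (FMor F v) g')"
        using C.Comp_assoc[OF g Fu[OF u] \<iota>[OF k]] C.Comp_assoc[OF g' Fu[OF v] \<iota>[OF k]] \<iota>F[OF u] \<iota>F[OF v] eq
        by simp
      from separate[OF k ug vg this] obtain l w where w: "w \<in> Hom J k l"
        "Comp C (FMor F w) (Comp C (FMor F u) g) = Comp C (FMor F w) (Comp C (FMor F v) g')" by blast
      have "t i g = t l (Comp C (FMor F w) (Comp C (FMor F u) g))"
        using t[OF w(1) ug] t[OF u g] by simp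
      also have "\<dots> = t j g'" using w(2) t[OF w(1) vg] t[OF v g'] by simp
      finally show ?thesis .
    qed
    have "\<forall>f\<in>Hom C X c. \<exists>p. fst p \<in> Ob J \<and> snd p \<in> Hom C X (FOb F (fst p)) \<and> Comp C (\<iota> (fst p)) (snd p) = f"
      using factor by fastforce
    from bchoice[OF this] obtain p where p: "\<And>f. f \<in> Hom C X c \<Longrightarrow> fst (p f) \<in> Ob J \<and>
        snd (p f) \<in> Hom C X (FOb F (fst (p f))) \<and> Comp C (\<iota> (fst (p f))) (snd (p f)) = f"
      by blast
    \<comment> \<open>\<open>p f\<close> is an arbitrary factorisation of \<open>f\<close> through a
      leg; by \<open>t_eq\<close> the value does not depend on it.\<close>
    define h where "h = (\<lambda>f\<in>Hom C X c. t (fst (p f)) (snd (p f)))"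
    have h: "h (Comp C (\<iota> j) g) = t j g" if j: "j \<in> Ob J" and g: "g \<in> Hom C X (FOb F j)" for j g
    proof -
      have f: "Comp C (\<iota> j) g \<in> Hom C X c" by (rule C.Comp_in_Hom[OF g \<iota>[OF j]])
      then show ?thesis
        unfolding h_def using p[OF f] g j by (auto intro: t_eq)
    qed
    have h_fun: "h \<in> Hom C X c \<rightarrow>\<^sub>E D"
      using p \<theta>(2) by (fastforce simp: h_def)
    have comp_iff: "Comp set_cat (Hom C X c, f, D) (FMor (hom_functor C X) (\<iota> j)) = \<theta> j \<longleftrightarrow>
        (\<forall>g\<in>Hom C X (FOb F j). f (Comp C (\<iota> j) g) = t j g)" if j: "j \<in> Ob J" for f j
      using \<theta>[OF j] C.Comp_in_Hom[OF _ \<iota>[OF j]]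
      by (auto simp: FMor_\<iota>[OF j] Comp_set_cat compose_def fun_eq_iff restrict_def PiE_def extensional_def)
    show "\<exists>!h. h \<in> Hom set_cat (FOb (hom_functor C X) c) D \<and>
        (\<forall>j\<in>Ob J. Comp set_cat h (FMor (hom_functor C X) (\<iota> j)) = \<theta> j)"
      unfolding FOb_c
    proof (rule ex1I[of _ "(Hom C X c, h, D)"])
      show "(Hom C X c, h, D) \<in> Hom set_cat (Hom C X c) D \<and>
          (\<forall>j\<in>Ob J. Comp set_cat (Hom C X c, h, D) (FMor (hom_functor C X) (\<iota> j)) = \<theta> j)"
        using h h_fun by (auto simp: Hom_set_cat comp_iff)
    next
      fix M assume M: "M \<in> Hom set_cat (Hom C X c) D \<and>
          (\<forall>j\<in>Ob J. Comp set_cat M (FMor (hom_functor C X) (\<iota> j)) = \<theta> j)"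
      then obtain f where f: "M = (Hom C X c, f, D)" "f \<in> Hom C X c \<rightarrow>\<^sub>E D"
        by (auto simp: Hom_set_cat)
      have "f = h"
      proof (rule PiE_ext[OF f(2) h_fun])
        fix q assume "q \<in> Hom C X c"
        then obtain j g where "j \<in> Ob J" "g \<in> Hom C X (FOb F j)" "q = Comp C (\<iota> j) g"
          using factor by blast
        then show "f q = h q" using M f h by (simp add: comp_iff)
      qed
      then show "M = (Hom C X c, h, D)" using f by simp
    qed
  qed
qed

section \<open>Homomorphisms from small crossed groups into \<kappa>-filtered colimits\<close>

locale filtered_crs_functor = crs_functor A J \<mu> F + K: regular_cardinal \<kappa>
  for A :: "('o, 'm) category" and J :: "('j, 'n) category" and \<mu> :: "'u rel"
    and F :: "('j, 'n, ('o, 'm, 'u) crossed_group,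
      ('o, 'm, 'u) crossed_group \<times> ('o \<Rightarrow> 'u \<Rightarrow> 'u) \<times> ('o, 'm, 'u) crossed_group) functor_data"
    and \<kappa> :: "'k rel" +
  fixes c :: "('o, 'm, 'u) crossed_group"
    and \<iota> :: "'j \<Rightarrow> ('o, 'm, 'u) crossed_group \<times> ('o \<Rightarrow> 'u \<Rightarrow> 'u) \<times> ('o, 'm, 'u) crossed_group"
  assumes filtered: "filtered \<kappa> J"
    and colimit: "is_colimit J (CrsGrp \<mu> A) F c \<iota>"
    and small_Mor_A: "small \<kappa> (Mor A)"
begin

sublocale FJ: filtered_category \<kappa> J
  by unfold_locales (rule filtered)

lemma cocone_c: "is_cocone J (CrsGrp \<mu> A) F c \<iota>"
  using colimit by (simp add: is_colimit_def)

lemmas \<iota> = cocone_CrsGrpD(3)[OF cocone_c]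
  and \<iota>_map = cocone_map[OF cocone_CrsGrpD(2)[OF cocone_c]]

lemma \<iota>_D:
  "\<lbrakk>u \<in> Hom J i j; a \<in> Ob A; x \<in> carrier (grp (FOb F i) a)\<rbrakk>
    \<Longrightarrow> fam (\<iota> j) a (fam (FMor F u) a x) = fam (\<iota> i) a x"
  using cocone_CrsGrpD(2)[OF cocone_c] by (simp add: cocone_def)

text \<open>\<open>colimit_separates\<close> settles each equation at a stage of its own;
  \<open>coequalise_family\<close> yields one morphism \<open>z\<close> that factors through all the
  morphisms leading there.\<close>

lemma identify_family:
  assumes "small \<kappa> R" and j: "j \<in> Ob J"
    and R: "\<And>a x y. (a, x, y) \<in> R \<Longrightarrow> a \<in> Ob A \<and> x \<in> carrier (grp (FOb F j) a) \<and>
      y \<in> carrier (grp (FOb F j) a) \<and> fam (\<iota> j) a x = fam (\<iota> j) a y"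
  obtains k z where "z \<in> Hom J j k" "\<And>a x y. (a, x, y) \<in> R \<Longrightarrow> fam (FMor F z) a x = fam (FMor F z) a y"
proof -
  have "\<forall>r\<in>R. \<exists>p. case r of (a, x, y) \<Rightarrow> snd p \<in> Hom J j (fst p) \<and>
      fam (FMor F (snd p)) a x = fam (FMor F (snd p)) a y"
  proof
    fix r assume r: "r \<in> R"
    obtain a x y where axy: "r = (a, x, y)" by (cases r)
    then obtain k u where "u \<in> Hom J j k" "fam (FMor F u) a x = fam (FMor F u) a y"
      using colimit_separates[OF colimit FJ.directed j] R r by blast
    then show "\<exists>p. case r of (a, x, y) \<Rightarrow> snd p \<in> Hom J j (fst p) \<and>
      fam (FMor F (snd p)) a x = fam (FMor F (snd p)) a y"
      using axy by (intro exI[of _ "(k, u)"]) simp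
  qed
  from bchoice[OF this] obtain p where "\<forall>r\<in>R. case r of (a, x, y) \<Rightarrow>
      snd (p r) \<in> Hom J j (fst (p r)) \<and>
      fam (FMor F (snd (p r))) a x = fam (FMor F (snd (p r))) a y" ..
  then have p: "snd (p (a, x, y)) \<in> Hom J j (fst (p (a, x, y)))"
      "fam (FMor F (snd (p (a, x, y)))) a x = fam (FMor F (snd (p (a, x, y)))) a y"
    if "(a, x, y) \<in> R" for a x y
    using that by auto
  have "\<exists>l. \<exists>z\<in>Hom J j l. \<exists>w. \<forall>r\<in>R. w r \<in> Hom J (fst (p r)) l \<and> Comp J (w r) (snd (p r)) = z"
    by (rule FJ.coequalise_family[OF assms(1) j]) (use p in auto)
  then obtain l z w where zw: "z \<in> Hom J j l" "\<And>r. r \<in> R \<Longrightarrow> w r \<in> Hom J (fst (p r)) l"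
    "\<And>r. r \<in> R \<Longrightarrow> Comp J (w r) (snd (p r)) = z" by blast
  have "fam (FMor F z) a x = fam (FMor F z) a y" if r: "(a, x, y) \<in> R" for a x y
    using D_Comp[OF p(1)[OF r] zw(2)[OF r]] R[OF r] p(2)[OF r] zw(3)[OF r] by metis
  then show ?thesis using that zw(1) by blast
qed

context
  fixes X
  assumes X: "X \<in> Ob (CrsGrp \<mu> A)"
    and small_X: "small \<kappa> (SIGMA a:Ob A. carrier (grp X a))"
begin

interpretation X: crossed_group A X
  using X by (simp add: Ob_CrsGrp)

lemma small_carrier: "a \<in> Ob A \<Longrightarrow> small \<kappa> (carrier (grp X a))"
  by (rule K.small_subset[OF K.small_image[OF small_X, of snd]]) force

lemma separate:
  assumes i: "i \<in> Ob J" and g: "g \<in> Hom (CrsGrp \<mu> A) X (FOb F i)" and g': "g' \<in> Hom (CrsGrp \<mu> A) X (FOb F i)"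
    and eq: "Comp (CrsGrp \<mu> A) (\<iota> i) g = Comp (CrsGrp \<mu> A) (\<iota> i) g'"
  shows "\<exists>k. \<exists>u\<in>Hom J i k. Comp (CrsGrp \<mu> A) (FMor F u) g = Comp (CrsGrp \<mu> A) (FMor F u) g'"
proof -
  note gm = crossed_group_mapD(1)[OF Hom_CrsGrpD(5)[OF g]]
  note gm' = crossed_group_mapD(1)[OF Hom_CrsGrpD(5)[OF g']]
  obtain k z where z: "z \<in> Hom J i k"
    "\<And>a x y. (a, x, y) \<in> (\<lambda>(a, x). (a, fam g a x, fam g' a x)) ` (SIGMA a:Ob A. carrier (grp X a))
      \<Longrightarrow> fam (FMor F z) a x = fam (FMor F z) a y"
  proof (rule identify_family[OF K.small_image[OF small_X] i])
    fix a x y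
    assume "(a, x, y) \<in> (\<lambda>(a, x). (a, fam g a x, fam g' a x)) ` (SIGMA a:Ob A. carrier (grp X a))"
    then obtain t where t: "a \<in> Ob A" "t \<in> carrier (grp X a)" "x = fam g a t" "y = fam g' a t" by auto
    then show "a \<in> Ob A \<and> x \<in> carrier (grp (FOb F i) a) \<and>
        y \<in> carrier (grp (FOb F i) a) \<and> fam (\<iota> i) a x = fam (\<iota> i) a y"
      using gm gm' Comp_CrsGrp_apply[OF g t(1,2)] Comp_CrsGrp_apply[OF g' t(1,2)] eq by metis
  qed blast
  have "Comp (CrsGrp \<mu> A) (FMor F z) g = Comp (CrsGrp \<mu> A) (FMor F z) g'"
    by (rule Hom_CrsGrp_eqI[OF Comp_CrsGrp_in_Hom[OF g FMor[OF z(1)]] Comp_CrsGrp_in_Hom[OF g' FMor[OF z(1)]]])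
      (use z(2) in \<open>auto simp: Comp_CrsGrp_apply[OF g] Comp_CrsGrp_apply[OF g'] image_iff\<close>)
  then show ?thesis using z(1) by blast
qed

lemma factor:
  assumes f: "f \<in> Hom (CrsGrp \<mu> A) X c"
  shows "\<exists>j\<in>Ob J. \<exists>g\<in>Hom (CrsGrp \<mu> A) X (FOb F j). Comp (CrsGrp \<mu> A) (\<iota> j) g = f"
proof -
  note fm = crossed_group_mapD[OF Hom_CrsGrpD(5)[OF f]]
  let ?T = "SIGMA a:Ob A. carrier (grp X a)"
  have "\<forall>t\<in>?T. \<exists>p. fst p \<in> Ob J \<and> snd p \<in> carrier (grp (FOb F (fst p)) (fst t)) \<and>
      fam f (fst t) (snd t) = fam (\<iota> (fst p)) (fst t) (snd p)"
  proof
    fix t assume t: "t \<in> ?T"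
    then have "fam f (fst t) (snd t) \<in> carrier (grp c (fst t))" using fm(1) by auto
    with t obtain k x where "k \<in> Ob J" "x \<in> carrier (grp (FOb F k) (fst t))"
      "fam f (fst t) (snd t) = fam (\<iota> k) (fst t) x"
      using colimit_covers[OF colimit FJ.directed] by (metis (no_types, lifting) SigmaE fst_conv)
    then show "\<exists>p. fst p \<in> Ob J \<and> snd p \<in> carrier (grp (FOb F (fst p)) (fst t)) \<and>
      fam f (fst t) (snd t) = fam (\<iota> (fst p)) (fst t) (snd p)"
      by (intro exI[of _ "(k, x)"]) simp
  qed
  from bchoice[OF this] obtain p where "\<forall>t\<in>?T. fst (p t) \<in> Ob J \<and>
      snd (p t) \<in> carrier (grp (FOb F (fst (p t))) (fst t)) \<and>
      fam f (fst t) (snd t) = fam (\<iota> (fst (p t))) (fst t) (snd (p t))" ..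
  note p = bspec[OF this]
  \<comment> \<open>The elements of \<open>X\<close> have preimages at different stages; fewer than
    \<kappa> stages have a common bound \<open>j\<close>.\<close>
  have "\<exists>j\<in>Ob J. \<exists>v. \<forall>t\<in>?T. v t \<in> Hom J (fst (p t)) j"
    by (rule FJ.upper_bound_family[OF small_X]) (use p in blast)
  then obtain j v where j: "j \<in> Ob J" and v: "\<And>t. t \<in> ?T \<Longrightarrow> v t \<in> Hom J (fst (p t)) j"
    by blast
  \<comment> \<open>This lifts \<open>f\<close> only as a family of functions; it need not respect
    products or structure maps yet.\<close>
  define g where "g a x = fam (FMor F (v (a, x))) a (snd (p (a, x)))" for a x
  have g: "g a x \<in> carrier (grp (FOb F j) a)" "fam (\<iota> j) a (g a x) = fam f a x"
    if "a \<in> Ob A" "x \<in> carrier (grp X a)" for a x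
    using that p[of "(a, x)"] v[of "(a, x)"] D_closed[OF v] \<iota>_D[OF v] by (auto simp: g_def)
  interpret Gj: crossed_group A "FOb F j" using j by (rule crossed)
  \<comment> \<open>\<open>?R1\<close> collects the equations that make the lift multiplicative,
    \<open>?R2\<close> those that make it commute with structure maps. They hold in \<open>c\<close>
    because \<open>f\<close> and the leg at \<open>j\<close> are maps, and they number fewer than
    \<kappa> because \<open>X\<close> and \<open>Mor A\<close> are small.\<close>
  let ?R1 = "(\<lambda>(a, x, y). (a, g a (x \<otimes>\<^bsub>grp X a\<^esub> y), g a x \<otimes>\<^bsub>grp (FOb F j) a\<^esub> g a y)) `
    (SIGMA a:Ob A. carrier (grp X a) \<times> carrier (grp X a))"
  let ?R2 = "(\<lambda>(\<phi>, x). (Dom A \<phi>, g (Dom A \<phi>) (pull X \<phi> x), pull (FOb F j) \<phi> (g (Cod A \<phi>) x))) `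
    (SIGMA \<phi>:Mor A. carrier (grp X (Cod A \<phi>)))"
  have small_R: "small \<kappa> (?R1 \<union> ?R2)"
    using small_carrier K.small_Ob[OF A.category_axioms small_Mor_A] small_Mor_A A.Cod_in_Ob
    by (intro K.small_Un K.small_image K.small_Sigma) auto
  obtain k z where z: "z \<in> Hom J j k"
    and eq: "\<And>a x y. (a, x, y) \<in> ?R1 \<union> ?R2 \<Longrightarrow> fam (FMor F z) a x = fam (FMor F z) a y"
  proof (rule identify_family[OF small_R j])
    fix a l r assume "(a, l, r) \<in> ?R1 \<union> ?R2"
    then consider (mult) x y where "a \<in> Ob A" "x \<in> carrier (grp X a)" "y \<in> carrier (grp X a)"
        "l = g a (x \<otimes>\<^bsub>grp X a\<^esub> y)" "r = g a x \<otimes>\<^bsub>grp (FOb F j) a\<^esub> g a y"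
      | (pull) b \<phi> x where "\<phi> \<in> Hom A a b" "x \<in> carrier (grp X b)"
        "l = g a (pull X \<phi> x)" "r = pull (FOb F j) \<phi> (g b x)"
      by (auto simp: Hom_def)
    then show "a \<in> Ob A \<and> l \<in> carrier (grp (FOb F j) a) \<and>
      r \<in> carrier (grp (FOb F j) a) \<and> fam (\<iota> j) a l = fam (\<iota> j) a r"
    proof cases
      case mult
      then have "x \<otimes>\<^bsub>grp X a\<^esub> y \<in> carrier (grp X a)"
        using X.group_grp group.is_monoid monoid.m_closed by metis
      then show ?thesis
        using mult g fm(2) crossed_group_mapD(2)[OF \<iota>_map[OF j]] monoid.m_closed[OF monoid_G[OF j]]
        by simp
    next
      case pull
      then show ?thesis
        using g[OF _ X.restr_closed[OF pull(1,2)]] g[of b x] A.Hom_Ob[OF pull(1)] fm(3)[OF pull(1,2)]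
          crossed_group_mapD(3)[OF \<iota>_map[OF j] pull(1)] Gj.restr_closed[OF pull(1)]
        by simp
    qed
  qed blast
  have k: "k \<in> Ob J" using J.Hom_Ob[OF z] by simp
  define h where "h a x = fam (FMor F z) a (g a x)" for a x
  have h_map: "crossed_group_map A X (FOb F k) h"
  proof (rule crossed_group_mapI)
    fix a x assume a: "a \<in> Ob A" and x: "x \<in> carrier (grp X a)"
    show "h a x \<in> carrier (grp (FOb F k) a)"
      unfolding h_def by (rule D_closed[OF z a g(1)[OF a x]])
    fix y assume y: "y \<in> carrier (grp X a)"
    have "(a, g a (x \<otimes>\<^bsub>grp X a\<^esub> y), g a x \<otimes>\<^bsub>grp (FOb F j) a\<^esub> g a y) \<in> ?R1 \<union> ?R2"
      using a x y by (force simp: image_iff)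
    from eq[OF this] show "h a (x \<otimes>\<^bsub>grp X a\<^esub> y) = h a x \<otimes>\<^bsub>grp (FOb F k) a\<^esub> h a y"
      using D_mult[OF z a g(1)[OF a x] g(1)[OF a y]] by (simp add: h_def)
  next
    fix a b \<phi> x assume \<phi>: "\<phi> \<in> Hom A a b" and x: "x \<in> carrier (grp X b)"
    have b: "b \<in> Ob A" using A.Hom_Ob[OF \<phi>] by simp
    have "(a, g a (pull X \<phi> x), pull (FOb F j) \<phi> (g b x)) \<in> ?R1 \<union> ?R2"
      using \<phi> x by (force simp: image_iff Hom_def)
    from eq[OF this] show "h a (pull X \<phi> x) = pull (FOb F k) \<phi> (h b x)"
      using D_pull[OF z \<phi> g(1)[OF b x]] by (simp add: h_def)
    \<comment> \<open>No equation was imposed for the action: the transition map and the leg both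
      preserve it, so it already equals the action of \<open>f b x\<close> in
      \<open>c\<close>.\<close>
    show "act (FOb F k) (h b x) \<phi> = act X x \<phi>"
      using D_act[OF z \<phi> g(1)[OF b x]] crossed_group_mapD(4)[OF \<iota>_map[OF j] \<phi> g(1)[OF b x]]
        g(2)[OF b x] fm(4)[OF \<phi> x] by (simp add: h_def)
  qed
  let ?h = "crs_mor A X (FOb F k) h"
  have h: "?h \<in> Hom (CrsGrp \<mu> A) X (FOb F k)"
    using X FOb[OF k] h_map by (rule crs_mor_in_Hom)
  have "Comp (CrsGrp \<mu> A) (\<iota> k) ?h = f"
    by (rule Hom_CrsGrp_eqI[OF Comp_CrsGrp_in_Hom[OF h \<iota>[OF k]] f])
      (simp add: Comp_CrsGrp_apply[OF h] crs_mor_apply h_def \<iota>_D[OF z] g)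
  then show ?thesis using k h by blast
qed

lemma hom_preserves_colimit:
  "is_colimit J set_cat (comp_functor (hom_functor (CrsGrp \<mu> A) X) F)
    (FOb (hom_functor (CrsGrp \<mu> A) X) c) (\<lambda>j. FMor (hom_functor (CrsGrp \<mu> A) X) (\<iota> j))"
  by (rule hom_functor_colimit[OF category_CrsGrp[OF A.category_axioms] FJ.directed J.category_axioms
        is_functor cocone_c factor separate])

end

end

lemma small_object_CrsGrp:
  fixes A :: "('o, 'm) category" and \<kappa> :: "'k rel" and \<mu> :: "'u rel"
  assumes "category A" "Cinfinite \<kappa>" "regularCard \<kappa>" "small \<kappa> (Mor A)"
    and "Cinfinite \<mu>" "regularCard \<mu>" "natLeq <o \<mu>"
    and X: "X \<in> Ob (CrsGrp \<mu> A)" and small_X: "small \<kappa> (SIGMA a:Ob A. carrier (grp X a))"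
  shows "small_object \<mu> \<kappa> (CrsGrp \<mu> A) X"
  unfolding small_object_def preserves_colimits_def small_category_def
proof (intro conjI allI impI X)
  fix J :: "('u, 'u) category" and c \<iota>
  fix F :: "('u, 'u, ('o, 'm, 'u) crossed_group,
    ('o, 'm, 'u) crossed_group \<times> ('o \<Rightarrow> 'u \<Rightarrow> 'u) \<times> ('o, 'm, 'u) crossed_group) functor_data"
  assume "(category J \<and> small \<mu> (Ob J) \<and> small \<mu> (Mor J)) \<and> filtered \<kappa> J"
    and "is_functor J (CrsGrp \<mu> A) F \<and> is_colimit J (CrsGrp \<mu> A) F c \<iota>"
  then interpret filtered_crs_functor A J \<mu> F \<kappa> c \<iota>
    using assms
    by (simp add: filtered_crs_functor_def crs_functor_def regular_cardinal_def
        crs_functor_axioms_def filtered_crs_functor_axioms_def)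
  show "is_colimit J set_cat (comp_functor (hom_functor (CrsGrp \<mu> A) X) F)
      (FOb (hom_functor (CrsGrp \<mu> A) X) c) (\<lambda>j. FMor (hom_functor (CrsGrp \<mu> A) X) (\<iota> j))"
    by (rule hom_preserves_colimit[OF X small_X])
qed

section \<open>Crossed subgroups\<close>

text \<open>A subgroup is one set of pairs, so that its size counts the elements over all objects
  together. Only the carriers change, hence inclusions are the identity on elements.\<close>

definition crs_restrict ::
  "('o, 'm, 'u) crossed_group \<Rightarrow> ('o \<times> 'u) set \<Rightarrow> ('o, 'm, 'u) crossed_group" where
  "crs_restrict X S = X\<lparr>grp := (\<lambda>a. (grp X a)\<lparr>carrier := S `` {a}\<rparr>)\<rparr>"

lemma crs_restrict_simps [simp]:
  "carrier (grp (crs_restrict X S) a) = S `` {a}"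
  "x \<otimes>\<^bsub>grp (crs_restrict X S) a\<^esub> y = x \<otimes>\<^bsub>grp X a\<^esub> y"
  "\<one>\<^bsub>grp (crs_restrict X S) a\<^esub> = \<one>\<^bsub>grp X a\<^esub>"
  "pull (crs_restrict X S) = pull X"
  "act (crs_restrict X S) = act X"
  by (simp_all add: crs_restrict_def)

context crossed_group
begin

definition elements :: "('o \<times> 'u) set" where
  "elements = (SIGMA a:Ob A. carrier (grp G a))"

text \<open>The action imposes no closure condition, as it moves morphisms of \<open>A\<close> and
  not elements.\<close>

definition crossed_subgroup :: "('o \<times> 'u) set \<Rightarrow> bool" where
  "crossed_subgroup S \<longleftrightarrow> S \<subseteq> elements \<and> (\<forall>a\<in>Ob A. subgroup (S `` {a}) (grp G a)) \<and>
     (\<forall>a b. \<forall>\<phi>\<in>Hom A a b. \<forall>x. (b, x) \<in> S \<longrightarrow> (a, pull G \<phi> x) \<in> S)"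

lemma crossed_group_restrict:
  assumes S: "crossed_subgroup S"
  shows "crossed_group A (crs_restrict G S)"
proof -
  have carrier: "(a, x) \<in> S \<Longrightarrow> x \<in> carrier (grp G a)" for a x
    using S by (auto simp: crossed_subgroup_def elements_def)
  have "group (grp (crs_restrict G S) a)" if "a \<in> Ob A" for a
    using S that subgroup.subgroup_is_group[OF _ group_grp]
    by (simp add: crossed_subgroup_def crs_restrict_def)
  then show ?thesis
    using S carrier
    by (intro crossed_groupI)
      (auto simp: category_axioms crossed_subgroup_def restr_Ident restr_Comp act_closed act_one
        act_mult act_Comp pull_mult)
qed

definition step :: "('o \<times> 'u) set \<Rightarrow> ('o \<times> 'u) set" where
  "step S = S \<union> (\<lambda>a. (a, \<one>\<^bsub>grp G a\<^esub>)) ` Ob A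
     \<union> (\<lambda>((a, x), (b, y)). (a, x \<otimes>\<^bsub>grp G a\<^esub> y)) ` {(s, t) \<in> S \<times> S. fst s = fst t}
     \<union> (\<lambda>(a, x). (a, inv\<^bsub>grp G a\<^esub> x)) ` S
     \<union> (\<lambda>(\<phi>, b, x). (Dom A \<phi>, pull G \<phi> x)) ` {(\<phi>, s) \<in> Mor A \<times> S. Cod A \<phi> = fst s}"

definition generated :: "('o \<times> 'u) set \<Rightarrow> ('o \<times> 'u) set" where
  "generated S = (\<Union>n. (step ^^ n) S)"

lemma step_iter_mono: "m \<le> n \<Longrightarrow> (step ^^ m) S \<subseteq> (step ^^ n) S"
  by (rule lift_Suc_mono_le[of "\<lambda>n. (step ^^ n) S"]) (auto simp: step_def)

lemma step_elements:
  assumes "S \<subseteq> elements"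
  shows "step S \<subseteq> elements"
proof -
  have "a \<in> Ob A \<Longrightarrow> group (grp G a)" "a \<in> Ob A \<Longrightarrow> monoid (grp G a)" for a
    using group_grp group.is_monoid by blast+
  then show ?thesis
    using assms Dom_in_Ob restr_closed
    by (auto simp: step_def elements_def monoid.one_closed intro!: monoid.m_closed group.inv_closed
        restr_closed[of _ _ "Cod A _"] simp: Hom_def)
qed

lemma generated_supset: "S \<subseteq> generated S"
  using UN_upper[of 0 UNIV "\<lambda>n. (step ^^ n) S"] by (simp add: generated_def)

lemma generated_elements:
  assumes "S \<subseteq> elements"
  shows "generated S \<subseteq> elements"
proof -
  have "(step ^^ n) S \<subseteq> elements" for n
    using assms by (induction n) (auto dest: step_elements)
  then show ?thesis by (auto simp: generated_def)
qed

text \<open>All operations are finitary and the iterates of \<open>step\<close> increase, so the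
  arguments of an operation lie in a common iterate and its value in the next one.\<close>

lemma crossed_subgroup_generated:
  assumes S: "S \<subseteq> elements"
  shows "crossed_subgroup (generated S)"
  unfolding crossed_subgroup_def
proof (intro conjI ballI allI impI generated_elements[OF S])
  have step: "t \<in> generated S" if "t \<in> step ((step ^^ n) S)" for t n
    using that UN_upper[of "Suc n" UNIV "\<lambda>n. (step ^^ n) S"] by (auto simp: generated_def)
  show "subgroup (generated S `` {a}) (grp G a)" if a: "a \<in> Ob A" for a
  proof (rule group.subgroupI[OF group_grp[OF a]])
    show "generated S `` {a} \<subseteq> carrier (grp G a)"
      using generated_elements[OF S] by (auto simp: elements_def)
    show "generated S `` {a} \<noteq> {}"
      using step[of "(a, \<one>\<^bsub>grp G a\<^esub>)" 0] a by (auto simp: step_def)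
    show "inv\<^bsub>grp G a\<^esub> x \<in> generated S `` {a}" if x: "x \<in> generated S `` {a}" for x
    proof -
      obtain n where "(a, x) \<in> (step ^^ n) S" using x by (auto simp: generated_def)
      then show ?thesis using step[of "(a, inv\<^bsub>grp G a\<^esub> x)" n] by (force simp: step_def)
    qed
    show "x \<otimes>\<^bsub>grp G a\<^esub> y \<in> generated S `` {a}"
      if xy: "x \<in> generated S `` {a}" "y \<in> generated S `` {a}" for x y
    proof -
      obtain m n where "(a, x) \<in> (step ^^ m) S" "(a, y) \<in> (step ^^ n) S"
        using xy by (auto simp: generated_def)
      then have "(a, x) \<in> (step ^^ max m n) S" "(a, y) \<in> (step ^^ max m n) S"
        using step_iter_mono[of m "max m n"] step_iter_mono[of n "max m n"] by auto
      then have "(a, x \<otimes>\<^bsub>grp G a\<^esub> y) \<in> step ((step ^^ max m n) S)"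
        by (force simp: step_def image_iff)
      then show ?thesis using step by auto
    qed
  qed
  show "(a, pull G \<phi> x) \<in> generated S" if \<phi>: "\<phi> \<in> Hom A a b" and x: "(b, x) \<in> generated S" for a b \<phi> x
  proof -
    obtain n where "(b, x) \<in> (step ^^ n) S" using x by (auto simp: generated_def)
    then have "(a, pull G \<phi> x) \<in> step ((step ^^ n) S)"
      using \<phi> by (force simp: step_def image_iff Hom_def)
    then show ?thesis by (rule step)
  qed
qed

end

section \<open>The poset of small crossed subgroups\<close>

locale crs_object = crossed_group A X + K: regular_cardinal \<kappa> + M: regular_cardinal \<mu>
  for A :: "('o, 'm) category" and X :: "('o, 'm, 'u) crossed_group"
    and \<kappa> :: "'k rel" and \<mu> :: "'u rel" +
  assumes Mor_A: "natLeq *c |Mor A| <o \<kappa>"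
    and size_bound: "size_bound \<kappa> \<mu>"
    and X_in_Ob: "X \<in> Ob (CrsGrp \<mu> A)"
begin

lemma \<kappa>_less: "\<kappa> <o \<mu>"
  using size_bound by (simp add: size_bound_def)

text \<open>A cardinal product with the empty set is zero and bounds nothing; this is the origin of
  the case distinction in \<open>small_generated\<close>.\<close>

lemma natLeq_\<kappa>: "Mor A \<noteq> {} \<Longrightarrow> natLeq <o \<kappa>"
  using ordLeq_ordLess_trans[OF Card_order_Times1[OF natLeq_Card_order, of "Mor A"]] Mor_A
  by (simp add: cprod_def Field_card_of)

lemma small_Mor: "small \<kappa> (Mor A)"
  using ordLeq_ordLess_trans[OF ordLeq_cprod2[OF Cinfinite_Cnotzero[OF natLeq_Cinfinite]
        card_of_Card_order] Mor_A]
  unfolding small_def .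

lemmas small_Ob = K.small_Ob[OF category_axioms small_Mor]

lemma small_step:
  assumes "small \<kappa> S"
  shows "small \<kappa> (step S)"
proof -
  have "small \<kappa> {(s, t) \<in> S \<times> S. fst s = fst t}" "small \<kappa> {(\<phi>, s) \<in> Mor A \<times> S. Cod A \<phi> = fst s}"
    using assms small_Mor
    by (auto intro: K.small_subset[OF K.small_Sigma[of S "\<lambda>_. S"]]
        K.small_subset[OF K.small_Sigma[of "Mor A" "\<lambda>_. S"]])
  then show ?thesis
    unfolding step_def using assms small_Ob by (intro K.small_Un K.small_image)
qed

lemma small_generated:
  assumes "small \<kappa> S" "S \<subseteq> elements"
  shows "small \<kappa> (generated S)"
proof (cases "Mor A = {}")
  case True
  then have "Ob A = {}" using Ident_in_Hom by (auto simp: Hom_def)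
  then have "generated S = {}" using generated_elements[OF assms(2)] by (auto simp: elements_def)
  then show ?thesis by (simp add: K.small_finite)
next
  case False
  have "small \<kappa> ((step ^^ n) S)" for n
    using assms(1) by (induction n) (auto intro: small_step)
  moreover have "small \<kappa> (UNIV :: nat set)"
    unfolding small_def using card_of_nat natLeq_\<kappa>[OF False] ordIso_ordLess_trans by blast
  ultimately show ?thesis
    unfolding generated_def by (rule K.small_UN[rotated])
qed

lemma small_elements: "small \<mu> elements"
  unfolding elements_def using X_in_Ob K.small_less[OF \<kappa>_less small_Ob]
  by (intro M.small_Sigma) (auto simp: Ob_CrsGrp)

definition subs :: "('o \<times> 'u) set set" where
  "subs = {S. crossed_subgroup S \<and> small \<kappa> S}"

lemma subs_elements: "\<lbrakk>S \<in> subs; s \<in> S\<rbrakk> \<Longrightarrow> s \<in> elements"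
  by (auto simp: subs_def crossed_subgroup_def)

lemma generated_in_subs: "\<lbrakk>small \<kappa> S; S \<subseteq> elements\<rbrakk> \<Longrightarrow> generated S \<in> subs"
  by (simp add: subs_def crossed_subgroup_generated small_generated)

text \<open>Here the clause of \<open>size_bound\<close> that counts subsets of size below \<kappa>
  enters. It concerns subsets of \<open>'u\<close>, so \<open>elements\<close> is first embedded
  there.\<close>

lemma small_subs: "small \<mu> subs"
proof -
  obtain e :: "'o \<times> 'u \<Rightarrow> 'u" where e: "inj_on e elements"
    using small_elements by (rule M.small_embed)
  have "small \<mu> (e ` elements)" using small_elements by (rule M.small_image)
  then have "small \<mu> {T. T \<subseteq> e ` elements \<and> |T| <o \<kappa>}"
    using size_bound by (simp add: size_bound_def)
  moreover have "(`) e ` subs \<subseteq> {T. T \<subseteq> e ` elements \<and> |T| <o \<kappa>}"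
    using K.small_image by (auto simp: subs_def crossed_subgroup_def small_def)
  ultimately have "small \<mu> ((`) e ` subs)" by (rule M.small_subset)
  moreover have "inj_on ((`) e) subs"
    using inj_on_image_Pow[OF e] by (rule inj_on_subset) (auto simp: subs_def crossed_subgroup_def)
  ultimately show ?thesis using M.small_inj_on by blast
qed

lemma restrict_in_Ob: "S \<in> subs \<Longrightarrow> crs_restrict X S \<in> Ob (CrsGrp \<mu> A)"
  unfolding Ob_CrsGrp
proof (intro conjI ballI)
  assume S: "S \<in> subs"
  then show "crossed_group A (crs_restrict X S)" by (simp add: subs_def crossed_group_restrict)
  fix a
  have "S `` {a} \<subseteq> snd ` S" by force
  moreover have "small \<kappa> (snd ` S)"
    using S by (intro K.small_image) (simp add: subs_def)
  ultimately have "small \<kappa> (S `` {a})"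
    by (rule K.small_subset[rotated])
  then show "small \<mu> (carrier (grp (crs_restrict X S) a))"
    by (simp add: K.small_less[OF \<kappa>_less])
qed

lemma restrict_small_object:
  assumes S: "S \<in> subs"
  shows "small_object \<mu> \<kappa> (CrsGrp \<mu> A) (crs_restrict X S)"
proof (rule small_object_CrsGrp[OF category_axioms K.Cinfinite K.regular small_Mor M.Cinfinite
      M.regular _ restrict_in_Ob[OF S]])
  have "natLeq \<le>o \<kappa>" using K.Cinfinite natLeq_ordLeq_cinfinite by blast
  then show "natLeq <o \<mu>" using \<kappa>_less ordLeq_ordLess_trans by blast
  show "small \<kappa> (SIGMA a:Ob A. carrier (grp (crs_restrict X S) a))"
    using S by (auto simp: subs_def intro: K.small_subset)
qed

definition code :: "('o \<times> 'u) set \<times> ('o \<times> 'u) set \<Rightarrow> 'u" where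
  "code = (SOME e. inj_on e (subs \<times> subs))"

abbreviation decode :: "'u \<Rightarrow> ('o \<times> 'u) set \<times> ('o \<times> 'u) set" where
  "decode \<equiv> inv_into (subs \<times> subs) code"

lemma small_subs_Times: "small \<mu> (subs \<times> subs)"
  using small_subs by (simp add: M.small_Sigma)

lemma inj_code: "inj_on code (subs \<times> subs)"
proof -
  have "\<exists>e :: _ \<Rightarrow> 'u. inj_on e (subs \<times> subs)"
    using M.small_embed[OF small_subs_Times] by blast
  then show ?thesis unfolding code_def by (rule someI_ex)
qed

lemma decode_code [simp]: "\<lbrakk>S \<in> subs; S' \<in> subs\<rbrakk> \<Longrightarrow> decode (code (S, S')) = (S, S')"
  using inj_code by (simp add: inv_into_f_f)

lemma code_eq_iff: "\<lbrakk>S \<in> subs; S' \<in> subs; T \<in> subs; T' \<in> subs\<rbrakk>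
    \<Longrightarrow> code (S, S') = code (T, T') \<longleftrightarrow> S = T \<and> S' = T'"
  using inj_on_eq_iff[OF inj_code, of "(S, S')" "(T, T')"] by simp

text \<open>An object \<open>S\<close> of the poset of subgroups is coded by its identity \<open>(S, S)\<close>.\<close>

definition subcat :: "('u, 'u) category" where
  "subcat = \<lparr>Ob = (\<lambda>S. code (S, S)) ` subs,
     Mor = code ` {(S, S') \<in> subs \<times> subs. S \<subseteq> S'},
     Dom = (\<lambda>f. code (fst (decode f), fst (decode f))),
     Cod = (\<lambda>f. code (snd (decode f), snd (decode f))),
     Ident = (\<lambda>a. a),
     Comp = (\<lambda>g f. code (fst (decode f), snd (decode g)))\<rparr>"

lemma Ob_subcat: "a \<in> Ob subcat \<longleftrightarrow> (\<exists>S\<in>subs. a = code (S, S))"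
  by (auto simp: subcat_def)

lemma Hom_subcat: "f \<in> Hom subcat a b \<longleftrightarrow>
    (\<exists>S\<in>subs. \<exists>S'\<in>subs. S \<subseteq> S' \<and> f = code (S, S') \<and> a = code (S, S) \<and> b = code (S', S'))"
proof
  assume "f \<in> Hom subcat a b"
  then obtain S S' where "S \<in> subs" "S' \<in> subs" "S \<subseteq> S'" "f = code (S, S')"
    "a = Dom subcat f" "b = Cod subcat f"
    by (auto simp: Hom_def subcat_def)
  then show "\<exists>S\<in>subs. \<exists>S'\<in>subs. S \<subseteq> S' \<and> f = code (S, S') \<and> a = code (S, S) \<and> b = code (S', S')"
    by (auto simp: subcat_def)
qed (auto simp: Hom_def subcat_def)

lemma code_in_Hom:
  "\<lbrakk>S \<in> subs; S' \<in> subs; S \<subseteq> S'\<rbrakk> \<Longrightarrow> code (S, S') \<in> Hom subcat (code (S, S)) (code (S', S'))"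
  by (auto simp: Hom_subcat)

lemma Comp_subcat:
  "\<lbrakk>S \<in> subs; S' \<in> subs; T \<in> subs; T' \<in> subs\<rbrakk>
    \<Longrightarrow> Comp subcat (code (T, T')) (code (S, S')) = code (S, T')"
  by (simp add: subcat_def)

lemma Ident_subcat: "Ident subcat a = a"
  by (simp add: subcat_def)

lemma subcat_composable:
  assumes "f \<in> Hom subcat a b" "g \<in> Hom subcat b c"
  obtains S T U where "S \<in> subs" "T \<in> subs" "U \<in> subs" "S \<subseteq> T" "T \<subseteq> U"
    "f = code (S, T)" "g = code (T, U)" "a = code (S, S)" "c = code (U, U)"
proof -
  obtain S T where f: "S \<in> subs" "T \<in> subs" "S \<subseteq> T" "f = code (S, T)" "a = code (S, S)" "b = code (T, T)"
    using assms(1) unfolding Hom_subcat by blast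
  obtain T' U where g: "T' \<in> subs" "U \<in> subs" "T' \<subseteq> U" "g = code (T', U)" "b = code (T', T')" "c = code (U, U)"
    using assms(2) unfolding Hom_subcat by blast
  have "T' = T" using f(2,6) g(1,5) code_eq_iff[of T T T' T'] by simp
  then show ?thesis using f g by (intro that[of S T U]) simp_all
qed

lemma category_subcat: "category subcat"
proof
  show "Dom subcat f \<in> Ob subcat" "Cod subcat f \<in> Ob subcat" if "f \<in> Mor subcat" for f
    using that by (auto simp: subcat_def)
  show "Ident subcat a \<in> Hom subcat a a" if "a \<in> Ob subcat" for a
    using that by (auto simp: Hom_subcat Ob_subcat Ident_subcat)
  show "Comp subcat g f \<in> Hom subcat a c" if fg: "f \<in> Hom subcat a b" "g \<in> Hom subcat b c" for f g a b c
  proof -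
    obtain S T U where *: "S \<in> subs" "T \<in> subs" "U \<in> subs" "S \<subseteq> T" "T \<subseteq> U"
      "f = code (S, T)" "g = code (T, U)" "a = code (S, S)" "c = code (U, U)"
      using fg by (rule subcat_composable)
    then have "S \<subseteq> U" by simp
    with * show ?thesis by (auto simp: Hom_subcat Comp_subcat)
  qed
  show "Comp subcat f (Ident subcat a) = f" "Comp subcat (Ident subcat b) f = f"
    if "f \<in> Hom subcat a b" for f a b
    using that by (auto simp: Hom_subcat Comp_subcat Ident_subcat)
  show "Comp subcat h (Comp subcat g f) = Comp subcat (Comp subcat h g) f"
    if fg: "f \<in> Hom subcat a b" "g \<in> Hom subcat b c" and h: "h \<in> Hom subcat c d" for f g h a b c d
    by (rule subcat_composable[OF fg], rule subcat_composable[OF fg(2) h])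
      (use h in \<open>auto simp: Hom_subcat Comp_subcat code_eq_iff\<close>)
qed

lemma small_category_subcat: "small_category \<mu> subcat"
  unfolding small_category_def
proof (intro conjI category_subcat)
  show "small \<mu> (Ob subcat)"
    using small_subs by (simp add: subcat_def M.small_image)
  show "small \<mu> (Mor subcat)"
    unfolding subcat_def category.simps
    by (rule M.small_image, rule M.small_subset[OF small_subs_Times]) auto
qed

text \<open>By regularity, the union of fewer than \<kappa> small subgroups is still small, and the
  subgroup it generates is an upper bound. Commutation of the legs is automatic in a poset.\<close>

lemma filtered_subcat: "filtered \<kappa> subcat"
  unfolding filtered_def
proof (intro conjI allI impI category_subcat)
  fix I :: "('k, 'k) category" and F
  assume I: "category I \<and> |Mor I| <o \<kappa> \<and> is_functor I subcat F"
  interpret I: category I using I by simp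
  have small_Ob_I: "small \<kappa> (Ob I)"
    using I by (intro K.small_Ob) (auto simp: small_def)
  have "\<exists>S\<in>subs. FOb F i = code (S, S)" if "i \<in> Ob I" for i
    using I that by (auto simp: is_functor_def Ob_subcat)
  then obtain S where S: "\<And>i. i \<in> Ob I \<Longrightarrow> S i \<in> subs" "\<And>i. i \<in> Ob I \<Longrightarrow> FOb F i = code (S i, S i)"
    by metis
  let ?U = "generated (\<Union>i\<in>Ob I. S i)"
  have U: "?U \<in> subs"
  proof (rule generated_in_subs)
    show "small \<kappa> (\<Union>i\<in>Ob I. S i)"
      using S(1) by (intro K.small_UN small_Ob_I) (auto simp: subs_def)
    show "(\<Union>i\<in>Ob I. S i) \<subseteq> elements"
      using S(1) subs_elements by blast
  qed
  have "is_cocone I subcat F (code (?U, ?U)) (\<lambda>i. code (S i, ?U))"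
    unfolding is_cocone_def
  proof (intro conjI ballI allI)
    show "code (?U, ?U) \<in> Ob subcat" using U by (auto simp: Ob_subcat)
    show "code (S i, ?U) \<in> Hom subcat (FOb F i) (code (?U, ?U))" if "i \<in> Ob I" for i
      unfolding S(2)[OF that]
      using S(1)[OF that] U
      by (rule code_in_Hom) (use that generated_supset[of "\<Union>i\<in>Ob I. S i"] in blast)
    show "Comp subcat (code (S j, ?U)) (FMor F u) = code (S i, ?U)" if u: "u \<in> Hom I i j" for i j u
    proof -
      note ij = I.Hom_Ob[OF u]
      have "FMor F u \<in> Hom subcat (FOb F i) (FOb F j)"
        using I u by (simp add: is_functor_def)
      then obtain T T' where T: "T \<in> subs" "T' \<in> subs" "FMor F u = code (T, T')"
        "code (S i, S i) = code (T, T)" "code (S j, S j) = code (T', T')"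
        using S(2) ij unfolding Hom_subcat by auto
      then have "FMor F u = code (S i, S j)"
        using S(1) ij by (simp add: code_eq_iff)
      then show ?thesis using S ij U by (simp add: Comp_subcat)
    qed
  qed
  then show "\<exists>c \<iota>. is_cocone I subcat F c \<iota>" by blast
qed

definition subfunctor where
  "subfunctor = \<lparr>FOb = (\<lambda>a. crs_restrict X (fst (decode a))),
     FMor = (\<lambda>f. crs_mor A (crs_restrict X (fst (decode f))) (crs_restrict X (snd (decode f))) (\<lambda>a x. x))\<rparr>"

lemma FOb_subfunctor: "S \<in> subs \<Longrightarrow> FOb subfunctor (code (S, S)) = crs_restrict X S"
  by (simp add: subfunctor_def)

lemma FMor_subfunctor:
  "\<lbrakk>S \<in> subs; S' \<in> subs\<rbrakk> \<Longrightarrow> FMor subfunctor (code (S, S')) =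
     crs_mor A (crs_restrict X S) (crs_restrict X S') (\<lambda>a x. x)"
  by (simp add: subfunctor_def)

lemma inclusion:
  assumes "S \<in> subs" "S' \<in> subs" "S \<subseteq> S'"
  shows "crs_mor A (crs_restrict X S) (crs_restrict X S') (\<lambda>a x. x)
    \<in> Hom (CrsGrp \<mu> A) (crs_restrict X S) (crs_restrict X S')"
  using assms by (intro crs_mor_in_Hom restrict_in_Ob crossed_group_mapI) auto

lemma inclusion_X:
  assumes "S \<in> subs"
  shows "crs_mor A (crs_restrict X S) X (\<lambda>a x. x) \<in> Hom (CrsGrp \<mu> A) (crs_restrict X S) X"
  using assms subs_elements[OF assms]
  by (intro crs_mor_in_Hom restrict_in_Ob X_in_Ob crossed_group_mapI) (auto simp: elements_def)

lemma functor_subfunctor: "is_functor subcat (CrsGrp \<mu> A) subfunctor"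
  unfolding is_functor_def
proof (intro conjI ballI allI)
  show "FOb subfunctor a \<in> Ob (CrsGrp \<mu> A)" if "a \<in> Ob subcat" for a
    using that by (auto simp: Ob_subcat FOb_subfunctor restrict_in_Ob)
  show "FMor subfunctor f \<in> Hom (CrsGrp \<mu> A) (FOb subfunctor a) (FOb subfunctor b)"
    if "f \<in> Hom subcat a b" for f a b
    using that by (auto simp: Hom_subcat FOb_subfunctor FMor_subfunctor inclusion)
  show "FMor subfunctor (Ident subcat a) = Ident (CrsGrp \<mu> A) (FOb subfunctor a)"
    if "a \<in> Ob subcat" for a
    using that by (auto simp: Ob_subcat Ident_subcat FOb_subfunctor FMor_subfunctor Ident_CrsGrp)
  show "FMor subfunctor (Comp subcat g f) = Comp (CrsGrp \<mu> A) (FMor subfunctor g) (FMor subfunctor f)"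
    if fg: "f \<in> Hom subcat a b" "g \<in> Hom subcat b c" for f g a b c
  proof -
    obtain S S' T where *: "S \<in> subs" "S' \<in> subs" "T \<in> subs" "S \<subseteq> S'" "S' \<subseteq> T"
      "f = code (S, S')" "g = code (S', T)"
      using fg by (rule subcat_composable)
    then have ST: "S \<subseteq> T" by simp
    show ?thesis
      unfolding *(6,7) Comp_subcat[OF *(1,2,2,3)] FMor_subfunctor[OF *(1,2)]
        FMor_subfunctor[OF *(2,3)] FMor_subfunctor[OF *(1,3)]
      using *(4)
      by (intro Hom_CrsGrp_eqI[OF inclusion[OF *(1,3) ST]
            Comp_CrsGrp_in_Hom[OF inclusion[OF *(1,2,4)] inclusion[OF *(2,3,5)]]])
        (auto simp: Comp_CrsGrp_apply[OF inclusion[OF *(1,2,4)]] crs_mor_apply)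
  qed
qed

abbreviation leg where
  "leg a \<equiv> crs_mor A (crs_restrict X (fst (decode a))) X (\<lambda>a x. x)"

lemma cocone_leg: "is_cocone subcat (CrsGrp \<mu> A) subfunctor X leg"
  unfolding is_cocone_def
proof (intro conjI ballI allI X_in_Ob)
  show "leg a \<in> Hom (CrsGrp \<mu> A) (FOb subfunctor a) X" if "a \<in> Ob subcat" for a
    using that by (auto simp: Ob_subcat FOb_subfunctor inclusion_X)
  show "Comp (CrsGrp \<mu> A) (leg b) (FMor subfunctor f) = leg a" if "f \<in> Hom subcat a b" for f a b
  proof -
    obtain S S' where *: "S \<in> subs" "S' \<in> subs" "S \<subseteq> S'"
      "f = code (S, S')" "a = code (S, S)" "b = code (S', S')"
      using \<open>f \<in> Hom subcat a b\<close> by (auto simp: Hom_subcat)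
    have "Comp (CrsGrp \<mu> A) (crs_mor A (crs_restrict X S') X (\<lambda>a x. x))
        (crs_mor A (crs_restrict X S) (crs_restrict X S') (\<lambda>a x. x)) = crs_mor A (crs_restrict X S) X (\<lambda>a x. x)"
      using *(3)
      by (intro Hom_CrsGrp_eqI[OF Comp_CrsGrp_in_Hom[OF inclusion[OF *(1-3)] inclusion_X[OF *(2)]]
            inclusion_X[OF *(1)]])
        (auto simp: Comp_CrsGrp_apply[OF inclusion[OF *(1-3)]] crs_mor_apply)
    then show ?thesis using * by (simp add: FMor_subfunctor)
  qed
qed

text \<open>Each element of \<open>X\<close>, and each pair of elements over one object, lies in a
  small subgroup. A compatible family on these subgroups therefore determines a map, and its laws
  can be checked inside them.\<close>

lemma colimit_leg: "is_colimit subcat (CrsGrp \<mu> A) subfunctor X leg"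
  unfolding is_colimit_def
proof (intro conjI allI impI cocone_leg)
  fix H \<theta> assume cc: "is_cocone subcat (CrsGrp \<mu> A) subfunctor H \<theta>"
  define t where "t S = fam (\<theta> (code (S, S)))" for S
  have \<theta>: "\<theta> (code (S, S)) \<in> Hom (CrsGrp \<mu> A) (crs_restrict X S) H" if "S \<in> subs" for S
  proof -
    have "code (S, S) \<in> Ob subcat" using that by (auto simp: Ob_subcat)
    then show ?thesis using cc that FOb_subfunctor[OF that] unfolding is_cocone_def by metis
  qed
  have t_mono: "t S' a x = t S a x"
    if *: "S \<in> subs" "S' \<in> subs" "S \<subseteq> S'" and ax: "(a, x) \<in> S" for S S' a x
  proof -
    have "code (S, S') \<in> Hom subcat (code (S, S)) (code (S', S'))"
      using * by (rule code_in_Hom)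
    then have eq: "Comp (CrsGrp \<mu> A) (\<theta> (code (S', S'))) (FMor subfunctor (code (S, S'))) = \<theta> (code (S, S))"
      using cc unfolding is_cocone_def by blast
    have a: "a \<in> Ob A" "x \<in> carrier (grp (crs_restrict X S) a)"
      using ax subs_elements[OF *(1)] by (auto simp: elements_def)
    then show ?thesis
      using Comp_CrsGrp_apply[OF inclusion[OF *] a, of "\<theta> (code (S', S'))"] eq
      by (simp add: t_def FMor_subfunctor[OF *(1,2)] crs_mor_apply)
  qed
  define h where "h a x = t (generated {(a, x)}) a x" for a x
  have gen: "generated S \<in> subs" if "S \<subseteq> elements" "finite S" for S
    using that by (intro generated_in_subs K.small_finite)
  have h: "h a x = t S a x" if S: "S \<in> subs" and ax: "(a, x) \<in> S" for S a x
  proof -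
    let ?S0 = "generated {(a, x)}"
    have S0: "?S0 \<in> subs" using subs_elements[OF S ax] by (intro gen) auto
    \<comment> \<open>The legs at \<open>?S0\<close> and \<open>S\<close> are compared through the
      leg at a subgroup containing both.\<close>
    let ?U = "generated (?S0 \<union> S)"
    have U: "?U \<in> subs"
      using S S0 by (intro generated_in_subs K.small_Un) (auto simp: subs_def crossed_subgroup_def)
    have sub: "?S0 \<subseteq> ?U" "S \<subseteq> ?U" using generated_supset[of "?S0 \<union> S"] by auto
    have "(a, x) \<in> ?S0" using generated_supset[of "{(a, x)}"] by auto
    then show ?thesis
      using t_mono[OF S0 U sub(1), of a x] t_mono[OF S U sub(2) ax] by (simp add: h_def)
  qed
  note tm = crossed_group_mapD[OF Hom_CrsGrpD(5)[OF \<theta>], folded t_def, simplified]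
  have h_map: "crossed_group_map A X H h"
  proof (rule crossed_group_mapI)
    fix a x assume a: "a \<in> Ob A" and x: "x \<in> carrier (grp X a)"
    have S: "generated {(a, x)} \<in> subs" "(a, x) \<in> generated {(a, x)}"
      using a x generated_supset[of "{(a, x)}"] by (auto intro!: gen simp: elements_def)
    then show "h a x \<in> carrier (grp H a)"
      using tm(1)[OF S(1) a S(2)] by (simp add: h[OF S])
    fix y assume y: "y \<in> carrier (grp X a)"
    \<comment> \<open>Multiplicativity of a leg applies only if both factors lie in the same
      subgroup.\<close>
    have S: "generated {(a, x), (a, y)} \<in> subs" and xy: "(a, x) \<in> generated {(a, x), (a, y)}" "(a, y) \<in> generated {(a, x), (a, y)}"
      using a x y generated_supset[of "{(a, x), (a, y)}"] by (auto intro!: gen simp: elements_def)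
    then have "(a, x \<otimes>\<^bsub>grp X a\<^esub> y) \<in> generated {(a, x), (a, y)}"
      using a subgroup.m_closed[of "generated {(a, x), (a, y)} `` {a}" "grp X a" x y]
      by (auto simp: subs_def crossed_subgroup_def)
    then show "h a (x \<otimes>\<^bsub>grp X a\<^esub> y) = h a x \<otimes>\<^bsub>grp H a\<^esub> h a y"
      using tm(2)[OF S a xy] by (simp add: h[OF S] xy)
  next
    fix a b \<phi> x assume \<phi>: "\<phi> \<in> Hom A a b" and x: "x \<in> carrier (grp X b)"
    have S: "generated {(b, x)} \<in> subs" and bx: "(b, x) \<in> generated {(b, x)}"
      using Hom_Ob[OF \<phi>] x generated_supset[of "{(b, x)}"] by (auto intro!: gen simp: elements_def)
    then have "(a, pull X \<phi> x) \<in> generated {(b, x)}"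
      using \<phi> by (auto simp: subs_def crossed_subgroup_def)
    then show "h a (pull X \<phi> x) = pull H \<phi> (h b x)" "act H (h b x) \<phi> = act X x \<phi>"
      using tm(3,4)[OF S \<phi> bx] by (simp_all add: h[OF S] bx)
  qed
  have H: "H \<in> Ob (CrsGrp \<mu> A)" using cc by (simp add: is_cocone_def)
  let ?h = "crs_mor A X H h"
  have h_hom: "?h \<in> Hom (CrsGrp \<mu> A) X H"
    using X_in_Ob H h_map by (rule crs_mor_in_Hom)
  have X_carrier: "a \<in> Ob A \<and> x \<in> carrier (grp X a)" if "S \<in> subs" "(a, x) \<in> S" for S a x
    using subs_elements[OF that] by (simp add: elements_def)
  show "\<exists>!h. h \<in> Hom (CrsGrp \<mu> A) X H \<and> (\<forall>j\<in>Ob subcat. Comp (CrsGrp \<mu> A) h (leg j) = \<theta> j)"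
  proof (rule ex1I[of _ ?h])
    have "Comp (CrsGrp \<mu> A) ?h (crs_mor A (crs_restrict X S) X (\<lambda>a x. x)) = \<theta> (code (S, S))"
      if S: "S \<in> subs" for S
      by (rule Hom_CrsGrp_eqI[OF Comp_CrsGrp_in_Hom[OF inclusion_X[OF S] h_hom] \<theta>[OF S]])
        (use X_carrier[OF S] in
          \<open>auto simp: Comp_CrsGrp_apply[OF inclusion_X[OF S]] crs_mor_apply h[OF S] t_def\<close>)
    then show "?h \<in> Hom (CrsGrp \<mu> A) X H \<and> (\<forall>j\<in>Ob subcat. Comp (CrsGrp \<mu> A) ?h (leg j) = \<theta> j)"
      using h_hom by (auto simp: Ob_subcat)
  next
    fix g assume g: "g \<in> Hom (CrsGrp \<mu> A) X H \<and> (\<forall>j\<in>Ob subcat. Comp (CrsGrp \<mu> A) g (leg j) = \<theta> j)"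
    show "g = ?h"
    proof (rule Hom_CrsGrp_eqI[OF conjunct1[OF g] h_hom])
      fix a x assume a: "a \<in> Ob A" and x: "x \<in> carrier (grp X a)"
      have S: "generated {(a, x)} \<in> subs" and ax: "x \<in> carrier (grp (crs_restrict X (generated {(a, x)})) a)"
        using a x generated_supset[of "{(a, x)}"] by (auto intro!: gen simp: elements_def)
      \<comment> \<open>Uniqueness: the leg at the subgroup generated by \<open>x\<close> forces the
        value of \<open>g\<close> at \<open>x\<close>.\<close>
      have "code (generated {(a, x)}, generated {(a, x)}) \<in> Ob subcat"
        using S by (auto simp: Ob_subcat)
      then have "Comp (CrsGrp \<mu> A) g (crs_mor A (crs_restrict X (generated {(a, x)})) X (\<lambda>a x. x)) =
          \<theta> (code (generated {(a, x)}, generated {(a, x)}))"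
        using g S by fastforce
      then show "fam g a x = fam ?h a x"
        using Comp_CrsGrp_apply[OF inclusion_X[OF S] a ax, of g] a x ax
        by (simp add: crs_mor_apply h_def t_def)
    qed
  qed
qed

end

theorem theorem2p4:
  fixes A :: "('o, 'm) category" and \<kappa> :: "'k rel" and \<mu> :: "'u rel"
  assumes "category A"
    and "Cinfinite \<kappa>" and "regularCard \<kappa>"
    and "natLeq *c |Mor A| <o \<kappa>"
    and "size_bound \<kappa> \<mu>"
  shows "locally_presentable \<mu> \<kappa> (CrsGrp \<mu> A)"
  unfolding locally_presentable_def
proof (intro conjI ballI category_CrsGrp assms(1))
  have \<mu>: "Cinfinite \<mu>" "regularCard \<mu>" "\<kappa> <o \<mu>"
    using assms(5) by (auto simp: size_bound_def)
  \<comment> \<open>Strictness for \<open>\<mu>\<close> comes from \<open>\<kappa> <o \<mu>\<close>,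
    so this covers an empty \<open>A\<close> with countable \<open>\<kappa>\<close> as well.\<close>
  have "natLeq \<le>o \<kappa>" using assms(2) natLeq_ordLeq_cinfinite by blast
  then have "natLeq <o \<mu>" using \<mu>(3) ordLeq_ordLess_trans by blast
  then show "cocomplete \<mu> (CrsGrp \<mu> A)"
    by (rule cocomplete_CrsGrp[OF assms(1) \<mu>(1,2)])
  fix X assume X: "X \<in> Ob (CrsGrp \<mu> A)"
  then interpret crossed_group A X by (simp add: Ob_CrsGrp)
  interpret crs_object A X \<kappa> \<mu>
    by unfold_locales (fact assms \<mu> X)+
  have "small_object \<mu> \<kappa> (CrsGrp \<mu> A) (FOb subfunctor j)" if "j \<in> Ob subcat" for j
    using that by (auto simp: Ob_subcat FOb_subfunctor restrict_small_object)
  then show "\<exists>(J :: ('u, 'u) category) F \<iota>. small_category \<mu> J \<and> filtered \<kappa> J \<and>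
      is_functor J (CrsGrp \<mu> A) F \<and> (\<forall>j\<in>Ob J. small_object \<mu> \<kappa> (CrsGrp \<mu> A) (FOb F j)) \<and>
      is_colimit J (CrsGrp \<mu> A) F X \<iota>"
    using small_category_subcat filtered_subcat functor_subfunctor colimit_leg by blast
qed

end
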